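(* Let $n,m\in\mathbb{Z}_{\ge 0}$ and $a\in\mathbb{C}\setminus\mathbb{Z}$. Let $U_2$ be the function of $z$ in the upper half-plane obtained by setting $b=-n$ (i.e. as the limit $b\to -n$) in $$U_1+\frac{\pi\sin\pi(a+b)}{\sin\pi a\,\sin\pi b}\;{}_2F_1(a,b;\,m+1;\,z),\qquad U_1=(-1)^{m+1}m!\,\frac{\Gamma(a-m)\Gamma(b-m)}{\Gamma(a+b-m)}\,{}_2F_1(a,b;\,a+b-m;\,1-z).$$ Write $F={}_2F_1(-n,a;\,m+1;\,z)$. Then $U_2$ has the following expressions: (1) $$U_2=\frac{(-1)^{m+1}m!\,n!}{(1-a)_{m+n+1}}(1-z)^{m+n+1-a}\,{}_2F_1(m+1-a,\,m+n+1;\,m+n+2-a;\,1-z);$$ (2) $$U_2=\frac{(-1)^{m+1}m!\,n!}{(a-m)_{m+n+1}}(-z)^{-a}\,{}_2F_1\!\left(a,\,a-m;\,a+n+1;\,\tfrac1z\right)+\frac{\pi e^{i\pi a}}{\sin\pi a}\,F;$$ (3) $$\begin{aligned}U_2={}&F\log z+\frac{\pi}{\tan\pi a}F+\frac{(-1)^{m+1}m!\,n!}{(1-a)_m}z^{-m}\sum_{k=0}^{m-1}\frac{(a-m)_k\,(m-k-1)!}{(m+n-k)!\,k!}z^k\\&+\sum_{k=0}^{n}\frac{m!\,n!\,(a)_k}{(m+k)!\,(n-k)!\,k!}\big(\psi(a+k)+\psi(n-k+1)-\psi(m+k+1)-\psi(k+1)\big)(-z)^k\\&+(-1)^n n!\,m!\sum_{k=n+1}^{\infty}\frac{(a)_k\,(k-n-1)!}{(m+k)!\,k!}z^k;\end{aligned}$$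 (4) $$\begin{aligned}U_2={}&F\log z+\frac{(-1)^{m+1}m!}{(1-a)_m(m+n)!}z^{-m}(1-z)^{m+n+1-a}\sum_{k=0}^{m-1}\frac{(1-a)_k(m-k-1)!\,(n+k)!}{k!}(-z)^k\\&+\frac{m!}{(m+n)!}(1-z)^{m+n+1-a}\sum_{k=0}^{\infty}\frac{(m+1-a)_k(m+n+k)!}{(m+k)!\,k!}\big(\psi(m+k+1-a)+\psi(m+n+k+1)-\psi(m+k+1)-\psi(k+1)\big)z^k;\end{aligned}$$ (5) $$\begin{aligned}U_2={}&F\log\frac{z}{1-z}+\frac{\pi}{\tan\pi a}F+\frac{(-1)^{m+1}m!}{(1-a)_m(m+n)!}z^{-m}(1-z)^{m-a}\sum_{k=0}^{m-1}\frac{(a-m)_k(m-k-1)!\,(n+k)!}{k!}\frac{z^k}{(1-z)^k}\\&+\frac{m!}{(m+n)!}(1-z)^{-a}\sum_{k=0}^{\infty}\frac{(a)_k(m+n+k)!}{(m+k)!\,k!}\big(\psi(a+k)+\psi(m+n+k+1)-\psi(m+k+1)-\psi(k+1)\big)\frac{z^k}{(z-1)^k};\end{aligned}$$ (6) $$\begin{aligned}U_2={}&F\log\frac{z}{1-z}+\frac{(-1)^{m+1}m!\,n!}{(1-a)_m}z^{-m}(1-z)^{n+m}\sum_{k=0}^{m-1}\frac{(1-a)_k(m-k-1)!}{(m+n-k)!\,k!}\frac{z^k}{(z-1)^k}\\&+m!\,n!\,(1-z)^n\sum_{k=0}^{n}\frac{(m+1-a)_k}{(m+k)!\,(n-k)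!\,k!}\big(\psi(m+k+1-a)+\psi(n-k+1)-\psi(m+k+1)-\psi(k+1)\big)\frac{z^k}{(1-z)^k}\\&+m!\,n!\,(z-1)^n\sum_{k=n+1}^{\infty}\frac{(m+1-a)_k(k-n-1)!}{(m+k)!\,k!}\frac{z^k}{(z-1)^k}.\end{aligned}$$
   Context: ${}_2F_1(a,b;c;z)=\sum_{k\ge0}\frac{(a)_k(b)_k}{(c)_k\,k!}z^k$ is the Gauss hypergeometric function (analytically continued), $(x)_k=x(x+1)\cdots(x+k-1)$, and $\psi(x)=\Gamma'(x)/\Gamma(x)$. All identities are between analytic functions on the upper half-plane $\{\operatorname{Im} z>0\}$, with $\log$ and complex powers taking principal values and all hypergeometric functions being the principal analytic continuations. An expression with an explicit infinite series is asserted where that series converges ($|z|<1$ for series in $z$, $|z/(z-1)|<1$ for series in $z/(z-1)$), and elsewhere by analytic continuation. Sums $\sum_{k=0}^{m-1}$ are empty (zero) for $m=0$. The two summands in the definition of $U_2$ are individually singular at $b=-n$, but their sum extends analytically to $b=-n$. *)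

theory Defs
  imports "HOL-Complex_Analysis.Complex_Analysis"
begin

text \<open>
  The principal branch: the holomorphic function on the plane cut along the real half-line
  from 1 to infinity which is given by the Gauss series in the unit disc. It is unique there
  by the identity theorem. The value is meaningful for arguments off the cut and for a
  parameter \<open>c\<close> that is not a nonpositive integer.
\<close>
definition hyp2F1 :: "complex \<Rightarrow> complex \<Rightarrow> complex \<Rightarrow> complex \<Rightarrow> complex" where
  "hyp2F1 a b c = (SOME f. f holomorphic_on - (complex_of_real ` {1..}) \<and>
     (\<forall>z. norm z < 1 \<longrightarrow>
        f z = (\<Sum>k. pochhammer a k * pochhammer b k / (pochhammer c k * fact k) * z ^ k)))"

definition upper_half_plane :: "complex set" where
  "upper_half_plane = {z. Im z > 0}"

definition U1 :: "nat \<Rightarrow> complex \<Rightarrow> complex \<Rightarrow> complex \<Rightarrow> complex" where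
  "U1 m a b z = (-1) ^ (m + 1) * fact m *
     (Gamma (a - of_nat m) * Gamma (b - of_nat m) / Gamma (a + b - of_nat m)) *
     hyp2F1 a b (a + b - of_nat m) (1 - z)"

definition U2_generic :: "nat \<Rightarrow> complex \<Rightarrow> complex \<Rightarrow> complex \<Rightarrow> complex" where
  "U2_generic m a b z = U1 m a b z +
     of_real pi * sin (of_real pi * (a + b)) / (sin (of_real pi * a) * sin (of_real pi * b)) *
     hyp2F1 a b (of_nat m + 1) z"

text \<open>
  Both summands of \<^const>\<open>U2_generic\<close> have a pole at \<open>b = -n\<close>, so evaluating it at that point
  would give a meaningless value. The limit is over the punctured neighbourhood.
\<close>
definition U2 :: "nat \<Rightarrow> nat \<Rightarrow> complex \<Rightarrow> complex \<Rightarrow> complex" where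
  "U2 n m a z = Lim (at (- of_nat n)) (\<lambda>b. U2_generic m a b z)"

end

theory Submission
  imports Defs "HOL-Real_Asymp.Real_Asymp"
begin

text \<open>
  All six expressions are forms of one solution of Gauss's equation with parameters \<open>a\<close>, \<open>-n\<close>
  and \<open>m + 1\<close>.

  The first form explains why the limit exists. For generic \<open>b\<close> the connection formula between
  \<open>0\<close> and \<open>1\<close> (\<open>reg2F1_connection\<close>) writes \<open>F(a, b; m + 1; z)\<close> as a combination of
  \<open>F(a, b; a + b - m; 1 - z)\<close> and \<open>(1 - z)\<^sup>s F(m + 1 - a, m + 1 - b; 1 + s; 1 - z)\<close> with
  \<open>s = m + 1 - a - b\<close>. By the reflection formula the first of these terms is cancelled by the
  summand \<open>U1\<close>, and the factor of the second one is
  \<open>(-1)\<^sup>m\<^sup>+\<^sup>1 m! \<Gamma>(1 - a) \<Gamma>(1 - b) / \<Gamma>(1 + s)\<close>, which has no pole at \<open>b = -n\<close>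
  (\<open>U2_generic_near_1\<close>, \<open>U2_generic_eq\<close>). It remains to let \<open>b\<close> tend to \<open>-n\<close> at every point of the
  half-plane, which requires that the analytic continuation depend continuously on its
  parameters (\<open>tendsto_hyp2F1\<close>).

  The form with argument \<open>1/z\<close> is the same connection formula in the variable \<open>1/z\<close>, after Pfaff's
  transformation of the first form (\<open>U2_at_infinity\<close>).

  The four logarithmic forms come from a second limit. Keep \<open>b = -n\<close> and replace \<open>m + 1\<close> by
  \<open>c = m + 1 + \<epsilon>\<close>. The exponents \<open>0\<close> and \<open>1 - c\<close> at the origin then no longer differ by an
  integer, and the connection formula reads \<open>sin (\<pi> (1 - c)) / \<pi> \<cdot> \<Phi> = X - Y\<close>, where \<open>X\<close> is a
  power series and \<open>Y\<close> is \<open>z\<^sup>1\<^sup>-\<^sup>c\<close> times a power series. Both sides vanish at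
  \<open>\<epsilon> = 0\<close>, and the derivatives with respect to \<open>\<epsilon>\<close> at that point give the expansion: the power
  of \<open>z\<close> contributes the logarithm, the Gamma factors of the coefficients contribute the values of
  \<open>\<psi>\<close>, and the first \<open>m\<close> terms of \<open>Y\<close>, which have no counterpart in \<open>X\<close>, contribute the finite sum
  with the pole (\<open>log_limit\<close>, \<open>connection_log_limit\<close>). Before the limit is taken, each of the
  transformations of Euler and Pfaff may be applied to \<open>X\<close> and \<open>Y\<close>; the identity and these three
  transformations give the four forms (\<open>U2_log_expansion\<close>).

  Gauss's series is used in Olver's normalisation \<open>F(a, b; c; z) / \<Gamma>(c)\<close>, which is entire in the
  parameters. Its continuation to the cut plane is obtained from the conformal map
  \<open>w \<mapsto> 4w / (1 + w)\<^sup>2\<close> of the unit disc onto the cut plane: the pulled back equation has its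
  singularities other than the origin on the unit circle, so that the Taylor series at \<open>0\<close> of the
  pulled back solution converges in the whole disc, with bounds that are locally uniform in the
  parameters (\<open>pullback_coeff_bound\<close>).
\<close>

section \<open>The regularised Gauss series\<close>

text \<open>
  The factor \<open>1 / \<Gamma>(c + k)\<close> in place of \<open>1 / (c)\<^sub>k\<close> makes the coefficients entire in all
  three parameters. Nonpositive integer values of \<open>c\<close> do occur: in the second solution at the
  origin \<open>c\<close> tends to \<open>1 - m\<close>.
\<close>
definition reg2F1_coeff :: "complex \<Rightarrow> complex \<Rightarrow> complex \<Rightarrow> nat \<Rightarrow> complex" where
  "reg2F1_coeff a b c k = pochhammer a k * pochhammer b k * rGamma (c + of_nat k) / fact k"

definition reg2F1 :: "complex \<Rightarrow> complex \<Rightarrow> complex \<Rightarrow> complex \<Rightarrow> complex" where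
  "reg2F1 a b c x = (\<Sum>k. reg2F1_coeff a b c k * x ^ k)"

lemma norm_pochhammer_le:
  fixes a :: complex
  assumes "norm a \<le> R"
  shows "norm (pochhammer a k) \<le> pochhammer R k"
proof (induction k)
  case (Suc k)
  have "norm (a + of_nat k) \<le> R + of_nat k"
    using norm_triangle_ineq[of a "of_nat k"] assms by simp
  with Suc show ?case
    by (simp add: pochhammer_Suc norm_mult mult_mono')
qed simp

lemma norm_pochhammer_ge_fact:
  fixes a :: complex
  assumes "Re a \<ge> 1"
  shows "norm (pochhammer a k) \<ge> fact k"
proof (induction k)
  case (Suc k)
  have "1 + of_nat k \<le> Re (a + of_nat k)"
    using assms by simp
  also have "\<dots> \<le> norm (a + of_nat k)"
    by (rule complex_Re_le_cmod)
  finally have "fact k * (1 + real k) \<le> norm (pochhammer a k) * norm (a + of_nat k)"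
    using Suc by (intro mult_mono) auto
  also have "\<dots> = norm (pochhammer a (Suc k))"
    by (simp only: pochhammer_Suc norm_mult)
  finally show ?case
    by (simp add: algebra_simps)
qed simp

text \<open>
  By the recurrence, \<open>1 / \<Gamma>(c + N) = (c + N)\<^sub>j / \<Gamma>(c + N + j)\<close>. As soon as the real part of
  \<open>c + N\<close> is at least \<open>1\<close>, the Pochhammer symbol has modulus at least \<open>j!\<close>, and the left-hand side
  is bounded on compact sets.
\<close>
lemma rGamma_shift_bound:
  fixes B :: real
  obtains M :: real and N :: nat
    where "M \<ge> 0" "\<And>c k. norm (c :: complex) \<le> B \<Longrightarrow> norm (rGamma (c + of_nat k)) \<le> M / fact (k - N)"
proof -
  \<comment> \<open>large enough that \<open>Re (c + N) \<ge> 1\<close> for all \<open>c\<close> in question\<close>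
  define N where "N = nat \<lceil>\<bar>B\<bar>\<rceil> + 1"
  have N: "real N \<ge> \<bar>B\<bar> + 1"
    unfolding N_def by linarith
  have "compact (rGamma ` cball (0::complex) (\<bar>B\<bar> + N))"
    by (intro compact_continuous_image continuous_intros compact_cball)
  then obtain M where M: "\<And>z::complex. z \<in> cball 0 (\<bar>B\<bar> + N) \<Longrightarrow> norm (rGamma z) \<le> M"
    using compact_imp_bounded[of "rGamma ` cball (0::complex) (\<bar>B\<bar> + N)"]
    unfolding bounded_iff by (metis imageI)
  have M0: "M \<ge> 0"
    using M[of 0] by auto
  show ?thesis
  proof (rule that[of M N])
    fix c :: complex and k :: nat
    assume c: "norm c \<le> B"
    show "norm (rGamma (c + of_nat k)) \<le> M / fact (k - N)"
    proof (cases "k \<le> N")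
      case True
      have "norm (c + of_nat k) \<le> B + of_nat N"
        using norm_triangle_ineq[of c "of_nat k"] c True by simp
      hence "norm (rGamma (c + of_nat k)) \<le> M"
        by (intro M) auto
      thus ?thesis using True by simp
    next
      case False
      define j where "j = k - N"
      have k: "k = N + j" using False by (simp add: j_def)
      have cN: "norm (c + of_nat N) \<le> \<bar>B\<bar> + of_nat N"
        using norm_triangle_ineq[of c "of_nat N"] c by simp
      have "Re c \<ge> - norm c"
        using abs_Re_le_cmod[of c] by linarith
      hence Re: "Re (c + of_nat N) \<ge> 1"
        using c N by simp
      have "rGamma (c + of_nat N) = pochhammer (c + of_nat N) j * rGamma (c + of_nat N + of_nat j)"
        by (rule pochhammer_rGamma)
      hence "norm (rGamma (c + of_nat N)) = norm (pochhammer (c + of_nat N) j) * norm (rGamma (c + of_nat k))"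
        by (simp add: k norm_mult add_ac)
      moreover have "fact j * norm (rGamma (c + of_nat k)) \<le> norm (pochhammer (c + of_nat N) j) * norm (rGamma (c + of_nat k))"
        using norm_pochhammer_ge_fact[OF Re] by (intro mult_right_mono) auto
      moreover have "norm (rGamma (c + of_nat N)) \<le> M"
        using cN by (intro M) auto
      ultimately have "fact j * norm (rGamma (c + of_nat k)) \<le> M"
        by linarith
      thus ?thesis
        by (simp add: j_def[symmetric] field_simps)
    qed
  qed (use M0 in auto)
qed

lemma summable_reg2F1_majorant:
  fixes R \<rho> :: real
  assumes "R > 0" "0 \<le> \<rho>" "\<rho> < 1"
  shows "summable (\<lambda>k. pochhammer R k * pochhammer R k / (fact k * fact (k - N)) * \<rho> ^ k)"
proof -
  define h where "h k = pochhammer R k * pochhammer R k / (fact k * fact (k - N)) * \<rho> ^ k" for k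
  define c where "c = (1 + \<rho>) / 2"
  have c: "c < 1" "\<rho> < c" using assms by (auto simp: c_def)
  have "(\<lambda>k. (R + real k) ^ 2 / ((real k + 1) * (real k + 1 - real N)) * \<rho>) \<longlonglongrightarrow> \<rho>"
    by real_asymp
  hence "eventually (\<lambda>k. (R + real k) ^ 2 / ((real k + 1) * (real k + 1 - real N)) * \<rho> < c) sequentially"
    using c(2) by (rule order_tendstoD(2))
  then obtain K where K: "\<And>k. k \<ge> K \<Longrightarrow> (R + real k) ^ 2 / ((real k + 1) * (real k + 1 - real N)) * \<rho> < c"
    by (auto simp: eventually_sequentially)
  have "summable h"
  proof (rule summable_ratio_test[OF c(1), of "max K N"])
    fix k assume k: "k \<ge> max K N"
    have h0: "h k \<ge> 0"
      using assms by (auto simp: h_def intro!: mult_nonneg_nonneg divide_nonneg_nonneg less_imp_le[OF pochhammer_pos])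
    have "h (Suc k) = (R + real k) ^ 2 / ((real k + 1) * (real k + 1 - real N)) * \<rho> * h k"
      using k by (simp add: h_def pochhammer_Suc Suc_diff_le of_nat_diff field_simps power2_eq_square)
    also have "\<dots> \<le> c * h k"
      using K[of k] k h0 by (intro mult_right_mono) auto
    finally have "h (Suc k) \<le> c * h k" .
    moreover have "h (Suc k) \<ge> 0"
      using assms by (auto simp: h_def intro!: mult_nonneg_nonneg divide_nonneg_nonneg less_imp_le[OF pochhammer_pos])
    ultimately show "norm (h (Suc k)) \<le> c * norm (h k)"
      using h0 by simp
  qed
  thus ?thesis by (simp add: h_def [abs_def])
qed

text \<open>
  One summable bound serves all parameters in a ball. This allows the Weierstrass test with the
  parameters as variables.
\<close>
lemma reg2F1_uniform_majorant:
  fixes B \<rho> :: real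
  assumes "0 \<le> \<rho>" "\<rho> < 1"
  obtains h :: "nat \<Rightarrow> real" where "summable h"
    "\<And>a b c x k. norm a \<le> B \<Longrightarrow> norm b \<le> B \<Longrightarrow> norm c \<le> B \<Longrightarrow> norm x \<le> \<rho> \<Longrightarrow>
       norm (reg2F1_coeff a b c k * x ^ k) \<le> h k"
proof -
  obtain M N where MN: "M \<ge> 0" "\<And>c k. norm (c :: complex) \<le> B \<Longrightarrow> norm (rGamma (c + of_nat k)) \<le> M / fact (k - N)"
    using rGamma_shift_bound[of B] by metis
  define R where "R = \<bar>B\<bar> + 1"
  define h where "h k = M * (pochhammer R k * pochhammer R k / (fact k * fact (k - N)) * \<rho> ^ k)" for k
  show ?thesis
  proof (rule that[of h])
    show "summable h"
      unfolding h_def by (intro summable_mult summable_reg2F1_majorant) (use assms in \<open>auto simp: R_def\<close>)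
    fix a b c x :: complex and k :: nat
    assume *: "norm a \<le> B" "norm b \<le> B" "norm c \<le> B" "norm x \<le> \<rho>"
    have "norm (reg2F1_coeff a b c k * x ^ k) =
      norm (pochhammer a k) * norm (pochhammer b k) * norm (rGamma (c + of_nat k)) / fact k * norm x ^ k"
      by (simp add: reg2F1_coeff_def norm_mult norm_divide norm_power)
    also have "\<dots> \<le> pochhammer R k * pochhammer R k * (M / fact (k - N)) / fact k * \<rho> ^ k"
      using * assms MN
      by (intro mult_mono divide_right_mono norm_pochhammer_le power_mono MN(2)
           mult_nonneg_nonneg divide_nonneg_nonneg less_imp_le[OF pochhammer_pos]) (auto simp: R_def)
    also have "\<dots> = h k"
      by (simp add: h_def field_simps)
    finally show "norm (reg2F1_coeff a b c k * x ^ k) \<le> h k" .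
  qed
qed

lemma summable_reg2F1:
  assumes "norm x < 1"
  shows "summable (\<lambda>k. reg2F1_coeff a b c k * x ^ k)"
proof -
  define B where "B = max (norm a) (max (norm b) (norm c))"
  obtain h where h: "summable h" 
    "\<And>a b c y k. norm a \<le> B \<Longrightarrow> norm b \<le> B \<Longrightarrow> norm c \<le> B \<Longrightarrow> norm y \<le> norm x \<Longrightarrow>
       norm (reg2F1_coeff a b c k * y ^ k) \<le> h k"
    using reg2F1_uniform_majorant[of "norm x" B] assms by auto
  have "norm (reg2F1_coeff a b c k * x ^ k) \<le> h k" for k
    by (rule h(2)) (auto simp: B_def)
  thus ?thesis
    by (intro summable_comparison_test'[OF h(1)])
qed

lemma reg2F1_sums:
  assumes "norm x < 1"
  shows "(\<lambda>k. reg2F1_coeff a b c k * x ^ k) sums reg2F1 a b c x"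
  unfolding reg2F1_def using summable_reg2F1[OF assms] by (rule summable_sums)

lemma reg2F1_commute: "reg2F1 a b c x = reg2F1 b a c x"
  by (simp add: reg2F1_def reg2F1_coeff_def mult_ac)

lemma reg2F1_0 [simp]: "reg2F1 a b c 0 = rGamma c"
  using powser_zero[of "reg2F1_coeff a b c"] by (simp add: reg2F1_def reg2F1_coeff_def)

lemma reg2F1_coeff_diffs:
  "diffs (reg2F1_coeff a b c) k = a * b * reg2F1_coeff (a + 1) (b + 1) (c + 1) k"
proof -
  have *: "c + of_nat (Suc k) = c + 1 + of_nat k" by simp
  have "diffs (reg2F1_coeff a b c) k =
     (of_nat (Suc k) * (a * pochhammer (a + 1) k * (b * pochhammer (b + 1) k) * rGamma (c + 1 + of_nat k))) /
     (of_nat (Suc k) * fact k)"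
    by (simp only: diffs_def reg2F1_coeff_def pochhammer_rec fact_Suc * times_divide_eq_right)
  also have "\<dots> = (a * pochhammer (a + 1) k * (b * pochhammer (b + 1) k) * rGamma (c + 1 + of_nat k)) / fact k"
    by (rule nonzero_mult_divide_mult_cancel_left) (rule of_nat_neq_0)
  finally show ?thesis
    by (simp add: reg2F1_coeff_def mult_ac)
qed

lemma reg2F1_has_field_derivative:
  assumes "norm x < 1"
  shows "(reg2F1 a b c has_field_derivative a * b * reg2F1 (a + 1) (b + 1) (c + 1) x) (at x)"
proof -
  have "((\<lambda>x. \<Sum>k. reg2F1_coeff a b c k * x ^ k) has_field_derivative
      (\<Sum>k. diffs (reg2F1_coeff a b c) k * x ^ k)) (at x)"
    by (rule termdiffs_strong'[OF summable_reg2F1 assms])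
  also have "(\<Sum>k. diffs (reg2F1_coeff a b c) k * x ^ k) =
     (\<Sum>k. (a * b) * (reg2F1_coeff (a + 1) (b + 1) (c + 1) k * x ^ k))"
    by (simp add: reg2F1_coeff_diffs mult_ac)
  also have "\<dots> = a * b * reg2F1 (a + 1) (b + 1) (c + 1) x"
    unfolding reg2F1_def by (rule suminf_mult[OF summable_reg2F1[OF assms]])
  finally show ?thesis
    by (rule DERIV_cong_ev[THEN iffD1, rotated 3]) (auto simp: reg2F1_def)
qed

lemma reg2F1_has_field_derivative' [derivative_intros]:
  assumes "(f has_field_derivative f') (at x within A)" "norm (f x) < 1"
  shows "((\<lambda>x. reg2F1 a b c (f x)) has_field_derivative a * b * reg2F1 (a + 1) (b + 1) (c + 1) (f x) * f') (at x within A)"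
  using DERIV_chain2[OF reg2F1_has_field_derivative[OF assms(2)] assms(1)] .

lemma holomorphic_on_reg2F1: "reg2F1 a b c holomorphic_on ball 0 1"
  by (subst holomorphic_on_open[OF open_ball])
     (use reg2F1_has_field_derivative in \<open>auto simp: dist_0_norm intro!: exI\<close>)

lemma holomorphic_on_reg2F1' [holomorphic_intros]:
  assumes "f holomorphic_on A" "\<And>z. z \<in> A \<Longrightarrow> norm (f z) < 1"
  shows "(\<lambda>z. reg2F1 a b c (f z)) holomorphic_on A"
  using holomorphic_on_compose_gen[OF assms(1) holomorphic_on_reg2F1, of a b c] assms(2)
  by (auto simp: o_def image_subset_iff)

text \<open>
  This two-term recurrence is Gauss's equation, read coefficient by coefficient.
\<close>
lemma reg2F1_coeff_Suc:
  "(of_nat k + 1) * (c + of_nat k) * reg2F1_coeff a b c (Suc k) =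
   (a + of_nat k) * (b + of_nat k) * reg2F1_coeff a b c k"
proof -
  have "rGamma (c + of_nat k) = (c + of_nat k) * rGamma (c + of_nat (Suc k))"
    using rGamma_plus1[of "c + of_nat k"] by (simp add: add_ac)
  moreover have "fact (Suc k) = (of_nat k + 1) * (fact k :: complex)" by simp
  moreover have "(of_nat k + 1 :: complex) \<noteq> 0"
    using of_nat_neq_0[of k, where ?'a = complex] by (simp add: add.commute)
  ultimately show ?thesis
    unfolding reg2F1_coeff_def by (simp add: pochhammer_Suc divide_simps del: fact_Suc of_nat_Suc)
qed

lemma reg2F1_ode:
  assumes x: "norm x < 1"
  shows "x * (1 - x) * (a * b * (a + 1) * (b + 1) * reg2F1 (a + 2) (b + 2) (c + 2) x)
           + (c - (a + b + 1) * x) * (a * b * reg2F1 (a + 1) (b + 1) (c + 1) x)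
           - a * b * reg2F1 a b c x = 0"
proof -
  define t where "t = reg2F1_coeff a b c"
  define y y1 y2 where "y = reg2F1 a b c x" and "y1 = a * b * reg2F1 (a + 1) (b + 1) (c + 1) x"
    and "y2 = a * b * (a + 1) * (b + 1) * reg2F1 (a + 2) (b + 2) (c + 2) x"
  have S0: "(\<lambda>k. t k * x ^ k) sums y"
    unfolding t_def y_def by (rule reg2F1_sums[OF x])
  have S1: "(\<lambda>k. diffs t k * x ^ k) sums y1"
    using sums_mult[OF reg2F1_sums[OF x, of "a+1" "b+1" "c+1"], of "a * b"]
    by (simp add: t_def reg2F1_coeff_diffs y1_def mult_ac)
  have diffs2: "diffs (diffs t) k = a * b * ((a + 1) * (b + 1)) * reg2F1_coeff (a + 2) (b + 2) (c + 2) k" for k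
  proof -
    have "diffs (diffs t) k = a * b * diffs (reg2F1_coeff (a + 1) (b + 1) (c + 1)) k"
      by (simp add: t_def reg2F1_coeff_diffs diffs_def[of "diffs (reg2F1_coeff a b c)"]
          diffs_def[of "reg2F1_coeff (a + 1) (b + 1) (c + 1)"] del: of_nat_Suc)
    thus ?thesis
      by (simp add: reg2F1_coeff_diffs add.assoc)
  qed
  have S2: "(\<lambda>k. diffs (diffs t) k * x ^ k) sums y2"
    using sums_mult[OF reg2F1_sums[OF x, of "a+2" "b+2" "c+2"], of "a * b * ((a + 1) * (b + 1))"]
    by (simp add: diffs2 y2_def mult_ac)
  have times_x: "f sums (x * s)" if "g sums s" "f 0 = 0" "\<And>k. f (Suc k) = x * g k" for f g s
  proof -
    have "(\<lambda>k. f (Suc k)) sums (x * s)"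
      using sums_mult[OF that(1), of x] that(3) by simp
    thus ?thesis
      using sums_Suc_iff[of f "x * s"] that(2) by simp
  qed
  have T1: "(\<lambda>k. of_nat k * t k * x ^ k) sums (x * y1)"
    by (rule times_x[OF S1]) (auto simp: diffs_def)
  have T2: "(\<lambda>k. of_nat k * (of_nat k + 1) * t (Suc k) * x ^ k) sums (x * y2)"
    by (rule times_x[OF S2]) (auto simp: diffs_def algebra_simps)
  have T3: "(\<lambda>k. of_nat k * (of_nat k - 1) * t k * x ^ k) sums (x * (x * y2))"
    by (rule times_x[OF T2]) (auto simp: algebra_simps)
  have "(\<lambda>k. ((of_nat k * (of_nat k + 1) * t (Suc k) * x ^ k - of_nat k * (of_nat k - 1) * t k * x ^ k)
        + (c * (diffs t k * x ^ k) - (a + b + 1) * (of_nat k * t k * x ^ k))) - a * b * (t k * x ^ k))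
     sums (((x * y2 - x * (x * y2)) + (c * y1 - (a + b + 1) * (x * y1))) - a * b * y)"
    by (intro sums_diff sums_add sums_mult S0 S1 T1 T2 T3)
  moreover have "((of_nat k * (of_nat k + 1) * t (Suc k) * x ^ k - of_nat k * (of_nat k - 1) * t k * x ^ k)
        + (c * (diffs t k * x ^ k) - (a + b + 1) * (of_nat k * t k * x ^ k))) - a * b * (t k * x ^ k)
      = ((of_nat k + 1) * (c + of_nat k) * t (Suc k) - (a + of_nat k) * (b + of_nat k) * t k) * x ^ k" for k
    by (simp add: diffs_def algebra_simps)
  ultimately have "(\<lambda>k. 0) sums (((x * y2 - x * (x * y2)) + (c * y1 - (a + b + 1) * (x * y1))) - a * b * y)"
    using reg2F1_coeff_Suc[of _ c a b] by (simp add: t_def)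
  hence "((x * y2 - x * (x * y2)) + (c * y1 - (a + b + 1) * (x * y1))) - a * b * y = 0"
    using sums_unique2 sums_zero by blast
  thus ?thesis
    unfolding y_def[symmetric] y1_def[symmetric] y2_def[symmetric] by (simp add: algebra_simps)
qed

text \<open>
  Termwise differentiation with respect to a variable that moves all three parameters along a
  line. The values of \<open>\<psi>\<close> in the logarithmic expansions arise from the derivatives \<open>D k\<close>.
\<close>
lemma reg2F1_affine_parameters:
  fixes a0 a1 b0 b1 c0 c1 x :: complex
  assumes x: "norm x < 1"
  assumes D: "\<And>k. ((\<lambda>\<epsilon>. reg2F1_coeff (a0 + a1 * \<epsilon>) (b0 + b1 * \<epsilon>) (c0 + c1 * \<epsilon>) k) has_field_derivative D k) (at 0)"
  shows "summable (\<lambda>k. D k * x ^ k)"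
    and "((\<lambda>\<epsilon>. reg2F1 (a0 + a1 * \<epsilon>) (b0 + b1 * \<epsilon>) (c0 + c1 * \<epsilon>) x) has_field_derivative (\<Sum>k. D k * x ^ k)) (at 0)"
proof -
  define B where "B = norm a0 + norm a1 + (norm b0 + norm b1) + (norm c0 + norm c1)"
  obtain h where h: "summable h" 
    "\<And>a b c y k. norm a \<le> B \<Longrightarrow> norm b \<le> B \<Longrightarrow> norm c \<le> B \<Longrightarrow> norm y \<le> norm x \<Longrightarrow>
       norm (reg2F1_coeff a b c k * y ^ k) \<le> h k"
    using reg2F1_uniform_majorant[of "norm x" B] x by auto
  define f where "f k \<epsilon> = reg2F1_coeff (a0 + a1 * \<epsilon>) (b0 + b1 * \<epsilon>) (c0 + c1 * \<epsilon>) k * x ^ k" for k \<epsilon>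
  have diff: "f k field_differentiable (at \<epsilon>)" for k \<epsilon>
    unfolding f_def reg2F1_coeff_def pochhammer_prod
    by (rule holomorphic_on_imp_differentiable_at[of _ UNIV])
       (auto intro!: holomorphic_intros)
  have bound: "norm (f k \<epsilon>) \<le> h k" if "\<epsilon> \<in> ball 0 1" for k \<epsilon>
  proof -
    have *: "norm (p + q * \<epsilon>) \<le> norm p + norm q" for p q
      using norm_triangle_ineq[of p "q * \<epsilon>"] mult_left_le[of "norm \<epsilon>" "norm q"] that
      by (simp add: norm_mult)
    have "norm (a0 + a1 * \<epsilon>) \<le> B" "norm (b0 + b1 * \<epsilon>) \<le> B" "norm (c0 + c1 * \<epsilon>) \<le> B"
      using *[of a0 a1] *[of b0 b1] *[of c0 c1]
            norm_ge_zero[of a0] norm_ge_zero[of a1] norm_ge_zero[of b0] norm_ge_zero[of b1]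
            norm_ge_zero[of c0] norm_ge_zero[of c1]
      unfolding B_def by linarith+
    thus ?thesis
      unfolding f_def by (intro h(2)) auto
  qed
  obtain g g' where g: "\<And>\<epsilon>. \<epsilon> \<in> ball 0 1 \<Longrightarrow> (\<lambda>n. f n \<epsilon>) sums g \<epsilon> \<and> (\<lambda>n. deriv (f n) \<epsilon>) sums g' \<epsilon> \<and> (g has_field_derivative g' \<epsilon>) (at \<epsilon>)"
  proof (rule series_and_derivative_comparison[of "ball 0 1" h f "\<lambda>n. deriv (f n)"], goal_cases)
    case (5 g g')
    thus ?case using that by blast
  next
    show "(f n has_field_derivative deriv (f n) \<epsilon>) (at \<epsilon>)" for n \<epsilon>
      using diff by (rule field_differentiable_derivI)
    show "\<forall>\<^sub>F n in sequentially. \<forall>\<epsilon>\<in>ball 0 1. norm (f n \<epsilon>) \<le> h n"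
      using bound by auto
  qed (use h(1) in auto)
  have f': "deriv (f k) 0 = D k * x ^ k" for k
    unfolding f_def by (intro DERIV_imp_deriv DERIV_cmult_right D)
  have s: "(\<lambda>k. D k * x ^ k) sums g' 0"
    using g[of 0] by (simp add: f')
  thus "summable (\<lambda>k. D k * x ^ k)" by (rule sums_summable)
  have "g' 0 = (\<Sum>k. D k * x ^ k)" using s by (rule sums_unique)
  moreover have "((\<lambda>\<epsilon>. reg2F1 (a0 + a1 * \<epsilon>) (b0 + b1 * \<epsilon>) (c0 + c1 * \<epsilon>) x) has_field_derivative g' 0) (at 0)"
  proof (rule has_field_derivative_transform_within_open)
    show "(g has_field_derivative g' 0) (at 0)" "open (ball (0::complex) 1)" "0 \<in> ball (0::complex) 1"
      using g[of 0] by auto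
    fix \<epsilon> :: complex assume "\<epsilon> \<in> ball 0 1"
    thus "g \<epsilon> = reg2F1 (a0 + a1 * \<epsilon>) (b0 + b1 * \<epsilon>) (c0 + c1 * \<epsilon>) x"
      using g[of \<epsilon>] unfolding reg2F1_def f_def by (simp add: sums_unique)
  qed
  ultimately show "((\<lambda>\<epsilon>. reg2F1 (a0 + a1 * \<epsilon>) (b0 + b1 * \<epsilon>) (c0 + c1 * \<epsilon>) x) has_field_derivative (\<Sum>k. D k * x ^ k)) (at 0)"
    by simp
qed

section \<open>Gauss's equation and the transformations of Pfaff and Euler\<close>

text \<open>
  The derivatives are taken with \<open>deriv\<close>, so that a solution is a single function and changes
  of variable can be stated for it alone. The definition is meaningful on open sets.
\<close>
definition solves_gauss :: "complex \<Rightarrow> complex \<Rightarrow> complex \<Rightarrow> complex set \<Rightarrow> (complex \<Rightarrow> complex) \<Rightarrow> bool" where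
  "solves_gauss a b c A f \<longleftrightarrow> f holomorphic_on A \<and>
     (\<forall>x\<in>A. x * (1 - x) * deriv (deriv f) x + (c - (a + b + 1) * x) * deriv f x - a * b * f x = 0)"

lemma solves_gaussI:
  assumes "open A"
    and "\<And>x. x \<in> A \<Longrightarrow> (f has_field_derivative f1 x) (at x)"
    and "\<And>x. x \<in> A \<Longrightarrow> (f1 has_field_derivative f2 x) (at x)"
    and "\<And>x. x \<in> A \<Longrightarrow> x * (1 - x) * f2 x + (c - (a + b + 1) * x) * f1 x - a * b * f x = 0"
  shows "solves_gauss a b c A f"
proof -
  have d1: "deriv f x = f1 x" if "x \<in> A" for x
    using assms(2)[OF that] by (rule DERIV_imp_deriv)
  have d2: "deriv (deriv f) x = f2 x" if x: "x \<in> A" for x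
  proof -
    have "(deriv f has_field_derivative f2 x) (at x)"
      by (rule has_field_derivative_transform_within_open[OF assms(3)[OF x] assms(1) x]) (simp add: d1)
    thus ?thesis by (rule DERIV_imp_deriv)
  qed
  have "f holomorphic_on A"
    using assms(1,2) by (subst holomorphic_on_open) auto
  thus ?thesis
    using assms(4) by (simp add: solves_gauss_def d1 d2)
qed

lemma solves_gaussD:
  assumes "solves_gauss a b c A f" "open A" "x \<in> A"
  shows "(f has_field_derivative deriv f x) (at x)"
    and "(deriv f has_field_derivative deriv (deriv f) x) (at x)"
    and "x * (1 - x) * deriv (deriv f) x + (c - (a + b + 1) * x) * deriv f x - a * b * f x = 0"
  using assms holomorphic_derivI[of f A x] holomorphic_derivI[of "deriv f" A x] holomorphic_deriv[of f A]
  by (auto simp: solves_gauss_def)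

lemma solves_gauss_subset:
  "solves_gauss a b c A f \<Longrightarrow> B \<subseteq> A \<Longrightarrow> solves_gauss a b c B f"
  using holomorphic_on_subset by (auto simp: solves_gauss_def)

lemma solves_gauss_reg2F1: "solves_gauss a b c (ball 0 1) (reg2F1 a b c)"
proof (rule solves_gaussI)
  fix x :: complex assume "x \<in> ball 0 1"
  hence x: "norm x < 1" by simp
  show "(reg2F1 a b c has_field_derivative a * b * reg2F1 (a + 1) (b + 1) (c + 1) x) (at x)"
    using x by (rule reg2F1_has_field_derivative)
  show "((\<lambda>x. a * b * reg2F1 (a + 1) (b + 1) (c + 1) x) has_field_derivative
      a * b * (a + 1) * (b + 1) * reg2F1 (a + 2) (b + 2) (c + 2) x) (at x)"
    using DERIV_cmult[OF reg2F1_has_field_derivative[OF x, of "a+1" "b+1" "c+1"], of "a * b"]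
    by (simp add: add.assoc mult.assoc)
  show "x * (1 - x) * (a * b * (a + 1) * (b + 1) * reg2F1 (a + 2) (b + 2) (c + 2) x) +
      (c - (a + b + 1) * x) * (a * b * reg2F1 (a + 1) (b + 1) (c + 1) x) - a * b * reg2F1 a b c x = 0"
    by (rule reg2F1_ode[OF x])
qed auto

text \<open>
  The equation is a recurrence for the Taylor coefficients. It determines all of them from the
  constant one, because the factor \<open>c + k\<close> never vanishes.
\<close>
lemma reg2F1_unique:
  assumes r: "r > 0" "r \<le> 1" and f: "solves_gauss a b c (ball 0 r) f" and c: "c \<notin> \<int>\<^sub>\<le>\<^sub>0"
    and x: "norm x < r"
  shows "f x = f 0 * Gamma c * reg2F1 a b c x"
proof -
  define F where "F = fps_expansion f 0"
  have hol: "f holomorphic_on ball 0 r" using f by (simp add: solves_gauss_def)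
  have F: "f has_fps_expansion F"
    unfolding F_def using hol r by (intro has_fps_expansion_fps_expansion[of "ball 0 r"]) auto
  have "(\<lambda>x. x * (1 - x) * deriv (deriv f) x + (c - (a + b + 1) * x) * deriv f x - a * b * f x)
     has_fps_expansion (fps_X * (1 - fps_X) * fps_deriv (fps_deriv F)
       + (fps_const c - fps_const (a + b + 1) * fps_X) * fps_deriv F - fps_const (a * b) * F)" 
    by (intro fps_expansion_intros F)
  moreover have "(\<lambda>x. x * (1 - x) * deriv (deriv f) x + (c - (a + b + 1) * x) * deriv f x - a * b * f x)
     has_fps_expansion 0"
  proof -
    have "eventually (\<lambda>x. x \<in> ball 0 r) (nhds (0::complex))"
      using r by (intro eventually_nhds_in_open) auto
    thus ?thesis
      unfolding has_fps_expansion_0_iff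
      by eventually_elim (use f in \<open>simp add: solves_gauss_def\<close>)
  qed
  ultimately have eq: "fps_X * (1 - fps_X) * fps_deriv (fps_deriv F)
       + (fps_const c - fps_const (a + b + 1) * fps_X) * fps_deriv F - fps_const (a * b) * F = 0"
    by (rule fps_expansion_unique_complex)
  have eq': "fps_X * fps_deriv (fps_deriv F) - fps_X * (fps_X * fps_deriv (fps_deriv F))
       + fps_const c * fps_deriv F - fps_const (a + b + 1) * (fps_X * fps_deriv F) - fps_const (a * b) * F = 0"
    using eq by (simp add: algebra_simps)
  have rec: "(of_nat k + 1) * (c + of_nat k) * F $ (Suc k) = (a + of_nat k) * (b + of_nat k) * F $ k" for k
  proof -
    have "(fps_X * fps_deriv (fps_deriv F) - fps_X * (fps_X * fps_deriv (fps_deriv F))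
       + fps_const c * fps_deriv F - fps_const (a + b + 1) * (fps_X * fps_deriv F) - fps_const (a * b) * F) $ k = 0"
      by (simp only: eq' fps_zero_nth)
    thus ?thesis
      by (cases k; cases "k - 1") (simp_all add: algebra_simps)
  qed
  have coeff: "F $ k = f 0 * Gamma c * reg2F1_coeff a b c k" for k
  proof (induction k)
    case 0
    have "F $ 0 = f 0" using has_fps_expansion_imp_0_eq_fps_nth_0[OF F] by simp
    moreover have "Gamma c * rGamma c = 1"
      using c by (simp add: rGamma_inverse_Gamma Gamma_eq_zero_iff)
    ultimately show ?case
      by (simp add: reg2F1_coeff_def mult.assoc)
  next
    case (Suc k)
    have nz: "(of_nat k + 1) * (c + of_nat k) \<noteq> 0"
    proof -
      have "c \<noteq> - of_nat k" using c by auto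
      hence "c + of_nat k \<noteq> 0" by (metis add_eq_0_iff minus_minus)
      moreover have "(of_nat k + 1 :: complex) \<noteq> 0"
        using of_nat_neq_0[of k, where ?'a = complex] by (simp add: add.commute)
      ultimately show ?thesis by simp
    qed
    have "(of_nat k + 1) * (c + of_nat k) * F $ (Suc k) =
          f 0 * Gamma c * ((a + of_nat k) * (b + of_nat k) * reg2F1_coeff a b c k)"
      unfolding rec Suc.IH by (simp only: mult_ac)
    also have "\<dots> = (of_nat k + 1) * (c + of_nat k) * (f 0 * Gamma c * reg2F1_coeff a b c (Suc k))"
      using reg2F1_coeff_Suc[of k c a b] by (simp add: mult.left_commute mult.assoc)
    finally show ?case
      using nz mult_left_cancel by blast
  qed
  have "(\<lambda>k. F $ k * x ^ k) sums f x"
    by (rule has_fps_expansion_imp_sums_complex[OF F, of r]) (use hol x in auto)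
  moreover have "(\<lambda>k. F $ k * x ^ k) sums (f 0 * Gamma c * reg2F1 a b c x)"
    using sums_mult[OF reg2F1_sums, of x "f 0 * Gamma c" a b c] x r by (simp add: coeff mult.assoc)
  ultimately show ?thesis
    by (rule sums_unique2)
qed

text \<open>
  Chain rule. With \<open>u = 1 / (1 - x)\<close>, the equation for the transformed function follows from the
  one for \<open>h\<close> as a polynomial identity modulo \<open>(1 - x) u = 1\<close>.
\<close>
lemma solves_gauss_pfaff:
  assumes "solves_gauss a (c - b) c B h" "open A" "open B"
    and AB: "\<And>x. x \<in> A \<Longrightarrow> 1 - x \<notin> \<real>\<^sub>\<le>\<^sub>0 \<and> x / (x - 1) \<in> B"
  shows "solves_gauss a b c A (\<lambda>x. (1 - x) powr (- a) * h (x / (x - 1)))"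
proof (rule solves_gaussI[OF assms(2)])
  fix x assume x: "x \<in> A"
  define u where "u = inverse (1 - x)"
  define P where "P = (1 - x) powr (- a)"
  define y where "y = x / (x - 1)"
  have nz: "1 - x \<noteq> 0" using AB[OF x] by auto
  hence u: "(1 - x) * u = 1" by (simp add: u_def)
  have y: "y = - x * u" using nz by (simp add: y_def u_def field_simps)
  have dP: "((\<lambda>x. (1 - x) powr (- a)) has_field_derivative a * P * u) (at x)"
    using AB[OF x] nz
    by (auto intro!: derivative_eq_intros simp: P_def u_def powr_diff field_simps)
  have du: "((\<lambda>x. inverse (1 - x)) has_field_derivative u ^ 2) (at x)"
    using nz by (auto intro!: derivative_eq_intros simp: u_def power2_eq_square)
  have dy: "((\<lambda>x. x / (x - 1)) has_field_derivative - (u ^ 2)) (at x)"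
    using nz by (auto intro!: derivative_eq_intros simp: u_def power2_eq_square divide_simps algebra_simps)
  note hD = solves_gaussD[OF assms(1,3), of y]
  have yB: "y \<in> B" using AB[OF x] by (simp add: y_def)
  have dh: "((\<lambda>x. h (x / (x - 1))) has_field_derivative deriv h y * (- (u ^ 2))) (at x)"
    using DERIV_chain2[OF hD(1)[OF yB, unfolded y_def] dy] by (simp add: y_def)
  have dh1: "((\<lambda>x. deriv h (x / (x - 1))) has_field_derivative deriv (deriv h) y * (- (u ^ 2))) (at x)"
    using DERIV_chain2[OF hD(2)[OF yB, unfolded y_def] dy] by (simp add: y_def)
  let ?f1 = "\<lambda>x. a * (1 - x) powr (- a) * inverse (1 - x) * h (x / (x - 1)) -
       (1 - x) powr (- a) * inverse (1 - x) ^ 2 * deriv h (x / (x - 1))"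
  let ?f2 = "\<lambda>x. a * (a + 1) * (1 - x) powr (- a) * inverse (1 - x) ^ 2 * h (x / (x - 1)) -
       (2 * a + 2) * (1 - x) powr (- a) * inverse (1 - x) ^ 3 * deriv h (x / (x - 1)) +
       (1 - x) powr (- a) * inverse (1 - x) ^ 4 * deriv (deriv h) (x / (x - 1))"
  show "((\<lambda>x. (1 - x) powr (- a) * h (x / (x - 1))) has_field_derivative ?f1 x) (at x)"
    by (rule derivative_eq_intros dP dh refl)+
       (simp add: u_def[symmetric] P_def[symmetric] y_def[symmetric] algebra_simps)
  show "(?f1 has_field_derivative ?f2 x) (at x)"
    by (rule derivative_eq_intros dP dh dh1 du refl)+
       (simp add: u_def[symmetric] P_def[symmetric] y_def[symmetric] algebra_simps power2_eq_square power3_eq_cube power4_eq_xxxx)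
  have "y * (1 - y) * deriv (deriv h) y + (c - (a + (c - b) + 1) * y) * deriv h y - a * (c - b) * h y = 0"
    by (rule hD(3)[OF yB])
  with u y have "x * (1 - x) * (a * (a + 1) * P * u ^ 2 * h y - (2 * a + 2) * P * u ^ 3 * deriv h y + P * u ^ 4 * deriv (deriv h) y)
     + (c - (a + b + 1) * x) * (a * P * u * h y - P * u ^ 2 * deriv h y) - a * b * (P * h y) = 0"
    by algebra
  thus "x * (1 - x) * ?f2 x + (c - (a + b + 1) * x) * ?f1 x - a * b * ((1 - x) powr (- a) * h (x / (x - 1))) = 0"
    by (simp only: u_def[symmetric] P_def[symmetric] y_def[symmetric])
qed

lemma one_minus_notin_nonpos_Reals: "norm (x::complex) < 1 \<Longrightarrow> 1 - x \<notin> \<real>\<^sub>\<le>\<^sub>0"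
  using abs_Re_le_cmod[of x] by (auto simp: complex_nonpos_Reals_iff)

lemma norm_pfaff_less_1_iff:
  assumes "x \<noteq> 1"
  shows "norm (x / (x - 1)) < 1 \<longleftrightarrow> Re x < 1 / 2"
proof -
  have "norm (x / (x - 1)) < 1 \<longleftrightarrow> norm x < norm (x - 1)"
    using assms by (simp add: norm_divide divide_simps)
  also have "\<dots> \<longleftrightarrow> norm x ^ 2 < norm (x - 1) ^ 2"
    by (metis norm_ge_zero power2_less_imp_less power_strict_mono zero_less_numeral)
  also have "\<dots> \<longleftrightarrow> Re x < 1 / 2"
    unfolding cmod_power2 by (simp add: power2_eq_square algebra_simps)
  finally show ?thesis .
qed

text \<open>
  Near the origin both sides solve the same equation and have the same value at \<open>0\<close>. The
  identity theorem carries the equality to the set on which both series converge.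
\<close>
lemma reg2F1_pfaff:
  assumes c: "c \<notin> \<int>\<^sub>\<le>\<^sub>0" and x: "norm x < 1" "Re x < 1 / 2"
  shows "reg2F1 a b c x = (1 - x) powr (- a) * reg2F1 a (c - b) c (x / (x - 1))"
proof -
  let ?g = "\<lambda>x. (1 - x) powr (- a) * reg2F1 a (c - b) c (x / (x - 1))"
  define A where "A = ball (0::complex) 1 \<inter> {x. Re x < 1 / 2}"
  have A: "open A" "connected A" "ball 0 (1/2) \<subseteq> A" "x \<in> A"
  proof -
    show "open A" unfolding A_def by (intro open_Int open_ball open_halfspace_Re_lt)
    show "connected A" unfolding A_def
      by (intro convex_connected convex_Int convex_ball convex_halfspace_Re_lt)
    show "ball 0 (1/2) \<subseteq> A"
    proof
      fix y :: complex assume "y \<in> ball 0 (1/2)"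
      thus "y \<in> A" using abs_Re_le_cmod[of y] by (simp add: A_def)
    qed
    show "x \<in> A" using x by (simp add: A_def)
  qed
  have sol: "solves_gauss a b c A ?g"
  proof (rule solves_gauss_pfaff[OF solves_gauss_reg2F1 A(1) open_ball])
    fix y assume y: "y \<in> A"
    hence "y \<noteq> 1" by (auto simp: A_def)
    with y show "1 - y \<notin> \<real>\<^sub>\<le>\<^sub>0 \<and> y / (y - 1) \<in> ball 0 1"
      by (simp add: A_def one_minus_notin_nonpos_Reals norm_pfaff_less_1_iff)
  qed
  have near: "?g y = reg2F1 a b c y" if "y \<in> ball 0 (1/2)" for y
  proof -
    have "?g y = ?g 0 * Gamma c * reg2F1 a b c y"
      by (rule reg2F1_unique[OF _ _ solves_gauss_subset[OF sol A(3)] c]) (use that in auto)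
    also have "?g 0 * Gamma c = 1"
      using c by (simp add: rGamma_inverse_Gamma Gamma_eq_zero_iff)
    finally show ?thesis by simp
  qed
  show ?thesis
  proof (rule analytic_continuation_open[of "ball 0 (1/2)" A "reg2F1 a b c" ?g])
    show "reg2F1 a b c holomorphic_on A"
      by (rule holomorphic_on_subset[OF holomorphic_on_reg2F1]) (auto simp: A_def)
    show "?g holomorphic_on A" using sol by (simp add: solves_gauss_def)
  qed (use near A in auto)
qed

text \<open>
  Euler's transformation is Pfaff's applied twice, since \<open>x / (x - 1)\<close> is an involution: first
  with \<open>a\<close> as the retained parameter, then with \<open>c - b\<close>.
\<close>
lemma reg2F1_euler:
  assumes c: "c \<notin> \<int>\<^sub>\<le>\<^sub>0" and x: "norm x < 1"
  shows "reg2F1 a b c x = (1 - x) powr (c - a - b) * reg2F1 (c - a) (c - b) c x"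
proof -
  let ?g = "\<lambda>x. (1 - x) powr (c - a - b) * reg2F1 (c - a) (c - b) c x"
  have near: "reg2F1 a b c y = ?g y" if y: "y \<in> ball 0 (1/2)" for y
  proof -
    have Re: "Re y < 1 / 2" using y abs_Re_le_cmod[of y] by simp
    have y1: "1 - y \<noteq> 0" using y by auto
    define w where "w = y / (y - 1)"
    have w: "w / (w - 1) = y" "1 - w = inverse (1 - y)"
      using y1 by (auto simp: w_def divide_simps)
    have w': "norm w < 1" "Re w < 1 / 2"
    proof -
      show "norm w < 1" using Re y1 by (simp add: w_def norm_pfaff_less_1_iff)
      hence "w \<noteq> 1" by auto
      thus "Re w < 1 / 2"
        using norm_pfaff_less_1_iff[of w] w y by simp
    qed
    have "reg2F1 a b c y = (1 - y) powr (- a) * reg2F1 a (c - b) c w"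
      unfolding w_def using c y Re by (intro reg2F1_pfaff) auto
    also have "reg2F1 a (c - b) c w = reg2F1 (c - b) a c w" by (rule reg2F1_commute)
    also have "\<dots> = (1 - w) powr (- (c - b)) * reg2F1 (c - b) (c - a) c y"
      using reg2F1_pfaff[OF c w', of "c - b" a] by (simp only: w)
    also have "(1 - w) powr (- (c - b)) = (1 - y) powr (c - b)"
    proof -
      have "Re (1 - y) > 0" using Re by simp
      hence "ln (inverse (1 - y)) = - ln (1 - y)"
        by (intro Ln_inverse) (auto simp: complex_nonpos_Reals_iff)
      thus ?thesis
        using y1 by (simp add: w powr_def algebra_simps)
    qed
    also have "(1 - y) powr (- a) * ((1 - y) powr (c - b) * reg2F1 (c - b) (c - a) c y) = ?g y"
      by (simp add: powr_add[symmetric] mult.assoc[symmetric] reg2F1_commute[of "c - b"] algebra_simps)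
    finally show ?thesis .
  qed
  show ?thesis
    by (rule analytic_continuation_open[of "ball 0 (1/2)" "ball 0 1" "reg2F1 a b c" ?g])
       (use x near in \<open>auto intro!: holomorphic_intros simp: one_minus_notin_nonpos_Reals\<close>)
qed

section \<open>Behaviour of the series at the point one\<close>

lemma sums_pochhammer_power:
  fixes s x :: complex
  assumes "norm x < 1"
  shows "(\<lambda>k. pochhammer s k / fact k * x ^ k) sums ((1 - x) powr (- s))"
proof -
  have "(\<lambda>k. ((- s) gchoose k) * (- x) ^ k) sums (1 + (- x)) powr (- s)"
    using assms by (intro gen_binomial_complex) auto
  moreover have "((- s) gchoose k) * (- x) ^ k = pochhammer s k / fact k * x ^ k" for k
  proof -
    have "(- x) ^ k = (-1) ^ k * x ^ k" by (rule power_minus)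
    thus ?thesis by (simp add: gbinomial_pochhammer)
  qed
  ultimately show ?thesis by simp
qed

lemma sums_pochhammer_power_real:
  fixes s x :: real
  assumes "\<bar>x\<bar> < 1"
  shows "(\<lambda>k. pochhammer s k / fact k * x ^ k) sums ((1 - x) powr (- s))"
proof -
  have "(\<lambda>k. ((- s) gchoose k) * (- x) ^ k) sums (1 + (- x)) powr (- s)"
    using assms by (intro gen_binomial_real) auto
  moreover have "((- s) gchoose k) * (- x) ^ k = pochhammer s k / fact k * x ^ k" for k
  proof -
    have "(- x) ^ k = (-1) ^ k * x ^ k" by (rule power_minus)
    thus ?thesis by (simp add: gbinomial_pochhammer)
  qed
  ultimately show ?thesis by simp
qed

lemma Re_pos_notin_nonpos_Ints: "Re s > 0 \<Longrightarrow> s \<notin> \<int>\<^sub>\<le>\<^sub>0"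
  by (auto elim!: nonpos_Ints_cases)

text \<open>
  The quotient of the two Pochhammer symbols is, up to a factor of modulus one, a quotient of
  terms of the Euler sequences for \<open>1 / \<Gamma>\<close>, hence convergent.
\<close>
lemma pochhammer_Re_bound:
  assumes "Re s > 0"
  obtains M where "M > 0" "\<And>k. norm (pochhammer s k) \<le> M * pochhammer (Re s) k"
proof -
  let ?q = "\<lambda>n. rGamma_series s n / rGamma_series (of_real (Re s)) n"
  have nz: "rGamma (complex_of_real (Re s)) \<noteq> 0"
    using assms Re_pos_notin_nonpos_Ints[of "of_real (Re s)"] by (simp add: rGamma_eq_zero_iff)
  have "?q \<longlonglongrightarrow> rGamma s / rGamma (of_real (Re s))"
    by (intro tendsto_divide rGamma_series_LIMSEQ nz)
  hence "Bseq ?q" by (intro convergent_imp_Bseq) (auto simp: convergent_def)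
  then obtain M where M: "M > 0" "\<And>n. norm (?q n) \<le> M" by (auto simp: Bseq_def)
  show ?thesis
  proof (rule that[of "max M 1"])
    fix k
    have pos: "pochhammer (Re s) k > 0" for k using assms by (rule pochhammer_pos)
    show "norm (pochhammer s k) \<le> max M 1 * pochhammer (Re s) k"
    proof (cases k)
      case (Suc n)
      have "norm (?q n) = norm (pochhammer s k) / pochhammer (Re s) k"
      proof -
        have "norm (pochhammer (complex_of_real (Re s)) k) = pochhammer (Re s) k"
          using pos[of k] by (simp only: pochhammer_of_real norm_of_real abs_of_pos)
        thus ?thesis
          by (simp add: rGamma_series_def norm_mult norm_divide Suc)
      qed
      hence "norm (pochhammer s k) \<le> M * pochhammer (Re s) k"
        using mult_right_mono[OF M(2)[of n], of "pochhammer (Re s) k"] pos[of k] by simp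
      also have "\<dots> \<le> max M 1 * pochhammer (Re s) k"
        using pos[of k] by (intro mult_right_mono) auto
      finally show ?thesis .
    qed auto
  qed (use M in auto)
qed

text \<open>
  An Abelian theorem. The comparison series is \<open>\<Sum> (s)\<^sub>k / k! r\<^sup>k = (1 - r)\<^sup>-\<^sup>s\<close>. The difference
  between the given series and \<open>L\<close> times the comparison series has coefficients that are small in
  comparison with those of \<open>(1 - r)\<close> to the power \<open>- Re s\<close>, apart from finitely many,
  whose contribution stays bounded while that power tends to infinity.
\<close>
lemma abel_binomial_comparison:
  fixes t :: "nat \<Rightarrow> complex"
  assumes s: "Re s > 0" and lim: "(\<lambda>k. t k * fact k / pochhammer s k) \<longlonglongrightarrow> L"
  shows "((\<lambda>r::real. of_real (1 - r) powr s * (\<Sum>k. t k * of_real r ^ k)) \<longlongrightarrow> L) (at_left 1)"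
proof -
  define q where "q k = t k * fact k / pochhammer s k" for k
  define g where "g k = pochhammer s k / fact k" for k
  define \<rho> where "\<rho> k = pochhammer (Re s) k / fact k" for k
  have tq: "t k = q k * g k" for k
    using s Re_pos_notin_nonpos_Ints[OF s] by (auto simp: q_def g_def pochhammer_eq_0_iff)
  obtain M where M: "M > 0" "\<And>k. norm (pochhammer s k) \<le> M * pochhammer (Re s) k"
    using pochhammer_Re_bound[OF s] by blast
  have g_le: "norm (g k) \<le> M * \<rho> k" for k
    using M(2)[of k] by (simp add: g_def \<rho>_def norm_divide divide_right_mono)
  have \<rho>0: "\<rho> k \<ge> 0" for k
    using s by (auto simp: \<rho>_def intro!: divide_nonneg_nonneg less_imp_le[OF pochhammer_pos])
  show ?thesis
  proof (rule tendstoI)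
    fix e :: real assume e: "e > 0"
    have "(\<lambda>k. q k - L) \<longlonglongrightarrow> 0" using lim by (simp add: q_def LIM_zero)
    then obtain N where N: "\<And>k. k \<ge> N \<Longrightarrow> norm (q k - L) < e / (2 * M)"
      using LIMSEQ_D[of "\<lambda>k. q k - L" 0 "e / (2 * M)"] M(1) e by auto
    \<comment> \<open>\<open>d\<close> is the coefficient of the difference from \<open>L\<close> times the binomial series; from \<open>N\<close> on it is at
       most \<open>e / 2\<close> times the coefficient of \<open>(1 - r)\<close> to the power \<open>- Re s\<close>\<close>
    define d where "d k = (q k - L) * g k" for k
    define D where "D = (\<Sum>k<N. norm (d k))"
    have d_le: "norm (d k * of_real r ^ k) \<le> (if k < N then norm (d k) else 0) + e / 2 * (\<rho> k * r ^ k)"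
      if r: "0 < r" "r < 1" for r k
    proof (cases "k < N")
      case True
      have "norm (d k * of_real r ^ k) \<le> norm (d k)"
        using r by (simp add: norm_mult norm_power mult_left_le power_le_one)
      thus ?thesis using True e \<rho>0[of k] r by (simp add: add_increasing2)
    next
      case False
      have "norm (d k) \<le> e / (2 * M) * (M * \<rho> k)"
        using N[of k] False g_le[of k] e M(1) unfolding d_def norm_mult by (intro mult_mono) auto
      hence "norm (d k) \<le> e / 2 * \<rho> k" using M(1) by simp
      hence "norm (d k) * r ^ k \<le> e / 2 * \<rho> k * r ^ k"
        using r by (intro mult_right_mono) auto
      thus ?thesis using False r by (simp add: norm_mult norm_power)
    qed
    have main: "norm (of_real (1 - r) powr s * (\<Sum>k. t k * of_real r ^ k) - L) \<le> (1 - r) powr Re s * D + e / 2"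
      if r: "0 < r" "r < 1" for r
    proof -
      have S\<rho>: "(\<lambda>k. \<rho> k * r ^ k) sums ((1 - r) powr (- Re s))"
        unfolding \<rho>_def using r by (intro sums_pochhammer_power_real) auto
      have Sg: "(\<lambda>k. g k * of_real r ^ k) sums ((1 - of_real r) powr (- s))"
        unfolding g_def using r by (intro sums_pochhammer_power) auto
      have Smaj: "(\<lambda>k. (if k < N then norm (d k) else 0) + e / 2 * (\<rho> k * r ^ k)) sums (D + e / 2 * (1 - r) powr (- Re s))"
        unfolding D_def using sums_If_finite_set[of "{..<N}" "\<lambda>k. norm (d k)"]
        by (intro sums_add sums_mult S\<rho>) auto
      have Sd: "summable (\<lambda>k. d k * of_real r ^ k)"
        by (rule summable_comparison_test'[OF sums_summable[OF Smaj]]) (use d_le[OF r] in auto)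
      have "norm (\<Sum>k. d k * of_real r ^ k) \<le> (\<Sum>k. (if k < N then norm (d k) else 0) + e / 2 * (\<rho> k * r ^ k))"
        by (rule norm_suminf_le[OF _ sums_summable[OF Smaj]]) (use d_le[OF r] in auto)
      hence nd: "norm (\<Sum>k. d k * of_real r ^ k) \<le> D + e / 2 * (1 - r) powr (- Re s)"
        using sums_unique[OF Smaj] by simp
      have "(\<lambda>k. L * (g k * of_real r ^ k) + d k * of_real r ^ k) sums
         (L * (1 - of_real r) powr (- s) + (\<Sum>k. d k * of_real r ^ k))"
        by (intro sums_add sums_mult Sg summable_sums[OF Sd])
      moreover have "L * (g k * of_real r ^ k) + d k * of_real r ^ k = t k * of_real r ^ k" for k
        by (simp add: d_def tq algebra_simps)
      ultimately have "(\<Sum>k. t k * of_real r ^ k) = L * (1 - of_real r) powr (- s) + (\<Sum>k. d k * of_real r ^ k)"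
        by (simp add: sums_iff)
      moreover have "of_real (1 - r) powr s * (1 - of_real r) powr (- s) = (1::complex)"
        using r by (simp add: powr_minus)
      ultimately have "of_real (1 - r) powr s * (\<Sum>k. t k * of_real r ^ k) - L =
          of_real (1 - r) powr s * (\<Sum>k. d k * of_real r ^ k)"
        by (simp add: distrib_left mult.left_commute[of _ L])
      hence "norm (of_real (1 - r) powr s * (\<Sum>k. t k * of_real r ^ k) - L) =
          (1 - r) powr Re s * norm (\<Sum>k. d k * of_real r ^ k)"
        using r by (simp add: norm_mult norm_powr_real_powr)
      also have "\<dots> \<le> (1 - r) powr Re s * (D + e / 2 * (1 - r) powr (- Re s))"
        using nd by (intro mult_left_mono) auto
      also have "\<dots> = (1 - r) powr Re s * D + e / 2"
        using r by (simp add: algebra_simps powr_minus)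
      finally show ?thesis .
    qed
    have "((\<lambda>r. (1 - r) powr Re s * D) \<longlongrightarrow> 0 * D) (at_left (1::real))"
    proof (intro tendsto_mult tendsto_const)
      show "((\<lambda>r::real. (1 - r) powr Re s) \<longlongrightarrow> 0) (at_left 1)"
      proof -
        have "((\<lambda>r::real. 1 - r) \<longlongrightarrow> 0) (at_left 1)"
          by (auto intro!: tendsto_eq_intros)
        hence "((\<lambda>r::real. (1 - r) powr Re s) \<longlongrightarrow> 0 powr Re s) (at_left 1)"
          by (intro tendsto_powr2 tendsto_const) (use s in \<open>auto simp: eventually_at_filter\<close>)
        thus ?thesis using s by simp
      qed
    qed
    hence "eventually (\<lambda>r. (1 - r) powr Re s * D < e / 2) (at_left (1::real))"
      using e by (intro order_tendstoD) auto
    moreover have "eventually (\<lambda>r::real. r \<in> {0<..<1}) (at_left 1)"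
      by (rule eventually_at_left_real) auto
    ultimately show "eventually (\<lambda>r. dist (of_real (1 - r) powr s * (\<Sum>k. t k * of_real r ^ k)) L < e) (at_left (1::real))"
    proof eventually_elim
      case (elim r)
      thus ?case using main[of r] unfolding dist_norm by auto
    qed
  qed
qed

text \<open>
  The quotients of the coefficients by those of \<open>(1 - r)\<^sup>-\<^sup>s\<close>, where \<open>s = a + b - c\<close>, converge by
  Euler's product for \<open>1 / \<Gamma>\<close>: the powers of \<open>k\<close> cancel because \<open>a + b = c + s\<close>.
\<close>
lemma reg2F1_at_1:
  assumes c: "c \<notin> \<int>\<^sub>\<le>\<^sub>0" and s: "Re (a + b - c) > 0"
  shows "((\<lambda>r::real. of_real (1 - r) powr (a + b - c) * reg2F1 a b c (of_real r)) \<longlongrightarrow>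
           Gamma (a + b - c) * rGamma a * rGamma b) (at_left 1)"
  unfolding reg2F1_def
proof (rule abel_binomial_comparison[OF s])
  let ?s = "a + b - c"
  let ?R = "rGamma_series :: complex \<Rightarrow> nat \<Rightarrow> complex"
  have nz: "rGamma c \<noteq> 0" "rGamma ?s \<noteq> 0"
    using c Re_pos_notin_nonpos_Ints[OF s] by (simp_all add: rGamma_eq_zero_iff)
  have "(\<lambda>n. ?R a n * ?R b n / (?R c n * ?R ?s n) * rGamma c) \<longlonglongrightarrow>
          rGamma a * rGamma b / (rGamma c * rGamma ?s) * rGamma c"
    using nz by (intro tendsto_intros) auto
  also have "rGamma a * rGamma b / (rGamma c * rGamma ?s) * rGamma c = Gamma ?s * rGamma a * rGamma b"
    using nz by (simp add: Gamma_def field_simps)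
  also have "(\<lambda>n. ?R a n * ?R b n / (?R c n * ?R ?s n) * rGamma c) =
     (\<lambda>n. reg2F1_coeff a b c (Suc n) * fact (Suc n) / pochhammer ?s (Suc n))"
  proof
    fix n
    define E where "E z = exp (z * of_real (ln (of_nat n)) :: complex)" for z
    have E: "E a * E b = E c * E ?s"
      by (simp add: E_def exp_add[symmetric] algebra_simps)
    have E0: "E z \<noteq> 0" for z by (simp add: E_def)
    have pc: "pochhammer c (Suc n) \<noteq> 0" "pochhammer ?s (Suc n) \<noteq> 0"
      using c Re_pos_notin_nonpos_Ints[OF s] by (auto simp: pochhammer_eq_0_iff)
    have "rGamma c = pochhammer c (Suc n) * rGamma (c + of_nat (Suc n))"
      by (rule pochhammer_rGamma)
    hence rG: "rGamma (c + of_nat (Suc n)) = rGamma c / pochhammer c (Suc n)"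
      using pc by (simp add: field_simps)
    have R: "?R z n = pochhammer z (Suc n) / (fact n * E z)" for z
      by (simp add: rGamma_series_def E_def)
    have "?R a n * ?R b n / (?R c n * ?R ?s n) =
       (pochhammer a (Suc n) * pochhammer b (Suc n) / (pochhammer c (Suc n) * pochhammer ?s (Suc n))) *
        ((E c * E ?s) / (E a * E b))"
      unfolding R by (simp add: divide_simps)
    also have "(E c * E ?s) / (E a * E b) = 1"
      using E E0 by (simp add: divide_simps)
    finally have eq: "?R a n * ?R b n / (?R c n * ?R ?s n) =
      pochhammer a (Suc n) * pochhammer b (Suc n) / (pochhammer c (Suc n) * pochhammer ?s (Suc n))"
      by (simp only: mult_1_right)
    show "?R a n * ?R b n / (?R c n * ?R ?s n) * rGamma c =
        reg2F1_coeff a b c (Suc n) * fact (Suc n) / pochhammer ?s (Suc n)"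
      unfolding eq reg2F1_coeff_def rG by (simp add: field_simps del: fact_Suc)
  qed
  finally show "(\<lambda>k. reg2F1_coeff a b c k * fact k / pochhammer ?s k) \<longlonglongrightarrow> Gamma ?s * rGamma a * rGamma b"
    by (rule LIMSEQ_imp_Suc)
qed

section \<open>Two solutions with a common domain, and their Wronskian\<close>

abbreviation lens :: "complex set" where "lens \<equiv> ball 0 1 \<inter> ball 1 1"

lemma convex_lens: "convex lens" and open_lens: "open lens"
  by (auto intro: convex_Int)

lemma lens_notin_nonpos_Reals:
  assumes "z \<in> lens"
  shows "z \<notin> \<real>\<^sub>\<le>\<^sub>0" "1 - z \<notin> \<real>\<^sub>\<le>\<^sub>0" "z \<noteq> 0" "1 - z \<noteq> 0" "norm z < 1" "norm (1 - z) < 1"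
proof -
  show *: "norm z < 1" "norm (1 - z) < 1"
    using assms by (auto simp: dist_norm norm_minus_commute)
  show "1 - z \<notin> \<real>\<^sub>\<le>\<^sub>0" "z \<notin> \<real>\<^sub>\<le>\<^sub>0"
    using one_minus_notin_nonpos_Reals[of z] one_minus_notin_nonpos_Reals[of "1 - z"] * by auto
  thus "z \<noteq> 0" "1 - z \<noteq> 0" by auto
qed

lemma solves_gauss_reflect:
  assumes "solves_gauss a b c A f" "open A" "open B" "\<And>z. z \<in> B \<Longrightarrow> 1 - z \<in> A"
  shows "solves_gauss a b (a + b + 1 - c) B (\<lambda>z. f (1 - z))"
proof (rule solves_gaussI[OF assms(3)])
  fix z assume z: "z \<in> B"
  have d: "((\<lambda>z. 1 - z) has_field_derivative -1) (at z)"
    by (auto intro!: derivative_eq_intros)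
  note D = solves_gaussD[OF assms(1,2) assms(4)[OF z]]
  show "((\<lambda>z. f (1 - z)) has_field_derivative - deriv f (1 - z)) (at z)"
    using DERIV_chain2[OF D(1) d] by simp
  show "((\<lambda>z. - deriv f (1 - z)) has_field_derivative deriv (deriv f) (1 - z)) (at z)"
    using DERIV_minus[OF DERIV_chain2[OF D(2) d]] by simp
  show "z * (1 - z) * deriv (deriv f) (1 - z) + (a + b + 1 - c - (a + b + 1) * z) * - deriv f (1 - z) - a * b * f (1 - z) = 0"
    using D(3) by (simp add: algebra_simps)
qed

text \<open>
  Termwise this is \<open>(c + k) / \<Gamma>(c + 1 + k) = 1 / \<Gamma>(c + k)\<close>. It expresses the derivative of
  \<open>x\<^sup>c\<close> times the series.
\<close>
lemma reg2F1_lower_c: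
  assumes x: "norm x < 1"
  shows "c * reg2F1 a b (c + 1) x + x * (a * b * reg2F1 (a + 1) (b + 1) (c + 2) x) = reg2F1 a b c x"
proof -
  let ?t = "reg2F1_coeff a b (c + 1)"
  have S1: "(\<lambda>k. diffs ?t k * x ^ k) sums (a * b * reg2F1 (a + 1) (b + 1) (c + 2) x)"
    using sums_mult[OF reg2F1_sums[OF x, of "a+1" "b+1" "c+2"], of "a * b"]
    by (simp add: reg2F1_coeff_diffs add.assoc mult_ac)
  have "(\<lambda>k. of_nat (Suc k) * ?t (Suc k) * x ^ Suc k) sums (x * (a * b * reg2F1 (a + 1) (b + 1) (c + 2) x))"
    using sums_mult[OF S1, of x] by (simp add: diffs_def mult_ac del: of_nat_Suc)
  hence "(\<lambda>k. of_nat k * ?t k * x ^ k) sums (x * (a * b * reg2F1 (a + 1) (b + 1) (c + 2) x))"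
    using sums_Suc_iff[of "\<lambda>k. of_nat k * ?t k * x ^ k"] by simp
  hence "(\<lambda>k. c * (?t k * x ^ k) + of_nat k * ?t k * x ^ k) sums
     (c * reg2F1 a b (c + 1) x + x * (a * b * reg2F1 (a + 1) (b + 1) (c + 2) x))"
    by (intro sums_add sums_mult reg2F1_sums[OF x])
  moreover have "c * (?t k * x ^ k) + of_nat k * ?t k * x ^ k = reg2F1_coeff a b c k * x ^ k" for k
  proof -
    have "rGamma (c + of_nat k) = (c + of_nat k) * rGamma (c + 1 + of_nat k)"
      using rGamma_plus1[of "c + of_nat k"] by (simp add: add_ac)
    thus ?thesis by (simp add: reg2F1_coeff_def algebra_simps add_divide_distrib)
  qed
  ultimately show ?thesis
    using reg2F1_sums[OF x, of a b c] by (simp add: sums_iff)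
qed

text \<open>
  The Frobenius solution at the origin with exponent \<open>s\<close>, for the equation with parameters \<open>a\<close>,
  \<open>b\<close> and \<open>1 - s\<close>. The other exponent is \<open>0\<close>.
\<close>
definition frob :: "complex \<Rightarrow> complex \<Rightarrow> complex \<Rightarrow> complex \<Rightarrow> complex" where
  "frob a b s z = z powr s * reg2F1 (a + s) (b + s) (1 + s) z"

text \<open>
  Differentiation maps this family of solutions into itself and lowers the exponent by one. The
  connection coefficients for \<open>s\<close> are thereby reduced to those for \<open>s - 1\<close>.
\<close>
lemma frob_has_field_derivative:
  assumes z: "norm z < 1" "z \<notin> \<real>\<^sub>\<le>\<^sub>0"
  shows "(frob a b s has_field_derivative frob (a + 1) (b + 1) (s - 1) z) (at z)"
proof -
  have z0: "z \<noteq> 0" using z by auto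
  let ?P = "reg2F1 (a + s) (b + s) (1 + s) z" and ?P1 = "reg2F1 (a + s + 1) (b + s + 1) (1 + s + 1) z"
  have dp: "((\<lambda>z. z powr s) has_field_derivative s * z powr (s - 1)) (at z)"
    using z(2) by (rule has_field_derivative_powr)
  have "((\<lambda>z. z powr s * reg2F1 (a + s) (b + s) (1 + s) z) has_field_derivative
      s * z powr (s - 1) * ?P + (a + s) * (b + s) * ?P1 * z powr s) (at z)"
    by (rule DERIV_mult[OF dp reg2F1_has_field_derivative[OF z(1)]])
  also have "s * z powr (s - 1) * ?P + (a + s) * (b + s) * ?P1 * z powr s =
     z powr (s - 1) * (s * ?P + z * ((a + s) * (b + s) * ?P1))"
    using z0 by (simp add: powr_diff field_simps)
  also have "s * ?P + z * ((a + s) * (b + s) * ?P1) = reg2F1 (a + s) (b + s) s z"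
    using reg2F1_lower_c[OF z(1), of s "a + s" "b + s"] by (simp add: add_ac)
  also have "z powr (s - 1) * \<dots> = frob (a + 1) (b + 1) (s - 1) z"
    by (simp add: frob_def add_ac)
  finally show ?thesis
    by (simp only: frob_def [abs_def])
qed

lemma solves_gauss_frob: "solves_gauss a b (1 - s) lens (frob a b s)"
proof (rule solves_gaussI[OF open_lens])
  fix z assume z: "z \<in> lens"
  note L = lens_notin_nonpos_Reals[OF z]
  show "(frob a b s has_field_derivative frob (a + 1) (b + 1) (s - 1) z) (at z)"
    using L by (intro frob_has_field_derivative) auto
  show "(frob (a + 1) (b + 1) (s - 1) has_field_derivative frob (a + 2) (b + 2) (s - 2) z) (at z)"
    using frob_has_field_derivative[OF L(5,1), of "a+1" "b+1" "s-1"] by (simp add: add.assoc)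
  define y y1 y2 where "y = reg2F1 (a + s) (b + s) (s + 1) z"
    and "y1 = (a + s) * (b + s) * reg2F1 (a + s + 1) (b + s + 1) (s + 2) z"
    and "y2 = (a + s) * (b + s) * (a + s + 1) * (b + s + 1) * reg2F1 (a + s + 2) (b + s + 2) (s + 3) z"
  have R: "s * y + z * y1 = reg2F1 (a + s) (b + s) s z"
    using reg2F1_lower_c[OF L(5), of s "a + s" "b + s"] by (simp add: y_def y1_def add_ac)
  have R1: "(s + 1) * y1 + z * y2 = (a + s) * (b + s) * reg2F1 (a + s + 1) (b + s + 1) (s + 1) z"
    using arg_cong[OF reg2F1_lower_c[OF L(5), of "s + 1" "a + s + 1" "b + s + 1"], of "\<lambda>x. (a + s) * (b + s) * x"]
    by (simp add: y1_def y2_def algebra_simps)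
  have R2: "(s - 1) * reg2F1 (a + s) (b + s) s z + z * ((a + s) * (b + s) * reg2F1 (a + s + 1) (b + s + 1) (s + 1) z)
      = reg2F1 (a + s) (b + s) (s - 1) z"
    using reg2F1_lower_c[OF L(5), of "s - 1" "a + s" "b + s"] by (simp add: add_ac)
  have ode: "z * (1 - z) * y2 + (s + 1 - (a + s + (b + s) + 1) * z) * y1 - (a + s) * (b + s) * y = 0"
    using reg2F1_ode[OF L(5), of "a + s" "b + s" "s + 1"] by (simp add: y_def y1_def y2_def add_ac)
  define p where "p = z powr (s - 2)"
  have p: "z powr s = z * z * p" "z powr (s - 1) = z * p"
    using L(3) by (simp_all add: p_def powr_diff field_simps power2_eq_square)
  have f: "frob a b s z = z * z * p * y"
    by (simp add: frob_def p y_def add.commute)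
  have f1: "frob (a + 1) (b + 1) (s - 1) z = z * p * (s * y + z * y1)"
    unfolding R by (simp add: frob_def p add_ac)
  have f2: "frob (a + 2) (b + 2) (s - 2) z = p * ((s - 1) * (s * y + z * y1) + z * ((s + 1) * y1 + z * y2))"
    unfolding R R1 R2 by (simp add: frob_def p_def add_ac)
  show "z * (1 - z) * frob (a + 2) (b + 2) (s - 2) z + (1 - s - (a + b + 1) * z) * frob (a + 1) (b + 1) (s - 1) z - a * b * frob a b s z = 0"
    unfolding f f1 f2 using ode by algebra
qed

text \<open>
  Abel's formula: the Wronskian satisfies a linear equation of first order, whose integrating
  factor is \<open>z\<^sup>c (1 - z)\<^sup>a\<^sup>+\<^sup>b\<^sup>+\<^sup>1\<^sup>-\<^sup>c\<close>.
\<close>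
lemma wronskian_constant:
  assumes y1: "solves_gauss a b c lens y1" and y2: "solves_gauss a b c lens y2"
  obtains K where "\<And>z. z \<in> lens \<Longrightarrow>
    (y1 z * deriv y2 z - deriv y1 z * y2 z) * z powr c * (1 - z) powr (a + b + 1 - c) = K"
proof -
  let ?W = "\<lambda>z. (y1 z * deriv y2 z - deriv y1 z * y2 z) * z powr c * (1 - z) powr (a + b + 1 - c)"
  have "(?W has_field_derivative 0) (at z within lens)" if z: "z \<in> lens" for z
  proof -
    note L = lens_notin_nonpos_Reals[OF z]
    note D1 = solves_gaussD[OF y1 open_lens z] and D2 = solves_gaussD[OF y2 open_lens z]
    define P Q where "P = z powr c" and "Q = (1 - z) powr (a + b + 1 - c)"
    define i j where "i = inverse z" and "j = inverse (1 - z)"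
    have ij: "z * i = 1" "(1 - z) * j = 1" using L by (simp_all add: i_def j_def)
    have dP: "((\<lambda>z. z powr c) has_field_derivative c * P * i) (at z)"
      using has_field_derivative_powr[OF L(1), of c] L(3) by (simp add: P_def i_def powr_diff field_simps)
    have dQ: "((\<lambda>z. (1 - z) powr (a + b + 1 - c)) has_field_derivative - ((a + b + 1 - c) * Q * j)) (at z)"
    proof -
      have "((\<lambda>z. (1 - z) powr e) has_field_derivative - (e * (1 - z) powr e * j)) (at z)" for e
        using L(2,4) by (auto intro!: derivative_eq_intros simp: j_def powr_diff field_simps)
      thus ?thesis by (simp add: Q_def)
    qed
    let ?w = "\<lambda>z. y1 z * deriv y2 z - deriv y1 z * y2 z"
    define w1 where "w1 = y1 z * deriv (deriv y2) z - deriv (deriv y1) z * y2 z"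
    have dw: "(?w has_field_derivative w1) (at z)"
      using DERIV_diff[OF DERIV_mult[OF D1(1) D2(2)] DERIV_mult[OF D1(2) D2(1)]]
      by (simp add: w1_def algebra_simps)
    have "(?W has_field_derivative ((w1 * P + c * P * i * ?w z) * Q + - ((a + b + 1 - c) * Q * j) * (?w z * P))) (at z)"
      using DERIV_mult[OF DERIV_mult[OF dw dP] dQ] by (simp only: P_def Q_def)
    moreover have "(w1 * P + c * P * i * ?w z) * Q + - ((a + b + 1 - c) * Q * j) * (?w z * P) = 0"
    proof -
      have "z * (1 - z) * w1 + (c - (a + b + 1) * z) * ?w z =
          y1 z * (z * (1 - z) * deriv (deriv y2) z + (c - (a + b + 1) * z) * deriv y2 z - a * b * y2 z)
        - y2 z * (z * (1 - z) * deriv (deriv y1) z + (c - (a + b + 1) * z) * deriv y1 z - a * b * y1 z)"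
        unfolding w1_def by (simp add: algebra_simps)
      hence w1: "z * (1 - z) * w1 + (c - (a + b + 1) * z) * ?w z = 0"
        unfolding D1(3) D2(3) by simp
      obtain w where w: "w = ?w z" by blast
      have "(w1 * P + c * P * i * w) * Q + - ((a + b + 1 - c) * Q * j) * (w * P) =
            P * Q * ((z * i) * ((1 - z) * j) * w1 + (c * i * ((1 - z) * j) - (a + b + 1 - c) * j * (z * i)) * w)"
        unfolding ij by (simp add: algebra_simps)
      also have "\<dots> = P * Q * i * j * (z * (1 - z) * w1 + (c - (a + b + 1) * z) * w)"
        by (simp add: algebra_simps)
      finally show ?thesis using w1 by (simp add: w)
    qed
    ultimately have "(?W has_field_derivative 0) (at z)" by (simp only:)
    thus ?thesis by (rule has_field_derivative_at_within)
  qed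
  from has_field_derivative_zero_constant[OF convex_lens this] that show ?thesis
    by blast
qed


lemma deriv_reg2F1_lens: "z \<in> lens \<Longrightarrow> deriv (reg2F1 a b c) z = a * b * reg2F1 (a + 1) (b + 1) (c + 1) z"
  by (intro DERIV_imp_deriv reg2F1_has_field_derivative lens_notin_nonpos_Reals)

lemma deriv_frob_lens: "z \<in> lens \<Longrightarrow> deriv (frob a b s) z = frob (a + 1) (b + 1) (s - 1) z"
  by (intro DERIV_imp_deriv frob_has_field_derivative lens_notin_nonpos_Reals)

lemma of_real_in_lens: "0 < r \<Longrightarrow> r < 1 \<Longrightarrow> complex_of_real r \<in> lens"
proof -
  assume r: "0 < r" "r < 1"
  have "dist 1 (complex_of_real r) = \<bar>1 - r\<bar>"
    by (metis dist_norm norm_of_real of_real_1 of_real_diff)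
  thus ?thesis using r by simp
qed

lemma eventually_of_real_in_lens: "eventually (\<lambda>r::real. 0 < r \<and> r < 1 \<and> complex_of_real r \<in> lens) (at_right 0)"
proof -
  have "eventually (\<lambda>r::real. r \<in> {0<..<1}) (at_right 0)"
    by (rule eventually_at_right_real) auto
  thus ?thesis
    by eventually_elim (simp only: of_real_in_lens greaterThanLessThan_iff simp_thms)
qed

lemma reg2F1_tendsto_0: "((\<lambda>r::real. reg2F1 a b c (of_real r)) \<longlongrightarrow> rGamma c) (at_right 0)"
proof -
  have "isCont (reg2F1 a b c) 0"
    using reg2F1_has_field_derivative[of 0 a b c] by (intro DERIV_isCont) auto
  hence "((\<lambda>r::real. reg2F1 a b c (of_real r)) \<longlongrightarrow> reg2F1 a b c 0) (at_right 0)"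
    by (rule isCont_tendsto_compose) (auto intro!: tendsto_eq_intros)
  thus ?thesis by simp
qed

text \<open>
  The constant in Abel's formula is evaluated by letting \<open>z\<close> tend to \<open>0\<close>. It equals
  \<open>1 / (\<Gamma>(s) \<Gamma>(1 - s))\<close>, which vanishes only for integers \<open>s\<close>.
\<close>
lemma wronskian_reg2F1_frob:
  assumes s: "s \<notin> \<int>"
  obtains K where "K \<noteq> 0" "\<And>z. z \<in> lens \<Longrightarrow>
    (reg2F1 a b (1 - s) z * deriv (frob a b s) z - deriv (reg2F1 a b (1 - s)) z * frob a b s z)
       * z powr (1 - s) * (1 - z) powr (a + b + s) = K"
proof -
  let ?u = "reg2F1 a b (1 - s)"
  have u: "solves_gauss a b (1 - s) lens ?u"
    using solves_gauss_reg2F1 by (rule solves_gauss_subset) auto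
  obtain K where "\<And>z. z \<in> lens \<Longrightarrow>
    (?u z * deriv (frob a b s) z - deriv ?u z * frob a b s z) * z powr (1 - s) * (1 - z) powr (a + b + 1 - (1 - s)) = K"
    using wronskian_constant[OF u solves_gauss_frob] by blast
  hence K: "\<And>z. z \<in> lens \<Longrightarrow>
    (?u z * deriv (frob a b s) z - deriv ?u z * frob a b s z) * z powr (1 - s) * (1 - z) powr (a + b + s) = K"
    by (simp add: add.assoc)
  let ?G = "\<lambda>z. (?u z * reg2F1 (a + s) (b + s) s z
       - z * (a * b * reg2F1 (a + 1) (b + 1) (2 - s) z) * reg2F1 (a + s) (b + s) (1 + s) z) * (1 - z) powr (a + b + s)"
  have eq: "?G z = K" if z: "z \<in> lens" for z
  proof -
    note L = lens_notin_nonpos_Reals[OF z]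
    have "frob (a + 1) (b + 1) (s - 1) z * z powr (1 - s) = reg2F1 (a + s) (b + s) s z"
      using L(3) powr_add[of z "s - 1" "1 - s"] by (simp add: frob_def add_ac)
    moreover have "frob a b s z * z powr (1 - s) = z * reg2F1 (a + s) (b + s) (1 + s) z"
      using L(3) powr_add[of z s "1 - s"] by (simp add: frob_def)
    ultimately show ?thesis
      using K[OF z, symmetric]
      by (simp add: deriv_reg2F1_lens[OF z] deriv_frob_lens[OF z] left_diff_distrib mult.assoc)
  qed
  have "((\<lambda>r::real. ?G (of_real r)) \<longlongrightarrow> (rGamma (1 - s) * rGamma s - 0 * (a * b * rGamma (2 - s)) * rGamma (1 + s)) * (1 - 0) powr (a + b + s)) (at_right 0)"
    by (intro tendsto_intros reg2F1_tendsto_0) (auto intro!: tendsto_eq_intros)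
  moreover have "((\<lambda>r::real. ?G (of_real r)) \<longlongrightarrow> K) (at_right 0)"
  proof (rule tendsto_eventually)
    show "eventually (\<lambda>r::real. ?G (of_real r) = K) (at_right 0)"
      using eventually_of_real_in_lens by eventually_elim (simp only: eq)
  qed
  ultimately have "(rGamma (1 - s) * rGamma s - 0 * (a * b * rGamma (2 - s)) * rGamma (1 + s)) * (1 - 0) powr (a + b + s) = K"
    by (intro tendsto_unique[OF trivial_limit_at_right_real])
  hence "K = rGamma (1 - s) * rGamma s"
    by simp
  moreover have "rGamma (1 - s) \<noteq> 0" "rGamma s \<noteq> 0"
  proof -
    have "1 - s \<notin> \<int>" using s Ints_diff[OF Ints_1, of "1 - s"] by auto
    thus "rGamma (1 - s) \<noteq> 0" "rGamma s \<noteq> 0"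
      using s nonpos_Ints_Int by (auto simp: rGamma_eq_zero_iff)
  qed
  ultimately show ?thesis
    using that[of K] K by auto
qed

text \<open>
  Cramer's rule. With \<open>W\<close> for the Wronskian, \<open>y W(u, v) = u W(y, v) + v W(u, y)\<close> holds
  identically, and the quotients of the three Wronskians are constant by Abel's formula.
\<close>
lemma reg2F1_frob_span:
  assumes s: "s \<notin> \<int>" and y: "solves_gauss a b (1 - s) lens y"
  obtains \<alpha> \<beta> where "\<And>z. z \<in> lens \<Longrightarrow> y z = \<alpha> * reg2F1 a b (1 - s) z + \<beta> * frob a b s z"
proof -
  let ?u = "reg2F1 a b (1 - s)" and ?v = "frob a b s"
  have u: "solves_gauss a b (1 - s) lens ?u"
    using solves_gauss_reg2F1 by (rule solves_gauss_subset) auto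
  have v: "solves_gauss a b (1 - s) lens ?v" by (rule solves_gauss_frob)
  let ?E = "\<lambda>z. z powr (1 - s) * (1 - z) powr (a + b + 1 - (1 - s))"
  obtain K where K: "K \<noteq> 0" "\<And>z. z \<in> lens \<Longrightarrow> (?u z * deriv ?v z - deriv ?u z * ?v z) * z powr (1 - s) * (1 - z) powr (a + b + s) = K"
    using wronskian_reg2F1_frob[OF s] by metis
  obtain K1 where K1: "\<And>z. z \<in> lens \<Longrightarrow> (y z * deriv ?v z - deriv y z * ?v z) * z powr (1 - s) * (1 - z) powr (a + b + 1 - (1 - s)) = K1"
    using wronskian_constant[OF y v] by blast
  obtain K2 where K2: "\<And>z. z \<in> lens \<Longrightarrow> (?u z * deriv y z - deriv ?u z * y z) * z powr (1 - s) * (1 - z) powr (a + b + 1 - (1 - s)) = K2"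
    using wronskian_constant[OF u y] by blast
  show ?thesis
  proof (rule that[of "K1 / K" "K2 / K"])
    fix z assume z: "z \<in> lens"
    define E F where "E = z powr (1 - s)" and "F = (1 - z) powr (a + b + s)"
    have Ks: "K = (?u z * deriv ?v z - deriv ?u z * ?v z) * E * F"
         "K1 = (y z * deriv ?v z - deriv y z * ?v z) * E * F"
         "K2 = (?u z * deriv y z - deriv ?u z * y z) * E * F"
      using K(2)[OF z] K1[OF z] K2[OF z] by (simp_all add: E_def F_def add.assoc)
    hence "K * y z = K1 * ?u z + K2 * ?v z"
      unfolding Ks by (simp only: algebra_simps)
    thus "y z = K1 / K * ?u z + K2 / K * ?v z"
      using K(1) by (simp add: field_simps)
  qed
qed

lemma reg2F1_frob_independent:
  assumes s: "s \<notin> \<int>"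
    and eq: "\<And>z. z \<in> lens \<Longrightarrow> \<alpha> * reg2F1 a b (1 - s) z + \<beta> * frob a b s z = \<alpha>' * reg2F1 a b (1 - s) z + \<beta>' * frob a b s z"
  shows "\<alpha> = \<alpha>'" "\<beta> = \<beta>'"
proof -
  let ?u = "reg2F1 a b (1 - s)" and ?v = "frob a b s"
  define z :: complex where "z = 1 / 2"
  have z: "z \<in> lens" using of_real_in_lens[of "1/2"] by (simp add: z_def)
  note L = lens_notin_nonpos_Reals[OF z]
  obtain K where K: "K \<noteq> 0" "(?u z * deriv ?v z - deriv ?u z * ?v z) * z powr (1 - s) * (1 - z) powr (a + b + s) = K"
    using wronskian_reg2F1_frob[OF s] z by metis
  have D: "(?u has_field_derivative deriv ?u z) (at z)" "(?v has_field_derivative deriv ?v z) (at z)"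
    using solves_gaussD(1)[OF solves_gauss_reg2F1 open_ball, of z] L(5) solves_gaussD(1)[OF solves_gauss_frob open_lens z] by auto
  have "((\<lambda>z. \<alpha> * ?u z + \<beta> * ?v z) has_field_derivative \<alpha> * deriv ?u z + \<beta> * deriv ?v z) (at z)"
    by (intro DERIV_add DERIV_cmult D)
  moreover have "((\<lambda>z. \<alpha> * ?u z + \<beta> * ?v z) has_field_derivative \<alpha>' * deriv ?u z + \<beta>' * deriv ?v z) (at z)"
    by (rule has_field_derivative_transform_within_open[OF _ open_lens z])
       (auto intro!: DERIV_add DERIV_cmult D simp: eq)
  ultimately have d: "\<alpha> * deriv ?u z + \<beta> * deriv ?v z = \<alpha>' * deriv ?u z + \<beta>' * deriv ?v z"
    by (rule DERIV_unique)
  define W where "W = ?u z * deriv ?v z - deriv ?u z * ?v z"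
  have W: "W \<noteq> 0" using K by (auto simp: W_def)
  have e: "(\<alpha> - \<alpha>') * ?u z = (\<beta>' - \<beta>) * ?v z" "(\<alpha> - \<alpha>') * deriv ?u z = (\<beta>' - \<beta>) * deriv ?v z"
    using d eq[OF z] by (simp_all add: algebra_simps)
  have "(\<alpha> - \<alpha>') * W = ((\<alpha> - \<alpha>') * ?u z) * deriv ?v z - ((\<alpha> - \<alpha>') * deriv ?u z) * ?v z"
    by (simp add: W_def algebra_simps)
  also have "\<dots> = 0" unfolding e by simp
  finally have "(\<alpha> - \<alpha>') * W = 0" .
  moreover have "(\<beta>' - \<beta>) * W = ((\<beta>' - \<beta>) * deriv ?v z) * ?u z - ((\<beta>' - \<beta>) * ?v z) * deriv ?u z"
    by (simp add: W_def algebra_simps)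
  hence "(\<beta>' - \<beta>) * W = 0" unfolding e[symmetric] by simp
  ultimately show "\<alpha> = \<alpha>'" "\<beta> = \<beta>'" using W by auto
qed

section \<open>The connection formula between zero and one\<close>

lemma of_int_not_Ints_shift:
  fixes s :: complex
  assumes "s \<notin> \<int>"
  shows "s + of_int k \<notin> \<int>" "s - of_int k \<notin> \<int>" "of_int k - s \<notin> \<int>" "- s \<notin> \<int>"
proof -
  show "s + of_int k \<notin> \<int>" using assms Ints_diff[of "s + of_int k" "of_int k"] by auto
  show "s - of_int k \<notin> \<int>" using assms Ints_add[of "s - of_int k" "of_int k"] by auto
  show "of_int k - s \<notin> \<int>" using assms Ints_diff[of "of_int k" "of_int k - s"] by auto
  show "- s \<notin> \<int>" using assms Ints_minus[of "- s"] by auto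
qed

lemma solves_gauss_at_1: "solves_gauss a b (1 - s) lens (\<lambda>z. reg2F1 a b (a + b + s) (1 - z))"
proof -
  have "solves_gauss a b (a + b + 1 - (a + b + s)) lens (\<lambda>z. reg2F1 a b (a + b + s) (1 - z))"
    by (rule solves_gauss_reflect[OF solves_gauss_reg2F1 open_ball open_lens])
       (use lens_notin_nonpos_Reals in auto)
  thus ?thesis by simp
qed

text \<open>
  For \<open>Re s < 0\<close> the solution with exponent \<open>s\<close> dominates at the origin. Its coefficient can
  therefore be read off from the limit of \<open>z\<^sup>-\<^sup>s\<close> times the left-hand side, which is known from the
  behaviour of Gauss's series at \<open>1\<close>.
\<close>
lemma connection_frob_coeff_Re_neg:
  assumes s: "s \<notin> \<int>" "Re s < 0" and c: "a + b + s \<notin> \<int>\<^sub>\<le>\<^sub>0"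
    and eq: "\<And>z. z \<in> lens \<Longrightarrow> reg2F1 a b (a + b + s) (1 - z) = \<alpha> * reg2F1 a b (1 - s) z + \<beta> * frob a b s z"
  shows "\<beta> * sin (of_real pi * s) / of_real pi = - (rGamma a * rGamma b)"
proof -
  have nz: "rGamma (- s) \<noteq> 0"
    using of_int_not_Ints_shift(4)[OF s(1)] nonpos_Ints_Int by (auto simp: rGamma_eq_zero_iff)
  have "((\<lambda>r::real. of_real (1 - r) powr (- s) * reg2F1 a b (a + b + s) (of_real r)) \<longlongrightarrow>
           Gamma (- s) * rGamma a * rGamma b) (at_left 1)"
    using reg2F1_at_1[OF c, of a b] s by simp
  hence "((\<lambda>r::real. of_real r powr (- s) * reg2F1 a b (a + b + s) (of_real (1 - r))) \<longlongrightarrow>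
           Gamma (- s) * rGamma a * rGamma b) (at_right 0)"
  proof -
    assume *: "((\<lambda>r::real. of_real (1 - r) powr (- s) * reg2F1 a b (a + b + s) (of_real r)) \<longlongrightarrow>
           Gamma (- s) * rGamma a * rGamma b) (at_left 1)"
    have "filterlim (\<lambda>r::real. 1 - r) (at_left 1) (at_right 0)"
      by real_asymp
    from filterlim_compose[OF * this] show ?thesis by simp
  qed
  moreover have "((\<lambda>r::real. of_real r powr (- s) * reg2F1 a b (a + b + s) (of_real (1 - r))) \<longlongrightarrow>
           \<alpha> * (0 * rGamma (1 - s)) + \<beta> * rGamma (1 + s)) (at_right 0)"
  proof (rule Lim_transform_eventually)
    have "((\<lambda>r::real. norm (of_real r powr (- s) :: complex)) \<longlongrightarrow> 0) (at_right 0)"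
    proof (rule Lim_transform_eventually)
      show "((\<lambda>r::real. r powr Re (- s)) \<longlongrightarrow> 0) (at_right 0)"
      proof -
        have "((\<lambda>r::real. r powr Re (- s)) \<longlongrightarrow> 0 powr Re (- s)) (at_right 0)"
          by (intro tendsto_powr2 tendsto_const) (use s in \<open>auto simp: eventually_at_filter intro: tendsto_ident_at\<close>)
        thus ?thesis using s by simp
      qed
      show "eventually (\<lambda>r::real. r powr Re (- s) = norm (of_real r powr (- s) :: complex)) (at_right 0)"
        using eventually_at_right_less[of "0::real"]
        by eventually_elim (simp add: norm_powr_real_powr)
    qed
    hence "((\<lambda>r::real. of_real r powr (- s) :: complex) \<longlongrightarrow> 0) (at_right 0)"
      by (rule tendsto_norm_zero_cancel)
    thus "((\<lambda>r::real. \<alpha> * (of_real r powr (- s) * reg2F1 a b (1 - s) (of_real r)) +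
         \<beta> * reg2F1 (a + s) (b + s) (1 + s) (of_real r)) \<longlongrightarrow>
           \<alpha> * (0 * rGamma (1 - s)) + \<beta> * rGamma (1 + s)) (at_right 0)"
      by (intro tendsto_intros reg2F1_tendsto_0)
    show "eventually (\<lambda>r::real. \<alpha> * (of_real r powr (- s) * reg2F1 a b (1 - s) (of_real r)) +
         \<beta> * reg2F1 (a + s) (b + s) (1 + s) (of_real r) = 
         of_real r powr (- s) * reg2F1 a b (a + b + s) (of_real (1 - r))) (at_right 0)"
      using eventually_of_real_in_lens
    proof eventually_elim
      case (elim r)
      have "of_real r powr (- s) * of_real r powr s = (1 :: complex)"
        using elim by (simp add: powr_add[symmetric])
      thus ?case
        using eq[of "of_real r"] elim
        by (simp add: frob_def distrib_left mult.left_commute[of _ \<alpha>] mult.left_commute[of _ \<beta>] mult.assoc[symmetric])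
    qed
  qed
  ultimately have "Gamma (- s) * rGamma a * rGamma b = \<alpha> * (0 * rGamma (1 - s)) + \<beta> * rGamma (1 + s)"
    by (rule tendsto_unique[OF trivial_limit_at_right_real])
  hence "rGamma (- s) * (Gamma (- s) * rGamma a * rGamma b) = \<beta> * (rGamma (- s) * rGamma (1 - (- s)))"
    by simp
  also have "rGamma (- s) * rGamma (1 - (- s)) = sin (of_real pi * (- s)) / of_real pi"
    by (rule rGamma_reflection_complex)
  finally have "rGamma (- s) * (Gamma (- s) * rGamma a * rGamma b) = - (\<beta> * sin (of_real pi * s) / of_real pi)"
    by simp
  moreover have "rGamma (- s) * (Gamma (- s) * rGamma a * rGamma b) = rGamma a * rGamma b"
    using nz by (simp add: Gamma_def mult.assoc[symmetric])
  ultimately show ?thesis by simp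
qed

text \<open>
  Differentiating the relation replaces \<open>s\<close> by \<open>s - 1\<close>. After finitely many steps the real part
  is negative.
\<close>
lemma connection_frob_coeff:
  assumes "s \<notin> \<int>" "a + b + s \<notin> \<int>\<^sub>\<le>\<^sub>0"
    and "\<And>z. z \<in> lens \<Longrightarrow> reg2F1 a b (a + b + s) (1 - z) = \<alpha> * reg2F1 a b (1 - s) z + \<beta> * frob a b s z"
  shows "\<beta> * sin (of_real pi * s) / of_real pi = - (rGamma a * rGamma b)"
proof -
  obtain N :: nat where "Re s < real N" using reals_Archimedean2 by blast
  thus ?thesis using assms
  proof (induction N arbitrary: a b s \<alpha> \<beta>)
    case 0
    thus ?case by (intro connection_frob_coeff_Re_neg) auto
  next
    case (Suc N a b s \<alpha> \<beta>)
    note s = Suc.prems(2) and c = Suc.prems(3) and eq = Suc.prems(4)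
    have s1: "s - 1 \<notin> \<int>" using of_int_not_Ints_shift(2)[OF s, of 1] by simp
    have sum1: "(a + 1) + (b + 1) + (s - 1) = a + b + s + 1" by simp
    have c1: "(a + 1) + (b + 1) + (s - 1) \<notin> \<int>\<^sub>\<le>\<^sub>0"
      using c unfolding sum1 by (auto simp: plus_one_in_nonpos_Ints_imp)
    obtain \<alpha>1 \<beta>1 where eq1: "\<And>z. z \<in> lens \<Longrightarrow> reg2F1 (a + 1) (b + 1) ((a + 1) + (b + 1) + (s - 1)) (1 - z)
        = \<alpha>1 * reg2F1 (a + 1) (b + 1) (1 - (s - 1)) z + \<beta>1 * frob (a + 1) (b + 1) (s - 1) z"
      using reg2F1_frob_span[OF s1 solves_gauss_at_1] by blast
    have \<beta>1: "\<beta>1 * sin (of_real pi * (s - 1)) / of_real pi = - (rGamma (a + 1) * rGamma (b + 1))"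
      using Suc.prems(1) s1 c1 eq1 by (intro Suc.IH) auto
    have "- (a * b) * \<alpha>1 * reg2F1 (a + 1) (b + 1) (1 - (s - 1)) z + - (a * b) * \<beta>1 * frob (a + 1) (b + 1) (s - 1) z
       = \<alpha> * (a * b) * reg2F1 (a + 1) (b + 1) (1 - (s - 1)) z + \<beta> * frob (a + 1) (b + 1) (s - 1) z" if z: "z \<in> lens" for z
    proof -
      note L = lens_notin_nonpos_Reals[OF z]
      have "((\<lambda>z. reg2F1 a b (a + b + s) (1 - z)) has_field_derivative
           a * b * reg2F1 (a + 1) (b + 1) (a + b + s + 1) (1 - z) * - 1) (at z)"
        using L by (intro reg2F1_has_field_derivative') (auto intro!: derivative_eq_intros)
      hence "((\<lambda>z. \<alpha> * reg2F1 a b (1 - s) z + \<beta> * frob a b s z) has_field_derivative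
           a * b * reg2F1 (a + 1) (b + 1) (a + b + s + 1) (1 - z) * - 1) (at z)"
        by (rule has_field_derivative_transform_within_open[OF _ open_lens z eq])
      moreover have "((\<lambda>z. \<alpha> * reg2F1 a b (1 - s) z + \<beta> * frob a b s z) has_field_derivative
           \<alpha> * (a * b * reg2F1 (a + 1) (b + 1) (1 - s + 1) z) + \<beta> * frob (a + 1) (b + 1) (s - 1) z) (at z)"
        by (intro DERIV_add DERIV_cmult reg2F1_has_field_derivative frob_has_field_derivative L)
      ultimately have "a * b * reg2F1 (a + 1) (b + 1) (a + b + s + 1) (1 - z) * - 1 =
          \<alpha> * (a * b * reg2F1 (a + 1) (b + 1) (1 - s + 1) z) + \<beta> * frob (a + 1) (b + 1) (s - 1) z"
        by (rule DERIV_unique)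
      moreover have "1 - s + 1 = 1 - (s - 1)" by simp
      ultimately show ?thesis
        using eq1[OF z] unfolding sum1 by (simp only:) (simp add: algebra_simps)
    qed
    from reg2F1_frob_independent(2)[OF s1 this] have "\<beta> = - (a * b) * \<beta>1" by simp
    hence "\<beta> * sin (of_real pi * s) / of_real pi = (a * b) * (\<beta>1 * sin (of_real pi * (s - 1)) / of_real pi)"
      by (simp add: right_diff_distrib sin_diff)
    also have "\<dots> = - ((a * rGamma (a + 1)) * (b * rGamma (b + 1)))"
      unfolding \<beta>1 by simp
    also have "\<dots> = - (rGamma a * rGamma b)" by (simp only: rGamma_plus1)
    finally show ?case .
  qed
qed

text \<open>
  The classical connection formula in regularised form. The coefficient of the second solution is
  known from the lemma above. Euler's transformation of the left-hand side exchanges the two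
  solutions and replaces \<open>s\<close> by \<open>-s\<close>, so that the first coefficient follows as well.
\<close>
theorem reg2F1_connection:
  assumes s: "s \<notin> \<int>" and c: "a + b + s \<notin> \<int>\<^sub>\<le>\<^sub>0" and z: "norm z < 1" "norm (1 - z) < 1"
  shows "sin (of_real pi * s) / of_real pi * reg2F1 a b (a + b + s) (1 - z) =
    rGamma (a + s) * rGamma (b + s) * reg2F1 a b (1 - s) z
    - rGamma a * rGamma b * (z powr s * reg2F1 (a + s) (b + s) (1 + s) z)"
proof -
  have zl: "z \<in> lens" using z by (auto simp: dist_norm norm_minus_commute)
  have s': "- s \<notin> \<int>" using of_int_not_Ints_shift(4)[OF s] .
  obtain \<alpha> \<beta> where eq: "\<And>z. z \<in> lens \<Longrightarrow> reg2F1 a b (a + b + s) (1 - z) = \<alpha> * reg2F1 a b (1 - s) z + \<beta> * frob a b s z"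
    using reg2F1_frob_span[OF s solves_gauss_at_1] by blast
  have sum': "(b + s) + (a + s) + (- s) = a + b + s" by simp
  obtain \<alpha>' \<beta>' where eq': "\<And>z. z \<in> lens \<Longrightarrow> reg2F1 (b + s) (a + s) ((b + s) + (a + s) + (- s)) (1 - z)
      = \<alpha>' * reg2F1 (b + s) (a + s) (1 - (- s)) z + \<beta>' * frob (b + s) (a + s) (- s) z"
    using reg2F1_frob_span[OF s' solves_gauss_at_1] by blast
  have \<beta>: "\<beta> * sin (of_real pi * s) / of_real pi = - (rGamma a * rGamma b)"
    using s c eq by (rule connection_frob_coeff)
  have \<beta>': "\<beta>' * sin (of_real pi * (- s)) / of_real pi = - (rGamma (b + s) * rGamma (a + s))"
    by (rule connection_frob_coeff[OF s' _ eq']) (use c in \<open>simp_all only: sum' not_False_eq_True\<close>)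
  have "\<alpha> * reg2F1 a b (1 - s) z + \<beta> * frob a b s z = \<beta>' * reg2F1 a b (1 - s) z + \<alpha>' * frob a b s z"
    if z: "z \<in> lens" for z
  proof -
    note L = lens_notin_nonpos_Reals[OF z]
    have "reg2F1 a b (a + b + s) (1 - z) = z powr s * reg2F1 (b + s) (a + s) (a + b + s) (1 - z)"
      using reg2F1_euler[OF c L(6), of a b] by (simp add: algebra_simps)
    also have "\<dots> = \<alpha>' * (z powr s * reg2F1 (b + s) (a + s) (1 + s) z) + \<beta>' * (z powr s * z powr (- s)) * reg2F1 b a (1 - s) z"
      using eq'[OF z] unfolding sum' by (simp add: frob_def algebra_simps)
    also have "z powr s * z powr (- s) = 1"
      using L(3) by (simp add: powr_add[symmetric])
    finally show ?thesis
      using eq[OF z] by (simp add: frob_def reg2F1_commute[of b] reg2F1_commute[of "b + s"] add.commute)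
  qed
  from reg2F1_frob_independent(1)[OF s this] have "\<alpha> = \<beta>'" .
  hence \<alpha>: "\<alpha> * sin (of_real pi * s) / of_real pi = rGamma (a + s) * rGamma (b + s)"
    using \<beta>' by (simp add: mult.commute)
  have "sin (of_real pi * s) / of_real pi * reg2F1 a b (a + b + s) (1 - z) =
     (\<alpha> * sin (of_real pi * s) / of_real pi) * reg2F1 a b (1 - s) z
     + (\<beta> * sin (of_real pi * s) / of_real pi) * frob a b s z"
    unfolding eq[OF zl] by (simp add: algebra_simps add_divide_distrib)
  thus ?thesis
    unfolding \<alpha> \<beta> by (simp add: frob_def)
qed

section \<open>Uniformisation of the cut plane\<close>

definition cut_plane :: "complex set" where
  "cut_plane = - (complex_of_real ` {1..})"

lemma in_cut_plane_iff: "z \<in> cut_plane \<longleftrightarrow> 1 - z \<notin> \<real>\<^sub>\<le>\<^sub>0"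
  by (force simp: cut_plane_def complex_nonpos_Reals_iff complex_eq_iff image_iff)

lemma open_cut_plane: "open cut_plane"
proof -
  have "cut_plane = (\<lambda>z. 1 - z) -` (- \<real>\<^sub>\<le>\<^sub>0)"
    by (auto simp: in_cut_plane_iff)
  also have "open \<dots>"
    by (intro open_vimage open_Compl closed_nonpos_Reals_complex continuous_intros)
  finally show ?thesis .
qed

lemma connected_cut_plane: "connected cut_plane"
proof (rule starlike_imp_connected)
  show "starlike cut_plane"
    unfolding starlike_def
  proof (intro bexI[of _ 0] ballI)
    show "0 \<in> cut_plane" by (simp add: in_cut_plane_iff)
    fix z assume z: "z \<in> cut_plane"
    show "closed_segment 0 z \<subseteq> cut_plane"
    proof
      fix y assume "y \<in> closed_segment 0 z"
      then obtain t :: real where t: "0 \<le> t" "t \<le> 1" "y = of_real t * z"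
        by (auto simp: closed_segment_def scaleR_conv_of_real)
      have "t * Re z < 1" if "Im z = 0 \<or> t = 0"
      proof (cases "t = 0")
        case False
        with that z have "Re z < 1"
          by (auto simp: in_cut_plane_iff complex_nonpos_Reals_iff)
        show ?thesis
        proof (cases "Re z \<ge> 0")
          case True
          hence "t * Re z \<le> 1 * Re z" using t by (intro mult_right_mono) auto
          thus ?thesis using \<open>Re z < 1\<close> by simp
        next
          case False
          hence "t * Re z \<le> 0" using t by (simp add: mult_nonneg_nonpos)
          thus ?thesis by simp
        qed
      qed auto
      thus "y \<in> cut_plane"
        using t by (auto simp: in_cut_plane_iff complex_nonpos_Reals_iff)
    qed
  qed
qed

lemma ball_subset_cut_plane: "ball 0 1 \<subseteq> cut_plane"
  using one_minus_notin_nonpos_Reals by (auto simp: in_cut_plane_iff)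

text \<open>
  The inverse of \<open>w \<mapsto> 4w / (1 + w)\<^sup>2\<close>, which maps the unit disc conformally onto the cut plane.
  The points \<open>1\<close> and \<open>\<infinity>\<close> correspond to \<open>w = 1\<close> and \<open>w = -1\<close>.
\<close>
definition disc_coord :: "complex \<Rightarrow> complex" where
  "disc_coord z = (1 - csqrt (1 - z)) / (1 + csqrt (1 - z))"

lemma Re_csqrt_pos: "z \<notin> \<real>\<^sub>\<le>\<^sub>0 \<Longrightarrow> Re (csqrt z) > 0"
proof (rule ccontr)
  assume z: "z \<notin> \<real>\<^sub>\<le>\<^sub>0" and "\<not> Re (csqrt z) > 0"
  hence "Re (csqrt z) = 0"
    using csqrt_principal[of z] by auto
  hence "csqrt z = \<i> * of_real (Im (csqrt z))"
    by (simp add: complex_eq_iff)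
  hence "z = (\<i> * of_real (Im (csqrt z))) ^ 2"
    using power2_csqrt[of z] by metis
  also have "\<dots> = of_real (- ((Im (csqrt z)) ^ 2))"
    by (simp add: power_mult_distrib)
  finally show False
    using z by (metis nonpos_Reals_of_real_iff neg_le_0_iff_le zero_le_power2)
qed

lemma disc_coord:
  assumes "z \<in> cut_plane"
  shows "norm (disc_coord z) < 1" "4 * disc_coord z / (1 + disc_coord z) ^ 2 = z" "disc_coord z \<noteq> -1"
proof -
  define q where "q = csqrt (1 - z)"
  have q: "Re q > 0" using assms unfolding q_def by (intro Re_csqrt_pos) (simp add: in_cut_plane_iff)
  have q2: "q ^ 2 = 1 - z" by (simp add: q_def)
  have nz: "1 + q \<noteq> 0"
  proof
    assume "1 + q = 0"
    hence "Re (1 + q) = 0" by simp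
    thus False using q by simp
  qed
  have "norm (1 - q) ^ 2 < norm (1 + q) ^ 2"
    unfolding cmod_power2 using q by (simp add: power2_eq_square algebra_simps)
  hence "norm (1 - q) < norm (1 + q)"
    by (rule power2_less_imp_less) auto
  thus "norm (disc_coord z) < 1"
    using nz by (simp add: disc_coord_def q_def[symmetric] norm_divide)
  thus "disc_coord z \<noteq> -1" by auto
  have 1: "1 + disc_coord z = 2 / (1 + q)"
    using nz by (simp add: disc_coord_def q_def[symmetric] field_simps)
  have "4 * disc_coord z / (1 + disc_coord z) ^ 2 = (1 - q) * (1 + q)"
    unfolding 1 using nz by (simp add: disc_coord_def q_def[symmetric] power2_eq_square)
  also have "\<dots> = z" using q2 by (simp add: power2_eq_square algebra_simps)
  finally show "4 * disc_coord z / (1 + disc_coord z) ^ 2 = z" .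
qed

lemma holomorphic_disc_coord: "disc_coord holomorphic_on cut_plane"
proof -
  have "1 + csqrt (1 - z) \<noteq> 0" if "z \<in> cut_plane" for z
  proof
    assume "1 + csqrt (1 - z) = 0"
    hence "csqrt (1 - z) = -1" by (simp add: add_eq_0_iff)
    moreover have "Re (csqrt (1 - z)) > 0"
      using that by (intro Re_csqrt_pos) (simp add: in_cut_plane_iff)
    ultimately show False by (simp only: uminus_complex.sel one_complex.sel)
  qed
  thus ?thesis
    unfolding disc_coord_def [abs_def]
    by (intro holomorphic_intros) (auto simp: in_cut_plane_iff)
qed

definition koebe :: "complex \<Rightarrow> complex" where "koebe w = 4 * w / (1 + w) ^ 2"

lemma norm_koebe_less_1: "norm w < 1 / 6 \<Longrightarrow> norm (koebe w) < 1"
proof -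
  assume w: "norm w < 1 / 6"
  have "5 / 6 < norm (1 + w)"
    using norm_triangle_ineq4[of "1 + w" w] w by simp
  hence "(5 / 6) ^ 2 < norm (1 + w) ^ 2"
    by (intro power_strict_mono) auto
  hence "4 * norm w < norm (1 + w) ^ 2" using w by (simp add: power2_eq_square)
  thus ?thesis
    unfolding koebe_def norm_divide norm_mult norm_power
    by (subst pos_divide_less_eq) auto
qed

text \<open>
  In the coordinate \<open>w\<close> the coefficients of Gauss's equation, divided as here, have their poles on
  the unit circle. The only singular point inside the disc is the origin.
\<close>
lemma pullback_ode:
  fixes a b c w :: complex
  assumes w: "norm w < 1 / 6"
  defines "g \<equiv> (\<lambda>w. reg2F1 a b c (koebe w))"
  shows "w * deriv (deriv g) w + c * deriv g w =
     w * ((4 * (a + b) - 2 * c - 2 * (c - 1) * w) / (1 - w ^ 2) * deriv g w) + 4 * a * b / (1 + w) ^ 2 * g w"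
proof -
  let ?f = "reg2F1 a b c"
  have nz: "1 + w \<noteq> 0" "1 - w \<noteq> 0" if "norm w < 1 / 6" for w :: complex
    using that by (auto simp: add_eq_0_iff)
  have dk: "(koebe has_field_derivative 4 * (1 - w) / (1 + w) ^ 3) (at w)" if "norm w < 1 / 6" for w
    unfolding koebe_def using nz[OF that]
    by (auto intro!: derivative_eq_intros simp: divide_simps) (simp add: algebra_simps power2_eq_square power3_eq_cube power4_eq_xxxx)
  have dk1: "((\<lambda>w. 4 * (1 - w) / (1 + w) ^ 3) has_field_derivative 8 * (w - 2) / (1 + w) ^ 4) (at w)"
    using nz[OF w]
    by (auto intro!: derivative_eq_intros simp: divide_simps) (simp add: algebra_simps eval_nat_numeral)
  note D = solves_gaussD[OF solves_gauss_reg2F1[of a b c] open_ball, simplified]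
  have d1: "(g has_field_derivative deriv ?f (koebe w) * (4 * (1 - w) / (1 + w) ^ 3)) (at w)" if "norm w < 1 / 6" for w
    unfolding g_def by (rule DERIV_chain2[OF D(1) dk]) (use that norm_koebe_less_1 in auto)
  have deriv_g: "deriv g w = deriv ?f (koebe w) * (4 * (1 - w) / (1 + w) ^ 3)" if "norm w < 1 / 6" for w
    using d1[OF that] by (rule DERIV_imp_deriv)
  have "((\<lambda>w. deriv ?f (koebe w) * (4 * (1 - w) / (1 + w) ^ 3)) has_field_derivative
     (deriv (deriv ?f) (koebe w) * (4 * (1 - w) / (1 + w) ^ 3)) * (4 * (1 - w) / (1 + w) ^ 3)
      + 8 * (w - 2) / (1 + w) ^ 4 * deriv ?f (koebe w)) (at w)"
    by (intro DERIV_mult dk1 DERIV_chain2[OF D(2) dk[OF w]]) (use w norm_koebe_less_1 in auto)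
  hence "(deriv g has_field_derivative
     (deriv (deriv ?f) (koebe w) * (4 * (1 - w) / (1 + w) ^ 3)) * (4 * (1 - w) / (1 + w) ^ 3)
      + 8 * (w - 2) / (1 + w) ^ 4 * deriv ?f (koebe w)) (at w)"
    by (rule has_field_derivative_transform_within_open[of _ _ _ "ball 0 (1/6)"]) (use w deriv_g in auto)
  hence deriv_g2: "deriv (deriv g) w = (deriv (deriv ?f) (koebe w) * (4 * (1 - w) / (1 + w) ^ 3)) * (4 * (1 - w) / (1 + w) ^ 3)
      + 8 * (w - 2) / (1 + w) ^ 4 * deriv ?f (koebe w)"
    by (rule DERIV_imp_deriv)
  define y y1 y2 where "y = ?f (koebe w)" and "y1 = deriv ?f (koebe w)" and "y2 = deriv (deriv ?f) (koebe w)"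
  define u v where "u = inverse (1 + w)" and "v = inverse (1 - w)"
  have uv: "(1 + w) * u = 1" "(1 - w) * v = 1" using nz[OF w] by (simp_all add: u_def v_def)
  define k where "k = koebe w"
  have k: "k = 4 * w * u ^ 2" by (simp add: k_def koebe_def u_def power_inverse divide_inverse)
  have ode: "k * (1 - k) * y2 = a * b * y - (c - (a + b + 1) * k) * y1"
    using D(3)[OF norm_koebe_less_1[OF w]] by (simp add: y_def y1_def y2_def k_def algebra_simps)
  have kk: "k * (1 - k) = 4 * w * (1 - w) ^ 2 * u ^ 4"
    unfolding k using uv(1) by algebra
  have e1: "w * (y2 * (4 * (1 - w) * u ^ 3) * (4 * (1 - w) * u ^ 3)) = 4 * u ^ 2 * (a * b * y - (c - (a + b + 1) * k) * y1)"
    unfolding ode[symmetric] kk by (simp add: algebra_simps eval_nat_numeral)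
  have e2: "- 4 * u ^ 2 * (c - (a + b + 1) * (4 * w * u ^ 2)) + w * (8 * (w - 2) * u ^ 4) + c * (4 * (1 - w) * u ^ 3)
      = w * ((4 * (a + b) - 2 * c - 2 * (c - 1) * w) * (u * v) * (4 * (1 - w) * u ^ 3))"
    using uv by algebra
  have "w * deriv (deriv g) w + c * deriv g w =
     w * (y2 * (4 * (1 - w) * u ^ 3) * (4 * (1 - w) * u ^ 3)) + w * (8 * (w - 2) * u ^ 4) * y1 + c * (4 * (1 - w) * u ^ 3) * y1"
    unfolding deriv_g2 deriv_g[OF w]
    by (simp add: y_def[symmetric] y1_def[symmetric] y2_def[symmetric] u_def divide_inverse power_inverse algebra_simps)
  also have "\<dots> = 4 * u ^ 2 * (a * b * y) + (- 4 * u ^ 2 * (c - (a + b + 1) * (4 * w * u ^ 2)) + w * (8 * (w - 2) * u ^ 4) + c * (4 * (1 - w) * u ^ 3)) * y1"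
    unfolding e1 k by (simp add: algebra_simps)
  also have "\<dots> = 4 * u ^ 2 * (a * b * y) + w * ((4 * (a + b) - 2 * c - 2 * (c - 1) * w) * (u * v) * (4 * (1 - w) * u ^ 3)) * y1"
    unfolding e2 ..
  also have "u * v = inverse (1 - w ^ 2)"
    unfolding u_def v_def by (simp add: inverse_mult_distrib[symmetric] power2_eq_square algebra_simps)
  also have "4 * u ^ 2 * (a * b * y) + w * ((4 * (a + b) - 2 * c - 2 * (c - 1) * w) * inverse (1 - w ^ 2) * (4 * (1 - w) * u ^ 3)) * y1
     = w * ((4 * (a + b) - 2 * c - 2 * (c - 1) * w) / (1 - w ^ 2) * deriv g w) + 4 * a * b / (1 + w) ^ 2 * g w"
    unfolding deriv_g[OF w]
    by (simp add: y_def y1_def g_def u_def divide_inverse power_inverse mult_ac)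
  finally show ?thesis .
qed

section \<open>Analytic continuation and its dependence on the parameters\<close>

definition koebe_fps :: "complex fps" where
  "koebe_fps = (fps_const 4 * fps_X) / (1 + fps_X) ^ 2"

definition pullback_fps :: "complex \<Rightarrow> complex \<Rightarrow> complex \<Rightarrow> complex fps" where
  "pullback_fps a b c = Abs_fps (reg2F1_coeff a b c) oo koebe_fps"

lemma koebe_fps_0: "koebe_fps $ 0 = 0"
  unfolding koebe_fps_def by (simp add: fps_divide_unit fps_mult_nth_0)

lemma has_fps_expansion_koebe: "koebe has_fps_expansion koebe_fps"
  unfolding koebe_def [abs_def] koebe_fps_def
  by (intro fps_expansion_intros) (simp add: fps_nth_power_0)

lemma has_fps_expansion_reg2F1: "reg2F1 a b c has_fps_expansion Abs_fps (reg2F1_coeff a b c)"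
proof (rule has_fps_expansionI)
  have "eventually (\<lambda>x. x \<in> ball 0 1) (nhds (0::complex))"
    by (intro eventually_nhds_in_open) auto
  thus "eventually (\<lambda>u. (\<lambda>n. Abs_fps (reg2F1_coeff a b c) $ n * u ^ n) sums reg2F1 a b c u) (nhds 0)"
    by eventually_elim (use reg2F1_sums in auto)
qed

text \<open>
  The composition is also the reason why each Taylor coefficient of the pulled back solution is
  a polynomial in finitely many \<open>reg2F1_coeff\<close>, hence continuous in the parameters.
\<close>
lemma has_fps_expansion_pullback: "(\<lambda>w. reg2F1 a b c (koebe w)) has_fps_expansion pullback_fps a b c"
  using has_fps_expansion_compose[OF has_fps_expansion_reg2F1 has_fps_expansion_koebe koebe_fps_0]
  by (simp add: pullback_fps_def o_def)

text \<open>
  The Taylor coefficients of \<open>(p + q w) / (1 - w\<^sup>2)\<close>.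
\<close>
definition drift_fps :: "complex \<Rightarrow> complex \<Rightarrow> complex fps" where
  "drift_fps p q = Abs_fps (\<lambda>i. if even i then p else q)"

lemma drift_fps: "fps_const p + fps_const q * fps_X = drift_fps p q * (1 - fps_X ^ 2)"
proof (rule fps_ext)
  fix n
  have "drift_fps p q * (1 - fps_X ^ 2) = drift_fps p q - fps_X * (fps_X * drift_fps p q)"
    by (simp add: algebra_simps power2_eq_square)
  thus "(fps_const p + fps_const q * fps_X) $ n = (drift_fps p q * (1 - fps_X ^ 2)) $ n"
    by (cases n; cases "n - 1") (auto simp: drift_fps_def)
qed

text \<open>
  The Taylor coefficients of \<open>p / (1 + w)\<^sup>2\<close>.
\<close>
definition potential_fps :: "complex \<Rightarrow> complex fps" where
  "potential_fps p = Abs_fps (\<lambda>i. p * (-1) ^ i * (of_nat i + 1))"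

lemma potential_fps: "fps_const p = potential_fps p * (1 + fps_X) ^ 2"
proof (rule fps_ext)
  fix n
  have "potential_fps p * (1 + fps_X) ^ 2 = potential_fps p + 2 * (fps_X * potential_fps p) + fps_X * (fps_X * potential_fps p)"
    by (simp add: algebra_simps power2_eq_square)
  also have "2 * (fps_X * potential_fps p) = fps_X * potential_fps p + fps_X * potential_fps p"
    by simp
  finally show "fps_const p $ n = (potential_fps p * (1 + fps_X) ^ 2) $ n"
    by (cases n; cases "n - 1") (auto simp: potential_fps_def algebra_simps)
qed

lemma pullback_recurrence:
  fixes a b c :: complex
  defines "G \<equiv> pullback_fps a b c"
  shows "(of_nat n + 1) * (c + of_nat n) * G $ Suc n =
     (\<Sum>i\<le>n. of_nat i * G $ i * (if even (n - i) then 4 * (a + b) - 2 * c else - 2 * (c - 1)))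
     + (\<Sum>i\<le>n. G $ i * (4 * a * b * (-1) ^ (n - i) * (of_nat (n - i) + 1)))"
proof -
  let ?g = "\<lambda>w. reg2F1 a b c (koebe w)"
  let ?p = "4 * (a + b) - 2 * c" and ?q = "- 2 * (c - 1)"
  have G: "?g has_fps_expansion G"
    unfolding G_def by (rule has_fps_expansion_pullback)
  have P: "(\<lambda>w. (?p + ?q * w) / (1 - w ^ 2)) has_fps_expansion drift_fps ?p ?q"
  proof -
    have "(\<lambda>w. (?p + ?q * w) / (1 - w ^ 2)) has_fps_expansion (fps_const ?p + fps_const ?q * fps_X) / (1 - fps_X ^ 2)"
      by (intro fps_expansion_intros) auto
    also have "(fps_const ?p + fps_const ?q * fps_X) / (1 - fps_X ^ 2) = drift_fps ?p ?q"
    proof -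
      have "(1 - fps_X ^ 2 :: complex fps) $ 0 \<noteq> 0" by simp
      hence "(1 - fps_X ^ 2 :: complex fps) \<noteq> 0" by (metis fps_zero_nth)
      thus ?thesis unfolding drift_fps by simp
    qed
    finally show ?thesis .
  qed
  have Q: "(\<lambda>w. (4 * a * b) / (1 + w) ^ 2) has_fps_expansion potential_fps (4 * a * b)"
  proof -
    have "(\<lambda>w. (4 * a * b) / (1 + w) ^ 2) has_fps_expansion fps_const (4 * a * b) / (1 + fps_X) ^ 2"
      by (intro fps_expansion_intros) (auto simp: fps_nth_power_0)
    also have "fps_const (4 * a * b) / (1 + fps_X) ^ 2 = potential_fps (4 * a * b)"
    proof -
      have "((1 + fps_X) ^ 2 :: complex fps) $ 0 \<noteq> 0" by (simp add: fps_nth_power_0)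
      hence "((1 + fps_X) ^ 2 :: complex fps) \<noteq> 0" by (metis fps_zero_nth)
      thus ?thesis unfolding potential_fps by simp
    qed
    finally show ?thesis .
  qed
  have L: "(\<lambda>w. w * deriv (deriv ?g) w + c * deriv ?g w) has_fps_expansion
     fps_X * fps_deriv (fps_deriv G) + fps_const c * fps_deriv G"
    by (intro fps_expansion_intros G)
  have R: "(\<lambda>w. w * ((?p + ?q * w) / (1 - w ^ 2) * deriv ?g w) + (4 * a * b) / (1 + w) ^ 2 * ?g w) has_fps_expansion
     fps_X * (drift_fps ?p ?q * fps_deriv G) + potential_fps (4 * a * b) * G"
    by (intro fps_expansion_intros G P Q)
  have "eventually (\<lambda>w. w \<in> ball 0 (1/6)) (nhds (0::complex))"
    by (intro eventually_nhds_in_open) auto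
  hence "eventually (\<lambda>w. w * deriv (deriv ?g) w + c * deriv ?g w =
     w * ((?p + ?q * w) / (1 - w ^ 2) * deriv ?g w) + (4 * a * b) / (1 + w) ^ 2 * ?g w) (nhds 0)"
  proof eventually_elim
    case (elim w)
    have q: "?p + ?q * w = ?p - 2 * (c - 1) * w" by (simp add: algebra_simps)
    have "norm w < 1 / 6" using elim by simp
    from pullback_ode[OF this, of a b c] show ?case unfolding q .
  qed
  from has_fps_expansion_cong[OF this refl] L
  have "(\<lambda>w. w * ((?p + ?q * w) / (1 - w ^ 2) * deriv ?g w) + (4 * a * b) / (1 + w) ^ 2 * ?g w) has_fps_expansion
     fps_X * fps_deriv (fps_deriv G) + fps_const c * fps_deriv G"
    by simp
  from fps_expansion_unique_complex[OF this R]
  have eq: "fps_X * fps_deriv (fps_deriv G) + fps_const c * fps_deriv G =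
      (fps_X * fps_deriv G) * drift_fps ?p ?q + G * potential_fps (4 * a * b)"
    by (simp only: mult_ac)
  have nth: "(fps_X * fps_deriv G) $ i = of_nat i * G $ i" for i
    by (cases i) auto
  have "(of_nat n + 1) * (c + of_nat n) * G $ Suc n = (fps_X * fps_deriv (fps_deriv G) + fps_const c * fps_deriv G) $ n"
    by (cases n) (auto simp: algebra_simps)
  also have "\<dots> = ((fps_X * fps_deriv G) * drift_fps ?p ?q + G * potential_fps (4 * a * b)) $ n"
    by (simp only: eq)
  also have "\<dots> = (\<Sum>i\<le>n. (fps_X * fps_deriv G) $ i * drift_fps ?p ?q $ (n - i)) + (\<Sum>i\<le>n. G $ i * potential_fps (4 * a * b) $ (n - i))"
    by (simp only: fps_add_nth fps_mult_nth atLeast0AtMost)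
  finally show ?thesis
    by (simp only: nth drift_fps_def potential_fps_def fps_nth_Abs_fps)
qed

text \<open>
  In the recurrence the terms of index \<open>i\<close> add up to at most \<open>M (n + 1) |G\<^sub>i|\<close>, because the
  weights \<open>i\<close> and \<open>n - i + 1\<close> of the two sums complement each other. Hence
  \<open>|G\<^sub>n\<^sub>+\<^sub>1| \<le> K / (n + 1) \<cdot> \<Sum>\<^sub>i\<^sub>\<le>\<^sub>n |G\<^sub>i|\<close> with \<open>K = M / \<delta>\<close>, and the partial sums grow no faster than the
  coefficients of \<open>(1 - w)\<^sup>-\<^sup>1\<^sup>-\<^sup>K\<close>. The parameters enter only through \<open>M\<close>, \<open>\<delta>\<close> and the constant term.
\<close>
lemma pullback_coeff_bound:
  fixes a b c :: complex
  defines "G \<equiv> pullback_fps a b c"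
  assumes \<delta>: "\<delta> > 0" "\<And>n. norm (c + of_nat n) \<ge> \<delta> * (real n + 1)"
    and M: "norm (4 * (a + b) - 2 * c) \<le> M" "norm (2 * (c - 1)) \<le> M" "norm (4 * a * b) \<le> M"
  shows "norm (G $ n) \<le> norm (rGamma c) * (pochhammer (1 + M / \<delta>) n / fact n)"
proof -
  define K where "K = M / \<delta>"
  have M0: "M \<ge> 0" using M(1) norm_ge_zero order_trans by blast
  have K0: "K \<ge> 0" using M0 \<delta>(1) by (simp add: K_def)
  have step: "norm (G $ Suc n) \<le> K / (real n + 1) * (\<Sum>i\<le>n. norm (G $ i))" for n
  proof -
    define T where "T i = of_nat i * G $ i * (if even (n - i) then 4 * (a + b) - 2 * c else - 2 * (c - 1))
       + G $ i * (4 * a * b * (-1) ^ (n - i) * (of_nat (n - i) + 1))" for i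
    have T: "norm (T i) \<le> M * (real n + 1) * norm (G $ i)" if "i \<le> n" for i
    proof -
      have "norm (T i) \<le> norm (of_nat i * G $ i * (if even (n - i) then 4 * (a + b) - 2 * c else - 2 * (c - 1)))
         + norm (G $ i * (4 * a * b * (-1) ^ (n - i) * (of_nat (n - i) + 1)))"
        unfolding T_def by (rule norm_triangle_ineq)
      also have "norm (of_nat i * G $ i * (if even (n - i) then 4 * (a + b) - 2 * c else - 2 * (c - 1))) \<le> real i * norm (G $ i) * M"
      proof -
        have "norm (- (2 * (c - 1))) \<le> M" using M(2) by (simp only: norm_minus_cancel)
        hence "norm (- 2 * (c - 1)) \<le> M" by (simp only: mult_minus_left)
        hence *: "norm (if even (n - i) then 4 * (a + b) - 2 * c else - 2 * (c - 1)) \<le> M"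
          using M(1) by (cases "even (n - i)") (simp_all only: if_True if_False)
        have "0 \<le> real i * norm (G $ i)" by simp
        from mult_left_mono[OF * this] show ?thesis
          by (simp only: norm_mult norm_of_nat)
      qed
      also have "norm (G $ i * (4 * a * b * (-1) ^ (n - i) * (of_nat (n - i) + 1))) \<le> norm (G $ i) * (M * (real (n - i) + 1))"
      proof -
        have "norm (of_nat (n - i) + 1 :: complex) = real (n - i) + 1"
          by (metis of_nat_Suc add.commute norm_of_nat)
        hence "norm (4 * a * b * (-1) ^ (n - i) * (of_nat (n - i) + 1)) = norm (4 * a * b) * (real (n - i) + 1)"
          by (simp add: norm_mult norm_power)
        also have "\<dots> \<le> M * (real (n - i) + 1)"
          using M(3) by (intro mult_right_mono) auto
        finally show ?thesis
          unfolding norm_mult[of "G $ i"] by (intro mult_left_mono) auto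
      qed
      finally have "norm (T i) \<le> real i * norm (G $ i) * M + norm (G $ i) * (M * (real (n - i) + 1))" by simp
      also have "\<dots> = M * (real n + 1) * norm (G $ i)"
        using that by (simp add: of_nat_diff algebra_simps)
      finally show ?thesis .
    qed
    have "(of_nat n + 1) * (c + of_nat n) * G $ Suc n = (\<Sum>i\<le>n. T i)"
      unfolding T_def sum.distrib G_def by (rule pullback_recurrence)
    hence "norm (of_nat n + 1 :: complex) * norm (c + of_nat n) * norm (G $ Suc n) = norm (\<Sum>i\<le>n. T i)"
      by (metis norm_mult)
    also have "norm (of_nat n + 1 :: complex) = real n + 1"
      by (metis of_nat_Suc add.commute norm_of_nat)
    also have "norm (\<Sum>i\<le>n. T i) \<le> (\<Sum>i\<le>n. M * (real n + 1) * norm (G $ i))"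
      using T by (intro sum_norm_le) auto
    also have "\<dots> = M * (real n + 1) * (\<Sum>i\<le>n. norm (G $ i))"
      by (simp add: sum_distrib_left)
    finally have "(real n + 1) * (norm (c + of_nat n) * norm (G $ Suc n)) \<le> (real n + 1) * (M * (\<Sum>i\<le>n. norm (G $ i)))"
      by (simp add: mult_ac)
    hence "norm (c + of_nat n) * norm (G $ Suc n) \<le> M * (\<Sum>i\<le>n. norm (G $ i))"
      by (rule mult_left_le_imp_le) simp
    moreover have "\<delta> * (real n + 1) * norm (G $ Suc n) \<le> norm (c + of_nat n) * norm (G $ Suc n)"
      using \<delta>(2)[of n] by (intro mult_right_mono) auto
    ultimately have "\<delta> * (real n + 1) * norm (G $ Suc n) \<le> M * (\<Sum>i\<le>n. norm (G $ i))" by linarith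
    hence *: "norm (G $ Suc n) * (\<delta> * (real n + 1)) \<le> M * (\<Sum>i\<le>n. norm (G $ i))"
      by (simp only: mult.commute)
    have "0 < \<delta> * (real n + 1)" using \<delta>(1) by simp
    from pos_le_divide_eq[OF this, THEN iffD2, OF *] show ?thesis
      by (simp add: K_def)
  qed
  have sum_le: "(\<Sum>i\<le>n. norm (G $ i)) \<le> norm (rGamma c) * (pochhammer (1 + K) n / fact n)" for n
  proof (induction n)
    case 0
    have "G $ 0 = rGamma c"
      by (simp add: G_def pullback_fps_def reg2F1_coeff_def)
    thus ?case by simp
  next
    case (Suc n)
    have "(\<Sum>i\<le>Suc n. norm (G $ i)) \<le> (1 + K / (real n + 1)) * (\<Sum>i\<le>n. norm (G $ i))"
      using step[of n] by (simp add: algebra_simps)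
    also have "\<dots> \<le> (1 + K / (real n + 1)) * (norm (rGamma c) * (pochhammer (1 + K) n / fact n))"
      using Suc K0 by (intro mult_left_mono) auto
    also have "\<dots> = norm (rGamma c) * ((1 + K / (real n + 1)) * (pochhammer (1 + K) n / fact n))"
      by (simp only: mult_ac)
    also have "(1 + K / (real n + 1)) * (pochhammer (1 + K) n / fact n) = pochhammer (1 + K) (Suc n) / fact (Suc n)"
    proof -
      have "1 + K / (real n + 1) = (1 + K + real n) / real (Suc n)"
        by (simp add: field_simps)
      thus ?thesis by (simp only: pochhammer_Suc fact_Suc times_divide_times_eq mult.commute)
    qed
    finally show ?case .
  qed
  have "norm (G $ n) \<le> (\<Sum>i\<le>n. norm (G $ i))"
    by (rule member_le_sum) auto
  also note sum_le[of n]
  finally show ?thesis by (simp add: K_def)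
qed

text \<open>
  The quotient \<open>|c + n| / (n + 1)\<close> is positive for every \<open>n\<close> and tends to \<open>1\<close>.
\<close>
lemma norm_plus_nat_lower_bound:
  fixes c :: complex
  assumes "c \<notin> \<int>\<^sub>\<le>\<^sub>0"
  obtains \<delta> where "\<delta> > 0" "\<And>n. norm (c + of_nat n) \<ge> \<delta> * (real n + 1)"
proof -
  define f where "f n = norm (c + of_nat n) / (real n + 1)" for n
  have pos: "f n > 0" for n
  proof -
    have "c \<noteq> - of_nat n" using assms by auto
    hence "c + of_nat n \<noteq> 0" by (metis add_eq_0_iff minus_minus)
    thus ?thesis by (simp add: f_def)
  qed
  obtain N :: nat where N: "real N > 2 * norm c + 1" using reals_Archimedean2 by blast
  have tail: "f n \<ge> 1 / 2" if "n \<ge> N" for n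
  proof -
    have "norm (c + of_nat n) \<ge> real n - norm c"
      using norm_triangle_ineq4[of "c + of_nat n" c] by simp
    moreover have "real n \<ge> 2 * norm c + 1" using N that by linarith
    ultimately have "norm (c + of_nat n) \<ge> (real n + 1) / 2" by argo
    thus ?thesis by (simp add: f_def field_simps)
  qed
  define \<delta> where "\<delta> = Min (insert (1/2) (f ` {..<N}))"
  have "\<delta> > 0" using pos by (auto simp: \<delta>_def)
  moreover have "norm (c + of_nat n) \<ge> \<delta> * (real n + 1)" for n
  proof -
    have "\<delta> \<le> f n"
    proof (cases "n < N")
      case True
      thus ?thesis by (auto simp: \<delta>_def intro!: Min_le)
    next
      case False
      have "\<delta> \<le> 1 / 2" unfolding \<delta>_def by (rule Min_le) auto
      thus ?thesis using tail[of n] False by linarith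
    qed
    thus ?thesis by (simp add: f_def pos_le_divide_eq)
  qed
  ultimately show ?thesis by (rule that)
qed

definition cont2F1 :: "complex \<Rightarrow> complex \<Rightarrow> complex \<Rightarrow> complex \<Rightarrow> complex" where
  "cont2F1 a b c z = (\<Sum>n. pullback_fps a b c $ n * disc_coord z ^ n)"

lemma summable_pullback:
  assumes "c \<notin> \<int>\<^sub>\<le>\<^sub>0" "norm w < 1"
  shows "summable (\<lambda>n. pullback_fps a b c $ n * w ^ n)"
proof -
  obtain \<delta> where \<delta>: "\<delta> > 0" "\<And>n. norm (c + of_nat n) \<ge> \<delta> * (real n + 1)"
    using norm_plus_nat_lower_bound[OF assms(1)] by blast
  define M where "M = norm (4 * (a + b) - 2 * c) + norm (2 * (c - 1)) + norm (4 * a * b)"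
  have bound: "norm (pullback_fps a b c $ n) \<le> norm (rGamma c) * (pochhammer (1 + M / \<delta>) n / fact n)" for n
    by (rule pullback_coeff_bound[OF \<delta>]) (auto simp: M_def)
  have "summable (\<lambda>n. norm (rGamma c) * (pochhammer (1 + M / \<delta>) n / fact n * norm w ^ n))"
    using sums_pochhammer_power_real[of "norm w" "1 + M / \<delta>"] assms(2)
    by (intro summable_mult) (auto simp: sums_iff)
  thus ?thesis
    by (rule summable_comparison_test')
       (use mult_right_mono[OF bound] in \<open>auto simp: norm_mult norm_power mult.assoc\<close>)
qed

lemma holomorphic_cont2F1:
  assumes "c \<notin> \<int>\<^sub>\<le>\<^sub>0"
  shows "cont2F1 a b c holomorphic_on cut_plane"
proof -
  define S where "S = (\<lambda>w. \<Sum>n. pullback_fps a b c $ n * w ^ n)"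
  have "S holomorphic_on ball 0 1"
  proof (subst holomorphic_on_open[OF open_ball], safe)
    fix w :: complex assume "w \<in> ball 0 1"
    thus "\<exists>f'. (S has_field_derivative f') (at w)"
      unfolding S_def using termdiffs_strong'[OF summable_pullback[OF assms], of 1 w a b] by auto
  qed
  hence "(S \<circ> disc_coord) holomorphic_on cut_plane"
    using holomorphic_disc_coord disc_coord(1) by (intro holomorphic_on_compose_gen) auto
  thus ?thesis by (simp add: o_def S_def cont2F1_def [abs_def])
qed

text \<open>
  Near the origin this holds by the construction of the coefficients, and in the unit disc by the
  identity theorem.
\<close>
lemma cont2F1_eq_reg2F1:
  assumes c: "c \<notin> \<int>\<^sub>\<le>\<^sub>0" and z: "norm z < 1"
  shows "cont2F1 a b c z = reg2F1 a b c z"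
proof -
  define U where "U = cut_plane \<inter> disc_coord -` ball 0 (1/6) \<inter> ball 0 1"
  have "open (cut_plane \<inter> disc_coord -` ball 0 (1/6))"
    by (rule continuous_open_preimage)
       (auto intro!: holomorphic_on_imp_continuous_on holomorphic_disc_coord open_cut_plane)
  hence U: "open U" by (auto simp: U_def)
  have "0 \<in> U" using ball_subset_cut_plane by (auto simp: U_def disc_coord_def)
  have eq: "cont2F1 a b c y = reg2F1 a b c y" if "y \<in> U" for y
  proof -
    let ?w = "disc_coord y"
    have y: "y \<in> cut_plane" "norm ?w < 1 / 6" using that by (auto simp: U_def)
    have "koebe holomorphic_on ball 0 (1/6)"
      unfolding koebe_def [abs_def] by (intro holomorphic_intros) (auto simp: add_eq_0_iff)
    hence "(\<lambda>w. reg2F1 a b c (koebe w)) holomorphic_on eball 0 (ereal (1/6))"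
      using norm_koebe_less_1 by (auto intro!: holomorphic_on_reg2F1')
    from has_fps_expansion_imp_sums_complex[OF has_fps_expansion_pullback this, of ?w] y
    have "(\<lambda>n. pullback_fps a b c $ n * ?w ^ n) sums reg2F1 a b c (koebe ?w)" by simp
    moreover have "koebe ?w = y" using disc_coord(2)[OF y(1)] by (simp add: koebe_def)
    ultimately show ?thesis by (simp add: cont2F1_def sums_iff)
  qed
  show ?thesis
  proof (rule analytic_continuation_open[of U "ball 0 1" "cont2F1 a b c" "reg2F1 a b c"])
    show "cont2F1 a b c holomorphic_on ball 0 1"
      using holomorphic_cont2F1[OF c] ball_subset_cut_plane by (rule holomorphic_on_subset)
  qed (use U \<open>0 \<in> U\<close> eq z in \<open>auto simp: U_def intro: holomorphic_on_reg2F1\<close>)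
qed

lemma gauss_coeff_eq:
  assumes "c \<notin> \<int>\<^sub>\<le>\<^sub>0"
  shows "pochhammer a k * pochhammer b k / (pochhammer c k * fact k) = Gamma c * reg2F1_coeff a b c k"
proof -
  have "rGamma c = pochhammer c k * rGamma (c + of_nat k)" by (rule pochhammer_rGamma)
  moreover have "Gamma c * rGamma c = 1"
    using assms by (simp add: rGamma_inverse_Gamma Gamma_eq_zero_iff)
  moreover have "pochhammer c k \<noteq> 0" using assms by (auto simp: pochhammer_eq_0_iff)
  ultimately have "Gamma c * rGamma (c + of_nat k) = 1 / pochhammer c k"
    by (simp add: field_simps)
  have "Gamma c * reg2F1_coeff a b c k = pochhammer a k * pochhammer b k / fact k * (Gamma c * rGamma (c + of_nat k))"
    by (simp add: reg2F1_coeff_def)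
  also have "Gamma c * rGamma (c + of_nat k) = 1 / pochhammer c k" by fact
  finally show ?thesis by (simp add: mult.commute)
qed

lemma gauss_suminf_eq:
  assumes "c \<notin> \<int>\<^sub>\<le>\<^sub>0" "norm z < 1"
  shows "(\<Sum>k. pochhammer a k * pochhammer b k / (pochhammer c k * fact k) * z ^ k) = Gamma c * reg2F1 a b c z"
  using sums_mult[OF reg2F1_sums[OF assms(2), of a b c], of "Gamma c"]
  by (simp add: gauss_coeff_eq[OF assms(1)] sums_iff mult.assoc)

text \<open>
  The construction shows that a function with the defining property of \<open>hyp2F1\<close> exists, so the
  choice in the definition is not vacuous. By the identity theorem it is unique on the cut plane.
\<close>
theorem hyp2F1_eq_cont2F1:
  assumes c: "c \<notin> \<int>\<^sub>\<le>\<^sub>0" and z: "z \<in> cut_plane"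
  shows "hyp2F1 a b c z = Gamma c * cont2F1 a b c z"
proof -
  let ?P = "\<lambda>f. f holomorphic_on - (complex_of_real ` {1..}) \<and>
     (\<forall>z. norm z < 1 \<longrightarrow> f z = (\<Sum>k. pochhammer a k * pochhammer b k / (pochhammer c k * fact k) * z ^ k))"
  have "?P (\<lambda>z. Gamma c * cont2F1 a b c z)"
    using holomorphic_cont2F1[OF c, of a b]
    by (auto intro!: holomorphic_intros simp: cut_plane_def gauss_suminf_eq[OF c] cont2F1_eq_reg2F1[OF c]
        simp del: times_divide_eq_left times_divide_eq_right)
  hence P: "?P (hyp2F1 a b c)"
    unfolding hyp2F1_def by (rule someI[of ?P])
  show ?thesis
  proof (rule analytic_continuation_open[of "ball 0 1" cut_plane "hyp2F1 a b c" "\<lambda>z. Gamma c * cont2F1 a b c z"])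
    show "hyp2F1 a b c holomorphic_on cut_plane" using P by (simp add: cut_plane_def)
    show "(\<lambda>z. Gamma c * cont2F1 a b c z) holomorphic_on cut_plane"
      by (intro holomorphic_intros holomorphic_cont2F1 c)
    fix y :: complex assume "y \<in> ball 0 1"
    hence y: "norm y < 1" by simp
    show "hyp2F1 a b c y = Gamma c * cont2F1 a b c y"
      using P y by (simp only: gauss_suminf_eq[OF c y] cont2F1_eq_reg2F1[OF c y]) 
  qed (use z ball_subset_cut_plane in \<open>auto simp: open_cut_plane connected_cut_plane\<close>)
qed

corollary hyp2F1_eq_reg2F1:
  "c \<notin> \<int>\<^sub>\<le>\<^sub>0 \<Longrightarrow> norm z < 1 \<Longrightarrow> hyp2F1 a b c z = Gamma c * reg2F1 a b c z"
  using hyp2F1_eq_cont2F1[of c z a b] cont2F1_eq_reg2F1[of c z a b] ball_subset_cut_plane by auto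

corollary holomorphic_hyp2F1:
  assumes "c \<notin> \<int>\<^sub>\<le>\<^sub>0"
  shows "hyp2F1 a b c holomorphic_on cut_plane"
proof -
  have "(\<lambda>z. Gamma c * cont2F1 a b c z) holomorphic_on cut_plane"
    by (intro holomorphic_intros holomorphic_cont2F1 assms)
  thus ?thesis
    by (rule holomorphic_transform) (simp add: hyp2F1_eq_cont2F1 assms)
qed

text \<open>
  Tannery's theorem for the series in the disc coordinate. Continuity is needed at every point of
  the cut plane, since the limit that defines \<open>U2\<close> is taken at each point of the half-plane
  separately.
\<close>
theorem tendsto_hyp2F1:
  assumes lim: "(f \<longlongrightarrow> a) F" "(g \<longlongrightarrow> b) F" "(h \<longlongrightarrow> c) F"
    and c: "c \<notin> \<int>\<^sub>\<le>\<^sub>0" and z: "z \<in> cut_plane" and F: "F \<noteq> bot"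
  shows "((\<lambda>t. hyp2F1 (f t) (g t) (h t) z) \<longlongrightarrow> hyp2F1 a b c z) F"
proof -
  let ?w = "disc_coord z"
  have w: "norm ?w < 1" using disc_coord(1)[OF z] .
  obtain \<delta> where \<delta>: "\<delta> > 0" "\<And>n. norm (c + of_nat n) \<ge> \<delta> * (real n + 1)"
    using norm_plus_nat_lower_bound[OF c] by blast
  define M where "M = norm (4 * (a + b) - 2 * c) + norm (2 * (c - 1)) + norm (4 * a * b) + 1"
  have ev_c: "eventually (\<lambda>t. \<forall>n. norm (h t + of_nat n) \<ge> \<delta> / 2 * (real n + 1)) F"
  proof -
    have "eventually (\<lambda>t. dist (h t) c < \<delta> / 2) F"
      using lim(3) \<delta>(1) by (intro tendstoD) auto
    thus ?thesis
    proof eventually_elim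
      case (elim t)
      show ?case
      proof
        fix n
        have "norm (c + of_nat n) \<le> norm (h t + of_nat n) + norm (c - h t)"
          using norm_triangle_ineq[of "h t + of_nat n" "c - h t"] by (simp add: add.commute)
        hence "norm (h t + of_nat n) \<ge> \<delta> * (real n + 1) - \<delta> / 2"
          using elim \<delta>(2)[of n] by (simp add: dist_norm norm_minus_commute)
        moreover have "\<delta> / 2 * (real n + 1) \<ge> \<delta> / 2" using \<delta>(1) by simp
        ultimately show "norm (h t + of_nat n) \<ge> \<delta> / 2 * (real n + 1)" by argo
      qed
    qed
  qed
  have ev_M: "eventually (\<lambda>t. norm (4 * (f t + g t) - 2 * h t) < M) F" "eventually (\<lambda>t. norm (2 * (h t - 1)) < M) F"
    "eventually (\<lambda>t. norm (4 * f t * g t) < M) F"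
  proof -
    have M: "norm (4 * (a + b) - 2 * c) < M" "norm (2 * (c - 1)) < M" "norm (4 * a * b) < M"
      unfolding M_def using norm_ge_zero[of "4 * (a + b) - 2 * c"] norm_ge_zero[of "2 * (c - 1)"] norm_ge_zero[of "4 * a * b"]
      by linarith+
    have "((\<lambda>t. norm (4 * (f t + g t) - 2 * h t)) \<longlongrightarrow> norm (4 * (a + b) - 2 * c)) F"
      "((\<lambda>t. norm (2 * (h t - 1))) \<longlongrightarrow> norm (2 * (c - 1))) F"
      "((\<lambda>t. norm (4 * f t * g t)) \<longlongrightarrow> norm (4 * a * b)) F"
      by (intro tendsto_intros lim)+
    from this[THEN order_tendstoD(2)] M
    show "eventually (\<lambda>t. norm (4 * (f t + g t) - 2 * h t) < M) F" "eventually (\<lambda>t. norm (2 * (h t - 1)) < M) F"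
      "eventually (\<lambda>t. norm (4 * f t * g t) < M) F" by blast+
  qed
  have lim_rG: "((\<lambda>t. rGamma (h t)) \<longlongrightarrow> rGamma c) F"
    by (intro isCont_tendsto_compose[OF isCont_rGamma] lim) simp
  have ev_rG: "eventually (\<lambda>t. norm (rGamma (h t)) < norm (rGamma c) + 1) F"
    by (rule order_tendstoD(2)[OF tendsto_norm[OF lim_rG]]) simp
  define m where "m n = (norm (rGamma c) + 1) * (pochhammer (1 + M / (\<delta> / 2)) n / fact n * norm ?w ^ n)" for n
  have "summable m"
    unfolding m_def using sums_pochhammer_power_real[of "norm ?w" "1 + M / (\<delta> / 2)"] w
    by (intro summable_mult) (auto simp: sums_iff)
  have bound: "eventually (\<lambda>t. \<forall>n. norm (pullback_fps (f t) (g t) (h t) $ n * ?w ^ n) \<le> m n) F"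
    using ev_c ev_M ev_rG
  proof eventually_elim
    case (elim t)
    show ?case
    proof
      fix n
      have M0: "M \<ge> 0" by (simp add: M_def)
      have "norm (pullback_fps (f t) (g t) (h t) $ n) \<le> norm (rGamma (h t)) * (pochhammer (1 + M / (\<delta> / 2)) n / fact n)"
        by (rule pullback_coeff_bound) (use elim \<delta> in auto)
      also have "\<dots> \<le> (norm (rGamma c) + 1) * (pochhammer (1 + M / (\<delta> / 2)) n / fact n)"
      proof (rule mult_right_mono)
        have "1 + M / (\<delta> / 2) > 0" using M0 \<delta>(1) by (intro add_pos_nonneg) auto
        thus "0 \<le> pochhammer (1 + M / (\<delta> / 2)) n / fact n"
          by (intro divide_nonneg_nonneg less_imp_le[OF pochhammer_pos]) auto
      qed (use elim in auto)
      finally have *: "norm (pullback_fps (f t) (g t) (h t) $ n) \<le>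
          (norm (rGamma c) + 1) * (pochhammer (1 + M / (\<delta> / 2)) n / fact n)" .
      have "0 \<le> norm ?w ^ n" by simp
      from mult_right_mono[OF * this] show "norm (pullback_fps (f t) (g t) (h t) $ n * ?w ^ n) \<le> m n"
        by (simp only: m_def norm_mult norm_power mult.assoc)
    qed
  qed
  have coeff: "((\<lambda>t. pullback_fps (f t) (g t) (h t) $ n * ?w ^ n) \<longlongrightarrow> pullback_fps a b c $ n * ?w ^ n) F" for n
  proof -
    have rG: "((\<lambda>t. rGamma (h t + of_nat i)) \<longlongrightarrow> rGamma (c + of_nat i)) F" for i
      by (intro isCont_tendsto_compose[OF isCont_rGamma] tendsto_intros lim) simp
    show ?thesis
      unfolding pullback_fps_def fps_compose_nth fps_nth_Abs_fps reg2F1_coeff_def pochhammer_prod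
      by (intro tendsto_intros lim rG) auto
  qed
  have "((\<lambda>t. cont2F1 (f t) (g t) (h t) z) \<longlongrightarrow> cont2F1 a b c z) F"
    unfolding cont2F1_def
  proof (rule tannerys_theorem[of _ _ F m, THEN conjunct2, THEN conjunct2])
    show "eventually (\<lambda>(n, t). norm (pullback_fps (f t) (g t) (h t) $ n * ?w ^ n) \<le> m n) (sequentially \<times>\<^sub>F F)"
      unfolding eventually_prod_filter
      by (intro exI[of _ "\<lambda>_. True"] exI[of _ "\<lambda>t. \<forall>n. norm (pullback_fps (f t) (g t) (h t) $ n * ?w ^ n) \<le> m n"] conjI bound) auto
  qed (use coeff \<open>summable m\<close> F in auto)
  hence "((\<lambda>t. Gamma (h t) * cont2F1 (f t) (g t) (h t) z) \<longlongrightarrow> Gamma c * cont2F1 a b c z) F"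
    using c by (intro tendsto_mult tendsto_Gamma lim) auto
  moreover have "eventually (\<lambda>t. hyp2F1 (f t) (g t) (h t) z = Gamma (h t) * cont2F1 (f t) (g t) (h t) z) F"
    using ev_c
  proof eventually_elim
    case (elim t)
    have "h t \<notin> \<int>\<^sub>\<le>\<^sub>0"
    proof
      assume "h t \<in> \<int>\<^sub>\<le>\<^sub>0"
      then obtain n where "h t = - of_nat n" by (auto elim!: nonpos_Ints_cases')
      hence "h t + of_nat n = 0" by simp
      thus False using elim \<delta>(1) by (metis norm_zero not_less mult_pos_pos half_gt_zero of_nat_0_le_iff add_nonneg_pos zero_less_one)
    qed
    thus ?case using z by (rule hyp2F1_eq_cont2F1)
  qed
  ultimately show ?thesis
    unfolding hyp2F1_eq_cont2F1[OF c z] by (subst tendsto_cong)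
qed

section \<open>The limit at a nonpositive integer\<close>

lemma upper_half_plane_iff: "z \<in> upper_half_plane \<longleftrightarrow> Im z > 0"
  by (simp add: upper_half_plane_def)

lemma open_upper_half_plane: "open upper_half_plane"
  unfolding upper_half_plane_def by (rule open_halfspace_Im_gt)

lemma connected_upper_half_plane: "connected upper_half_plane"
  unfolding upper_half_plane_def by (intro convex_connected convex_halfspace_Im_gt)

lemma upper_half_planeD:
  assumes "z \<in> upper_half_plane"
  shows "z \<in> cut_plane" "1 - z \<in> cut_plane" "1 / z \<in> cut_plane"
    "1 - z \<notin> \<real>\<^sub>\<le>\<^sub>0" "- z \<notin> \<real>\<^sub>\<le>\<^sub>0" "z \<notin> \<real>\<^sub>\<le>\<^sub>0" "z \<noteq> 0" "1 - z \<noteq> 0" "z \<noteq> 1"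
proof -
  have im: "Im z > 0" using assms by (simp add: upper_half_plane_iff)
  show *: "z \<noteq> 0" using im by auto
  show "z \<in> cut_plane" "1 - z \<in> cut_plane" "1 - z \<notin> \<real>\<^sub>\<le>\<^sub>0" "- z \<notin> \<real>\<^sub>\<le>\<^sub>0" "z \<notin> \<real>\<^sub>\<le>\<^sub>0" "1 - z \<noteq> 0" "z \<noteq> 1"
    using im by (auto simp: in_cut_plane_iff complex_nonpos_Reals_iff)
  have "(Re z)\<^sup>2 + (Im z)\<^sup>2 > 0" using im by (simp add: add_nonneg_pos)
  hence "Im (1 / z) < 0" using im by (simp add: Im_divide)
  thus "1 / z \<in> cut_plane"
    by (auto simp: in_cut_plane_iff complex_nonpos_Reals_iff)
qed

lemma not_Ints_imp_not_nonpos_Ints: "z \<notin> \<int> \<Longrightarrow> z \<notin> \<int>\<^sub>\<le>\<^sub>0"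
  using nonpos_Ints_Int by auto

lemma not_nonpos_Ints_shift:
  fixes s :: complex
  assumes "s \<notin> \<int>"
  shows "of_nat k - s \<notin> \<int>\<^sub>\<le>\<^sub>0" "s - of_nat k \<notin> \<int>\<^sub>\<le>\<^sub>0" "s + of_nat k \<notin> \<int>\<^sub>\<le>\<^sub>0" "1 - s \<notin> \<int>\<^sub>\<le>\<^sub>0"
  using of_int_not_Ints_shift(1-3)[OF assms, of "int k"] of_int_not_Ints_shift(3)[OF assms, of 1]
  by (auto intro!: not_Ints_imp_not_nonpos_Ints)

lemma sin_pi_eq_0_iff: "sin (of_real pi * z) = 0 \<longleftrightarrow> (z :: complex) \<in> \<int>"
proof -
  have "rGamma z * rGamma (1 - z) = 0 \<longleftrightarrow> z \<in> \<int>"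
    unfolding mult_eq_0_iff rGamma_eq_zero_iff
  proof
    assume "z \<in> \<int>\<^sub>\<le>\<^sub>0 \<or> 1 - z \<in> \<int>\<^sub>\<le>\<^sub>0"
    thus "z \<in> \<int>" using nonpos_Ints_Int Ints_diff[OF Ints_1, of "1 - z"] by auto
  next
    assume "z \<in> \<int>"
    then obtain k where k: "z = of_int k" by (auto elim: Ints_cases)
    show "z \<in> \<int>\<^sub>\<le>\<^sub>0 \<or> 1 - z \<in> \<int>\<^sub>\<le>\<^sub>0"
    proof (cases "k \<le> 0")
      case False
      hence "1 - z = of_int (1 - k)" "1 - k \<le> 0" by (simp_all add: k)
      thus ?thesis by (metis nonpos_Ints_of_int)
    qed (simp add: k nonpos_Ints_of_int)
  qed
  thus ?thesis unfolding rGamma_reflection_complex by simp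
qed

lemma sin_pi_diff_nat: "sin (of_real pi * (z - of_nat m)) = (-1) ^ m * sin (of_real pi * (z :: complex))"
proof (induction m)
  case (Suc m)
  have "sin (of_real pi * (z - of_nat (Suc m))) = sin (of_real pi * (z - of_nat m) - of_real pi)"
    by (simp add: algebra_simps)
  also have "\<dots> = - sin (of_real pi * (z - of_nat m))" by (simp add: sin_diff)
  finally show ?case by (simp add: Suc.IH)
qed simp

lemma rGamma_shifted_reflection:
  "rGamma (of_nat m + 1 - z) * rGamma (z - of_nat m) = (-1) ^ m * sin (of_real pi * (z::complex)) / of_real pi"
proof -
  have "1 - (z - of_nat m) = of_nat m + 1 - z" by simp
  thus ?thesis
    using rGamma_reflection_complex[of "z - of_nat m"] by (simp only: sin_pi_diff_nat mult.commute)
qed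

text \<open>
  The step that removes the pole. In the connection formula for \<open>F(a, b; m + 1; z)\<close> the
  coefficient of \<open>F(a, b; a + b - m; 1 - z)\<close> is, by the reflection formula, the negative of that in
  \<open>U1\<close>. What remains contains \<open>b\<close> only through \<open>\<Gamma>(1 - b)\<close>, a power and regularised series.
\<close>
lemma U2_generic_near_1:
  assumes a: "a \<notin> \<int>" and b: "b \<notin> \<int>" and ab: "a + b \<notin> \<int>" and z: "norm z < 1" "norm (1 - z) < 1"
  shows "U2_generic m a b z = (-1) ^ (m + 1) * fact m * Gamma (1 - a) * Gamma (1 - b) *
     ((1 - z) powr (of_nat m + 1 - a - b) * reg2F1 (of_nat m + 1 - a) (of_nat m + 1 - b) (of_nat m + 2 - a - b) (1 - z))"
proof -
  define s where "s = of_nat m + 1 - a - b"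
  have s: "s \<notin> \<int>"
    using of_int_not_Ints_shift(3)[OF ab, of "int m + 1"] by (simp add: s_def algebra_simps)
  have abm: "a + b - of_nat m \<notin> \<int>\<^sub>\<le>\<^sub>0"
    using not_nonpos_Ints_shift(2)[OF ab, of m] .
  have m1: "of_nat m + 1 \<notin> (\<int>\<^sub>\<le>\<^sub>0 :: complex set)"
    by (rule Re_pos_notin_nonpos_Ints) simp
  define X Y Z where "X = reg2F1 a b (of_nat m + 1) z" and "Y = reg2F1 a b (a + b - of_nat m) (1 - z)"
    and "Z = (1 - z) powr s * reg2F1 (of_nat m + 1 - a) (of_nat m + 1 - b) (of_nat m + 2 - a - b) (1 - z)"
  define sa sb where "sa = sin (of_real pi * a)" and "sb = sin (of_real pi * b)"
  have sab: "sa \<noteq> 0" "sb \<noteq> 0" using a b by (simp_all add: sa_def sb_def sin_pi_eq_0_iff)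
  define e where "e = ((-1) ^ m :: complex)"
  have ee: "e * e = 1" by (simp add: e_def power_mult_distrib[symmetric])
  have conn: "sin (of_real pi * s) / of_real pi * X = rGamma (of_nat m + 1 - b) * rGamma (of_nat m + 1 - a) * Y - rGamma a * rGamma b * Z"
  proof -
    have p: "a + b + s = of_nat m + 1" "1 - s = a + b - of_nat m" "a + s = of_nat m + 1 - b"
      "b + s = of_nat m + 1 - a" "1 + s = of_nat m + 2 - a - b" "1 - (1 - z) = z"
      by (simp_all add: s_def)
    show ?thesis
      using reg2F1_connection[OF s, of a b "1 - z", unfolded p, OF m1 z(2,1)]
      by (simp only: X_def Y_def Z_def reg2F1_commute[of "of_nat m + 1 - b"])
  qed
  have sins: "sin (of_real pi * s) = e * sin (of_real pi * (a + b))"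
  proof -
    have "sin (of_real pi * s) = - sin (of_real pi * ((a + b) - of_nat (Suc m)))"
      unfolding sin_minus[symmetric] by (simp add: s_def algebra_simps)
    thus ?thesis by (simp add: sin_pi_diff_nat e_def del: of_nat_Suc)
  qed
  have G: "rGamma (of_nat m + 1 - x) = Gamma (x - of_nat m) * e * sin (of_real pi * x) / of_real pi" if "x \<notin> \<int>" for x :: complex
  proof -
    have "rGamma (x - of_nat m) \<noteq> 0"
      using not_nonpos_Ints_shift(2)[OF that, of m] by (simp add: rGamma_eq_zero_iff)
    thus ?thesis using rGamma_shifted_reflection[of m x] by (simp add: Gamma_def e_def field_simps)
  qed
  have G1: "rGamma x = Gamma (1 - x) * sin (of_real pi * x) / of_real pi" if "x \<notin> \<int>" for x :: complex
  proof -
    have "rGamma (1 - x) \<noteq> 0"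
      using not_nonpos_Ints_shift(4)[OF that] by (simp add: rGamma_eq_zero_iff)
    thus ?thesis using rGamma_reflection_complex[of x] by (simp add: Gamma_def field_simps)
  qed
  have "U2_generic m a b z = - e * fact m * Gamma (a - of_nat m) * Gamma (b - of_nat m) * Y
     + of_real pi * sin (of_real pi * (a + b)) / (sa * sb) * (fact m * X)"
  proof -
    have "Gamma (a + b - of_nat m) \<noteq> 0" using abm by (simp add: Gamma_eq_zero_iff)
    moreover have "Gamma (of_nat m + 1) = (fact m :: complex)"
      using Gamma_fact[of m, where ?'a = complex] by (simp add: add.commute)
    ultimately show ?thesis
      unfolding U2_generic_def U1_def
      by (simp add: hyp2F1_eq_reg2F1[OF abm z(2)] hyp2F1_eq_reg2F1[OF m1 z(1)] X_def Y_def e_def sa_def sb_def)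
  qed
  also have "of_real pi * sin (of_real pi * (a + b)) / (sa * sb) * (fact m * X) =
     of_real pi ^ 2 / (sa * sb) * fact m * e * (sin (of_real pi * s) / of_real pi * X)"
    unfolding sins using ee by (simp add: power2_eq_square field_simps)
  also have "sin (of_real pi * s) / of_real pi * X = (Gamma (a - of_nat m) * Gamma (b - of_nat m) * Y
       - Gamma (1 - a) * Gamma (1 - b) * Z) * (sa * sb / of_real pi ^ 2)"
    unfolding conn G[OF a] G[OF b] G1[OF a] G1[OF b] sa_def[symmetric] sb_def[symmetric]
    using ee by (simp add: power2_eq_square field_simps)
  also have "of_real pi ^ 2 / (sa * sb) * fact m * e * ((Gamma (a - of_nat m) * Gamma (b - of_nat m) * Y
       - Gamma (1 - a) * Gamma (1 - b) * Z) * (sa * sb / of_real pi ^ 2)) = 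
       fact m * e * (Gamma (a - of_nat m) * Gamma (b - of_nat m) * Y - Gamma (1 - a) * Gamma (1 - b) * Z)"
    using sab by simp
  finally show ?thesis by (simp add: Z_def s_def e_def algebra_simps)
qed

lemma holomorphic_U2_generic:
  assumes ab: "a + b \<notin> \<int>"
  shows "U2_generic m a b holomorphic_on upper_half_plane"
proof -
  have abm: "a + b - of_nat m \<notin> \<int>\<^sub>\<le>\<^sub>0"
    using not_nonpos_Ints_shift(2)[OF ab, of m] .
  have m1: "of_nat m + 1 \<notin> (\<int>\<^sub>\<le>\<^sub>0 :: complex set)"
    by (rule Re_pos_notin_nonpos_Ints) simp
  have 1: "hyp2F1 a b (of_nat m + 1) holomorphic_on upper_half_plane"
    by (rule holomorphic_on_subset[OF holomorphic_hyp2F1[OF m1]]) (use upper_half_planeD in auto)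
  have "(hyp2F1 a b (a + b - of_nat m) \<circ> (\<lambda>z. 1 - z)) holomorphic_on upper_half_plane"
    by (rule holomorphic_on_compose_gen[OF _ holomorphic_hyp2F1[OF abm]])
       (use upper_half_planeD in \<open>auto intro!: holomorphic_intros\<close>)
  hence 2: "(\<lambda>z. hyp2F1 a b (a + b - of_nat m) (1 - z)) holomorphic_on upper_half_plane"
    by (simp add: o_def)
  show ?thesis
    unfolding U2_generic_def [abs_def] U1_def
    by (intro holomorphic_intros 1 2)
qed

lemma holomorphic_at_1:
  assumes c: "c \<notin> \<int>\<^sub>\<le>\<^sub>0"
  shows "(\<lambda>z. (1 - z) powr e * hyp2F1 a b c (1 - z)) holomorphic_on upper_half_plane"
proof -
  have "(hyp2F1 a b c \<circ> (\<lambda>z. 1 - z)) holomorphic_on upper_half_plane"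
    by (rule holomorphic_on_compose_gen[OF _ holomorphic_hyp2F1[OF c]])
       (use upper_half_planeD in \<open>auto intro!: holomorphic_intros\<close>)
  thus ?thesis
    by (intro holomorphic_intros) (use upper_half_planeD in \<open>auto simp: o_def\<close>)
qed

lemma identity_upper_half_plane:
  assumes "open G" "G \<noteq> {}" "G \<subseteq> upper_half_plane"
    and "f holomorphic_on upper_half_plane" "g holomorphic_on upper_half_plane"
    and "\<And>z. z \<in> G \<Longrightarrow> f z = g z" and "z \<in> upper_half_plane"
  shows "f z = g z"
  using analytic_continuation_open[of G upper_half_plane f g z] assms open_upper_half_plane connected_upper_half_plane
  by blast

lemma U2_generic_eq:
  assumes a: "a \<notin> \<int>" and b: "b \<notin> \<int>" and ab: "a + b \<notin> \<int>" and z: "z \<in> upper_half_plane"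
  shows "U2_generic m a b z = (-1) ^ (m + 1) * fact m * Gamma (1 - a) * Gamma (1 - b) * rGamma (of_nat m + 2 - a - b) *
     ((1 - z) powr (of_nat m + 1 - a - b) * hyp2F1 (of_nat m + 1 - a) (of_nat m + 1 - b) (of_nat m + 2 - a - b) (1 - z))"
    (is "_ = ?R z")
proof (rule identity_upper_half_plane[of "lens \<inter> upper_half_plane" "U2_generic m a b" ?R])
  have c: "of_nat m + 2 - a - b \<notin> \<int>\<^sub>\<le>\<^sub>0"
    using not_nonpos_Ints_shift(1)[OF ab, of "m + 2"] by (simp add: algebra_simps)
  show "open (lens \<inter> upper_half_plane)" using open_lens open_upper_half_plane by blast
  have "1 / 2 + \<i> / 2 \<in> lens \<inter> upper_half_plane"
    by (auto simp: upper_half_plane_iff dist_norm cmod_def power2_eq_square)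
  thus "lens \<inter> upper_half_plane \<noteq> {}" by blast
  show "U2_generic m a b holomorphic_on upper_half_plane" using ab by (rule holomorphic_U2_generic)
  show "?R holomorphic_on upper_half_plane"
    by (intro holomorphic_on_mult[OF holomorphic_on_const] holomorphic_at_1 c)
  fix y assume "y \<in> lens \<inter> upper_half_plane"
  hence y: "norm y < 1" "norm (1 - y) < 1" using lens_notin_nonpos_Reals by auto
  have "rGamma (of_nat m + 2 - a - b) \<noteq> 0" using c by (simp add: rGamma_eq_zero_iff)
  thus "U2_generic m a b y = ?R y"
    unfolding U2_generic_near_1[OF a b ab y] hyp2F1_eq_reg2F1[OF c y(2)] by (simp add: Gamma_def)
qed (use z in auto)

lemma pochhammer_eq_Gamma_rGamma:
  assumes "x \<notin> \<int>\<^sub>\<le>\<^sub>0"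
  shows "Gamma x * rGamma (x + of_nat k) = 1 / pochhammer x k"
proof -
  have "rGamma x \<noteq> 0" "pochhammer x k \<noteq> 0" using assms by (auto simp: rGamma_eq_zero_iff pochhammer_eq_0_iff)
  thus ?thesis using pochhammer_rGamma[of x k] by (simp add: Gamma_def field_simps)
qed

lemma tendsto_U2_generic:
  assumes a: "a \<notin> \<int>" and z: "z \<in> upper_half_plane"
  shows "((\<lambda>b. U2_generic m a b z) \<longlongrightarrow> (-1) ^ (m + 1) * fact m * fact n / pochhammer (1 - a) (m + n + 1)
         * (1 - z) powr (of_nat (m + n + 1) - a)
         * hyp2F1 (of_nat (m + 1) - a) (of_nat (m + n + 1)) (of_nat (m + n + 2) - a) (1 - z)) (at (- of_nat n))"
proof -
  let ?R = "\<lambda>b. (-1) ^ (m + 1) * fact m * Gamma (1 - a) * Gamma (1 - b) * rGamma (of_nat m + 2 - a - b) *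
     ((1 - z) powr (of_nat m + 1 - a - b) * hyp2F1 (of_nat m + 1 - a) (of_nat m + 1 - b) (of_nat m + 2 - a - b) (1 - z))"
  let ?b = "- of_nat n :: complex"
  note zD = upper_half_planeD[OF z]
  have 1: "1 - ?b \<notin> \<int>\<^sub>\<le>\<^sub>0" by (rule Re_pos_notin_nonpos_Ints) simp
  have c: "of_nat m + 2 - a - ?b \<notin> \<int>\<^sub>\<le>\<^sub>0"
    using not_nonpos_Ints_shift(1)[OF a, of "m + 2 + n"] by (simp add: algebra_simps)
  have powr: "(\<lambda>b. (1 - z) powr (of_nat m + 1 - a - b)) = (\<lambda>b. exp ((of_nat m + 1 - a - b) * ln (1 - z)))"
    using zD by (simp add: powr_def)
  have lim: "(?R \<longlongrightarrow> ?R ?b) (at ?b)"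
  proof (intro tendsto_mult tendsto_const)
    show "((\<lambda>b. Gamma (1 - b)) \<longlongrightarrow> Gamma (1 - ?b)) (at ?b)"
      by (intro tendsto_Gamma 1 tendsto_intros)
    show "((\<lambda>b. rGamma (of_nat m + 2 - a - b)) \<longlongrightarrow> rGamma (of_nat m + 2 - a - ?b)) (at ?b)"
      by (intro isCont_tendsto_compose[OF isCont_rGamma] tendsto_intros) simp
    show "((\<lambda>b. (1 - z) powr (of_nat m + 1 - a - b)) \<longlongrightarrow> (1 - z) powr (of_nat m + 1 - a - ?b)) (at ?b)"
      using zD(8) unfolding powr_def by (auto intro!: tendsto_eq_intros)
    show "((\<lambda>b. hyp2F1 (of_nat m + 1 - a) (of_nat m + 1 - b) (of_nat m + 2 - a - b) (1 - z)) \<longlongrightarrow>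
       hyp2F1 (of_nat m + 1 - a) (of_nat m + 1 - ?b) (of_nat m + 2 - a - ?b) (1 - z)) (at ?b)"
      by (rule tendsto_hyp2F1[OF _ _ _ c zD(2)]) (auto intro!: tendsto_eq_intros)
  qed
  have "eventually (\<lambda>b. b \<in> ball ?b 1 - {?b} - {b. a + b \<in> \<int>}) (at ?b)"
  proof -
    have "closed {b. a + b \<in> \<int>}"
    proof -
      have "closed ((\<lambda>b. a + b) -` \<int>)" by (intro closed_vimage closed_Ints continuous_intros)
      thus ?thesis by (simp add: vimage_def)
    qed
    moreover have "?b \<notin> {b. a + b \<in> \<int>}"
      using of_int_not_Ints_shift(2)[OF a, of "int n"] by simp
    ultimately have "eventually (\<lambda>b. b \<in> ball ?b 1 \<inter> (- {b. a + b \<in> \<int>})) (at ?b)"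
      by (intro eventually_at_in_open') auto
    moreover have "eventually (\<lambda>b. b \<noteq> ?b) (at ?b)" by (rule eventually_neq_at_within)
    ultimately show ?thesis by eventually_elim auto
  qed
  hence "eventually (\<lambda>b. U2_generic m a b z = ?R b) (at ?b)"
  proof eventually_elim
    case (elim b)
    have "b \<notin> \<int>"
    proof
      assume "b \<in> \<int>"
      then obtain k where k: "b = of_int k" by (auto elim: Ints_cases)
      hence "norm (of_int (k + int n) :: complex) < 1" using elim by (simp add: dist_norm norm_minus_commute)
      hence "\<bar>k + int n\<bar> < 1" by (simp only: norm_of_int flip: of_int_abs)
      hence "k = - int n" by simp
      thus False using elim k by simp
    qed
    thus ?case using elim by (intro U2_generic_eq[OF a _ _ z]) auto
  qed
  with lim have "((\<lambda>b. U2_generic m a b z) \<longlongrightarrow> ?R ?b) (at ?b)"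
    by (subst tendsto_cong)
  also have "?R ?b = (-1) ^ (m + 1) * fact m * fact n / pochhammer (1 - a) (m + n + 1)
         * (1 - z) powr (of_nat (m + n + 1) - a)
         * hyp2F1 (of_nat (m + 1) - a) (of_nat (m + n + 1)) (of_nat (m + n + 2) - a) (1 - z)"
  proof -
    have "1 - a \<notin> \<int>\<^sub>\<le>\<^sub>0" using not_nonpos_Ints_shift(4)[OF a] .
    from pochhammer_eq_Gamma_rGamma[OF this, of "m + n + 1"]
    have "Gamma (1 - a) * rGamma (of_nat m + 2 - a + of_nat n) = 1 / pochhammer (1 - a) (m + n + 1)"
      by (simp add: algebra_simps)
    moreover have "Gamma (1 + of_nat n) = (fact n :: complex)" by (rule Gamma_fact)
    moreover have "(-1) ^ (m + 1) * fact m * Gamma (1 - a) * fact n * rGamma (of_nat m + 2 - a + of_nat n) =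
       (-1) ^ (m + 1) * fact m * fact n * (Gamma (1 - a) * rGamma (of_nat m + 2 - a + of_nat n))"
      by (simp only: mult_ac)
    ultimately show ?thesis
      by (simp add: algebra_simps)
  qed
  finally show ?thesis .
qed

lemma U2_eq:
  assumes "a \<notin> \<int>" "z \<in> upper_half_plane"
  shows "U2 n m a z = (-1) ^ (m + 1) * fact m * fact n / pochhammer (1 - a) (m + n + 1)
         * (1 - z) powr (of_nat (m + n + 1) - a)
         * hyp2F1 (of_nat (m + 1) - a) (of_nat (m + n + 1)) (of_nat (m + n + 2) - a) (1 - z)"
  unfolding U2_def by (rule tendsto_Lim[OF _ tendsto_U2_generic[OF assms]]) simp

lemma holomorphic_U2:
  assumes a: "a \<notin> \<int>"
  shows "U2 n m a holomorphic_on upper_half_plane"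
proof -
  have c: "of_nat (m + n + 2) - a \<notin> \<int>\<^sub>\<le>\<^sub>0"
    using not_nonpos_Ints_shift(1)[OF a] .
  have "(\<lambda>z. (-1) ^ (m + 1) * fact m * fact n / pochhammer (1 - a) (m + n + 1)
         * ((1 - z) powr (of_nat (m + n + 1) - a)
         * hyp2F1 (of_nat (m + 1) - a) (of_nat (m + n + 1)) (of_nat (m + n + 2) - a) (1 - z))) holomorphic_on upper_half_plane"
    by (intro holomorphic_on_mult[OF holomorphic_on_const] holomorphic_at_1 c)
  thus ?thesis
    by (rule holomorphic_transform) (simp add: U2_eq[OF a] mult.assoc)
qed

lemma U2_eq_reg2F1:
  assumes a: "a \<notin> \<int>" and z: "z \<in> upper_half_plane" "norm (1 - z) < 1"
  shows "U2 n m a z = (-1) ^ (m + 1) * fact m * fact n * Gamma (1 - a) *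
     ((1 - z) powr (of_nat m + of_nat n + 1 - a) *
      reg2F1 (of_nat m + 1 - a) (of_nat m + of_nat n + 1) (of_nat m + of_nat n + 2 - a) (1 - z))"
proof -
  have c: "of_nat m + of_nat n + 2 - a \<notin> \<int>\<^sub>\<le>\<^sub>0"
    using not_nonpos_Ints_shift(1)[OF a, of "m + n + 2"] by (simp add: algebra_simps)
  have a1: "1 - a \<notin> \<int>\<^sub>\<le>\<^sub>0" using not_nonpos_Ints_shift(4)[OF a] .
  have cnz: "rGamma (of_nat m + of_nat n + 2 - a) \<noteq> 0" using c by (simp add: rGamma_eq_zero_iff)
  have "1 / pochhammer (1 - a) (m + n + 1) = Gamma (1 - a) * rGamma (of_nat m + of_nat n + 2 - a)"
    using pochhammer_eq_Gamma_rGamma[OF a1, of "m + n + 1"] by (simp add: algebra_simps)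
  hence p: "x / pochhammer (1 - a) (m + n + 1) = x * (Gamma (1 - a) * rGamma (of_nat m + of_nat n + 2 - a))" for x
    by (metis mult.right_neutral times_divide_eq_right)
  have "U2 n m a z = (-1) ^ (m + 1) * fact m * fact n / pochhammer (1 - a) (m + n + 1)
         * (1 - z) powr (of_nat m + of_nat n + 1 - a)
         * hyp2F1 (of_nat m + 1 - a) (of_nat m + of_nat n + 1) (of_nat m + of_nat n + 2 - a) (1 - z)"
    using U2_eq[OF a z(1), of n m] by (simp add: add_ac)
  also have "\<dots> = (-1) ^ (m + 1) * fact m * fact n * (Gamma (1 - a) * rGamma (of_nat m + of_nat n + 2 - a))
         * (1 - z) powr (of_nat m + of_nat n + 1 - a)
         * (Gamma (of_nat m + of_nat n + 2 - a) * reg2F1 (of_nat m + 1 - a) (of_nat m + of_nat n + 1) (of_nat m + of_nat n + 2 - a) (1 - z))"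
    unfolding p hyp2F1_eq_reg2F1[OF c z(2)] ..
  also have "\<dots> = (-1) ^ (m + 1) * fact m * fact n * Gamma (1 - a) *
     ((1 - z) powr (of_nat m + of_nat n + 1 - a) *
      reg2F1 (of_nat m + 1 - a) (of_nat m + of_nat n + 1) (of_nat m + of_nat n + 2 - a) (1 - z))
     * (rGamma (of_nat m + of_nat n + 2 - a) * Gamma (of_nat m + of_nat n + 2 - a))"
    by (simp only: mult_ac)
  also have "rGamma (of_nat m + of_nat n + 2 - a) * Gamma (of_nat m + of_nat n + 2 - a) = 1"
    using cnz by (simp add: Gamma_def)
  finally show ?thesis by simp
qed

section \<open>The expansion at infinity\<close>

lemma pochhammer_minus_of_nat:
  "k \<le> n \<Longrightarrow> pochhammer (- of_nat n :: complex) k = (-1) ^ k * fact n / fact (n - k)"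
proof (induction k)
  case (Suc k)
  have n: "n - k = Suc (n - Suc k)" using Suc.prems by simp
  have "pochhammer (- of_nat n :: complex) (Suc k) = (-1) ^ k * fact n / fact (n - k) * (- of_nat n + of_nat k)"
    using Suc by (simp add: pochhammer_Suc)
  also have "- of_nat n + of_nat k = - (of_nat (n - k) :: complex)"
    using Suc.prems by (simp add: of_nat_diff)
  also have "fact (n - k) = of_nat (n - k) * (fact (n - Suc k) :: complex)"
    unfolding n by simp
  also have "(-1) ^ k * fact n / (of_nat (n - k) * fact (n - Suc k)) * - of_nat (n - k) = (-1) ^ Suc k * fact n / (fact (n - Suc k) :: complex)"
    using Suc.prems by (simp add: n del: of_nat_Suc)
  finally show ?case .
qed simp

lemma pochhammer_minus_of_nat_eq_0:
  "k > n \<Longrightarrow> pochhammer (- of_nat n :: complex) k = 0"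
  by (simp add: pochhammer_of_nat_eq_0_iff)

lemma rGamma_minus_of_nat_shift:
  "rGamma (1 - a - of_nat j) = (-1) ^ j * pochhammer a j * rGamma (1 - a :: complex)"
  using pochhammer_rGamma[of "1 - a - of_nat j" j] pochhammer_minus'[of "- a" j] by (simp add: algebra_simps)

lemma rGamma_of_nat_Suc: "rGamma (of_nat k + 1 :: complex) = 1 / fact k"
proof -
  have "Gamma (1 + of_nat k) = (fact k :: complex)" by (rule Gamma_fact)
  thus ?thesis by (simp add: rGamma_inverse_Gamma add.commute divide_inverse)
qed

lemma reg2F1_terminating:
  "reg2F1 (- of_nat n) b c z = (\<Sum>k\<le>n. reg2F1_coeff (- of_nat n) b c k * z ^ k)"
  unfolding reg2F1_def
  by (rule suminf_finite) (auto simp: reg2F1_coeff_def pochhammer_minus_of_nat_eq_0)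

lemma holomorphic_reg2F1_terminating: "reg2F1 (- of_nat n) b c holomorphic_on A"
proof -
  have "(\<lambda>z. \<Sum>k\<le>n. reg2F1_coeff (- of_nat n) b c k * z ^ k) holomorphic_on A"
    by (intro holomorphic_intros)
  thus ?thesis by (rule holomorphic_transform) (simp add: reg2F1_terminating)
qed

lemma hyp2F1_terminating:
  assumes "z \<in> cut_plane"
  shows "hyp2F1 (- of_nat n) a (of_nat m + 1) z = fact m * reg2F1 (- of_nat n) a (of_nat m + 1) z"
proof (rule analytic_continuation_open[of "ball 0 1" cut_plane "hyp2F1 (- of_nat n) a (of_nat m + 1)"])
  have m1: "of_nat m + 1 \<notin> (\<int>\<^sub>\<le>\<^sub>0 :: complex set)"
    by (rule Re_pos_notin_nonpos_Ints) simp
  show "hyp2F1 (- of_nat n) a (of_nat m + 1) holomorphic_on cut_plane"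
    by (rule holomorphic_hyp2F1[OF m1])
  show "(\<lambda>z. fact m * reg2F1 (- of_nat n) a (of_nat m + 1) z) holomorphic_on cut_plane"
    by (intro holomorphic_intros holomorphic_reg2F1_terminating)
  fix y :: complex assume "y \<in> ball 0 1"
  hence y: "norm y < 1" by simp
  have "Gamma (of_nat m + 1) = (fact m :: complex)"
    using Gamma_fact[of m, where ?'a = complex] by (simp add: add.commute)
  thus "hyp2F1 (- of_nat n) a (of_nat m + 1) y = fact m * reg2F1 (- of_nat n) a (of_nat m + 1) y"
    by (simp add: hyp2F1_eq_reg2F1[OF m1 y])
qed (use assms ball_subset_cut_plane in \<open>auto simp: open_cut_plane connected_cut_plane\<close>)

text \<open>
  A polynomial of degree \<open>n\<close> read backwards: the term of index \<open>n - j\<close> on the left-hand side is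
  compared with the term of index \<open>j\<close> on the right-hand side.
\<close>
lemma reg2F1_terminating_reverse:
  assumes "z \<noteq> 0"
  shows "z ^ n * reg2F1 (- of_nat n) (- of_nat (n + m)) (1 - a - of_nat n) (1 / z) =
     fact (n + m) * rGamma (1 - a) * reg2F1 (- of_nat n) a (of_nat m + 1) z"
proof -
  have "z ^ n * reg2F1 (- of_nat n) (- of_nat (n + m)) (1 - a - of_nat n) (1 / z) =
    (\<Sum>k\<le>n. reg2F1_coeff (- of_nat n) (- of_nat (n + m)) (1 - a - of_nat n) k * z ^ (n - k))"
    unfolding reg2F1_terminating sum_distrib_left
    by (rule sum.cong) (use assms in \<open>auto simp: power_diff field_simps\<close>)
  also have "\<dots> = (\<Sum>j\<le>n. reg2F1_coeff (- of_nat n) (- of_nat (n + m)) (1 - a - of_nat n) (n - j) * z ^ j)"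
    by (rule sum.reindex_bij_witness[of _ "\<lambda>j. n - j" "\<lambda>j. n - j"]) auto
  also have "\<dots> = (\<Sum>j\<le>n. fact (n + m) * rGamma (1 - a) * (reg2F1_coeff (- of_nat n) a (of_nat m + 1) j * z ^ j))"
  proof (rule sum.cong)
    fix j assume "j \<in> {..n}"
    hence j: "j \<le> n" by simp
    have 1: "1 - a - of_nat n + of_nat (n - j) = 1 - a - of_nat j" using j by (simp add: of_nat_diff)
    have 2: "n + m - (n - j) = m + j" "n - (n - j) = j" using j by auto
    have 3: "of_nat m + 1 + of_nat j = (of_nat (m + j) + 1 :: complex)" by simp
    have 4: "((-1) ^ (n - j) * (-1) ^ (n - j) :: complex) = 1" by (simp add: power_mult_distrib[symmetric])
    have 5: "((-1) ^ j :: complex) * (-1) ^ j = 1" by (simp add: power_mult_distrib[symmetric])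
    have "reg2F1_coeff (- of_nat n) (- of_nat (n + m)) (1 - a - of_nat n) (n - j) =
      ((-1) ^ (n - j) * fact n / fact j) * ((-1) ^ (n - j) * fact (n + m) / fact (m + j)) * ((-1) ^ j * pochhammer a j * rGamma (1 - a)) / fact (n - j)"
      unfolding reg2F1_coeff_def 1 rGamma_minus_of_nat_shift
      using j by (subst (1 2) pochhammer_minus_of_nat) (auto simp: 2)
    also have "\<dots> = ((-1) ^ (n - j) * (-1) ^ (n - j)) * (fact (n + m) * rGamma (1 - a) * (((-1) ^ j * fact n / fact (n - j)) * pochhammer a j * (1 / fact (m + j)) / fact j))"
      by (simp add: field_simps)
    also have "\<dots> = fact (n + m) * rGamma (1 - a) * reg2F1_coeff (- of_nat n) a (of_nat m + 1) j"
      unfolding 4 reg2F1_coeff_def 3 rGamma_of_nat_Suc pochhammer_minus_of_nat[OF j] by simp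
    finally show "reg2F1_coeff (- of_nat n) (- of_nat (n + m)) (1 - a - of_nat n) (n - j) * z ^ j =
       fact (n + m) * rGamma (1 - a) * (reg2F1_coeff (- of_nat n) a (of_nat m + 1) j * z ^ j)"
      by (simp add: mult.assoc)
  qed simp
  also have "\<dots> = fact (n + m) * rGamma (1 - a) * reg2F1 (- of_nat n) a (of_nat m + 1) z"
    by (simp add: reg2F1_terminating sum_distrib_left)
  finally show ?thesis .
qed

text \<open>
  For \<open>z\<close> in the upper half-plane, \<open>1 - z\<close> and \<open>-z\<close> have arguments in \<open>(-\<pi>, 0)\<close>, so their
  difference stays inside the principal strip. For \<open>z / (1 - z)\<close> the difference of the arguments
  lies in \<open>(0, 2\<pi>)\<close>, and it is less than \<open>\<pi>\<close> because the quotient has positive imaginary part.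
\<close>
lemma Ln_branches_upper_half_plane:
  assumes z: "z \<in> upper_half_plane"
  shows "Ln (1 - 1 / z) = Ln (1 - z) - Ln (- z)" "Ln (- z) = Ln z - \<i> * of_real pi" "Ln (1 / z) = - Ln z"
    "Ln (z / (1 - z)) = Ln z - Ln (1 - z)"
proof -
  note zD = upper_half_planeD[OF z]
  have im: "Im z > 0" using z by (simp add: upper_half_plane_iff)
  have neg: "- pi < Im (Ln w) \<and> Im (Ln w) < 0" if "Im w < 0" for w
  proof -
    have "w \<noteq> 0" using that by auto
    thus ?thesis using that Im_Ln_pos_le[of w] mpi_less_Im_Ln[of w] Im_Ln_le_pi[of w] by auto
  qed
  have 1: "- pi < Im (Ln (1 - z)) \<and> Im (Ln (1 - z)) < 0" "- pi < Im (Ln (- z)) \<and> Im (Ln (- z)) < 0"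
    using im by (intro neg; simp)+
  have "exp (Ln (1 - z) - Ln (- z)) = 1 - 1 / z"
    using zD by (simp add: exp_diff field_simps)
  thus "Ln (1 - 1 / z) = Ln (1 - z) - Ln (- z)"
    using 1 by (intro Ln_unique) auto
  show 2: "Ln (- z) = Ln z - \<i> * of_real pi"
    using Ln_minus[OF zD(7)] im by simp
  show "Ln (1 / z) = - Ln z"
    using Ln_inverse[OF zD(6)] by (simp add: inverse_eq_divide)
  have "Im (z / (1 - z)) > 0"
  proof -
    have "norm (1 - z) > 0" using zD by simp
    thus ?thesis using im by (simp add: Im_complex_div_gt_0 algebra_simps)
  qed
  have pos: "0 < Im (Ln z) \<and> Im (Ln z) < pi" using Im_Ln_pos_lt[OF zD(7)] im by simp
  have "Ln (z / (1 - z)) = Ln z - Ln (1 - z)"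
  proof -
    define w where "w = Ln z - Ln (1 - z)"
    have exp_w: "exp w = z / (1 - z)"
      using zD by (simp add: w_def exp_diff)
    have "Im (Ln z - Ln (1 - z)) < pi"
    proof (rule ccontr)
      assume "\<not> ?thesis"
      hence "sin (Im w) \<le> 0" using pos 1 by (intro sin_le_zero) (auto simp: w_def)
      hence "Im (exp w) \<le> 0" by (simp add: Im_exp mult_nonneg_nonpos)
      thus False using \<open>Im (z / (1 - z)) > 0\<close> by (simp add: exp_w)
    qed
    moreover have "exp (Ln z - Ln (1 - z)) = z / (1 - z)"
      using exp_w by (simp add: w_def)
    ultimately show ?thesis using 1 pos by (intro Ln_unique) auto
  qed
  thus "Ln (z / (1 - z)) = Ln z - Ln (1 - z)" .
qed


lemma powr_of_nat': "z \<noteq> 0 \<Longrightarrow> z powr (of_nat k) = (z::complex) ^ k"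
  by (simp add: powr_nat)

text \<open>
  Let \<open>x = 1/z\<close>. Pfaff's transformation turns the argument \<open>1 - z\<close> into \<open>1 - x\<close>, the connection
  formula turns this into \<open>x\<close>, and Euler's transformation removes the powers of \<open>1 - x\<close>. One of the
  two resulting series terminates; reversed, it is the polynomial \<open>F(-n, a; m + 1; z)\<close>. The region
  is the one where all the series converge.
\<close>
lemma U2_at_infinity_near:
  assumes a: "a \<notin> \<int>" and z: "z \<in> upper_half_plane" "norm z > 1" "norm (1 - z) < 1"
  shows "U2 n m a z =
       (-1) ^ (m + 1) * fact m * fact n / pochhammer (a - of_nat m) (m + n + 1)
         * ((- z) powr (- a) * hyp2F1 a (a - of_nat m) (a + of_nat n + 1) (1 / z))
       + of_real pi * exp (\<i> * of_real pi * a) / sin (of_real pi * a) * (fact m * reg2F1 (- of_nat n) a (of_nat m + 1) z)"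
proof -
  note zD = upper_half_planeD[OF z(1)]
  define x where "x = 1 / z"
  define p where "p = m + n + 1"
  have x: "norm x < 1" "norm (1 - x) < 1"
  proof -
    show "norm x < 1" using z(2) zD(7) by (simp add: x_def norm_divide pos_divide_less_eq)
    have "1 - x = (1 - z) / (- z)" using zD by (simp add: x_def field_simps)
    hence "norm (1 - x) = norm (1 - z) / norm z" by (simp add: norm_divide)
    also have "\<dots> < 1"
      using z by (intro pos_divide_less_eq[THEN iffD2]) auto
    finally show "norm (1 - x) < 1" .
  qed
  have Re: "Re (1 - z) < 1 / 2"
  proof -
    have "norm (1 - z) ^ 2 < norm z ^ 2" using z by (intro power_strict_mono) auto
    thus ?thesis unfolding cmod_power2 by (simp add: power2_eq_square algebra_simps)
  qed
  define s where "s = - a - of_nat n"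
  have s: "s \<notin> \<int>" using of_int_not_Ints_shift(3)[OF a, of "- int n"] by (simp add: s_def)
  define C where "C = of_nat p + 1 - a"
  have C: "C \<notin> \<int>\<^sub>\<le>\<^sub>0" using not_nonpos_Ints_shift(1)[OF a, of "p + 1"] by (simp add: C_def add.commute)
  have an: "a + of_nat n + 1 \<notin> \<int>\<^sub>\<le>\<^sub>0" using not_nonpos_Ints_shift(3)[OF a, of "n + 1"] by (simp add: add_ac)
  have na: "1 - a - of_nat n \<notin> \<int>\<^sub>\<le>\<^sub>0"
    using of_int_not_Ints_shift(3)[OF a, of "1 - int n"] not_Ints_imp_not_nonpos_Ints[of "1 - a - of_nat n"]
    by (simp add: algebra_simps)
  \<comment> \<open>with \<open>p\<close> as the retained parameter, the power of \<open>z\<close> that splits off has an integer exponent and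
     therefore no branch\<close>
  have R1: "reg2F1 (of_nat m + 1 - a) (of_nat p) C (1 - z) = z powr (- of_nat p) * reg2F1 (of_nat p) (of_nat n + 1) C (1 - x)"
  proof -
    have "(1 - z) / (1 - z - 1) = 1 - x" using zD by (simp add: x_def field_simps)
    moreover have "C - (of_nat m + 1 - a) = of_nat n + 1" "1 - (1 - z) = z" by (simp_all add: C_def p_def)
    ultimately show ?thesis
      using reg2F1_pfaff[OF C z(3) Re, of "of_nat p" "of_nat m + 1 - a"]
      by (simp only: reg2F1_commute[of "of_nat m + 1 - a"])
  qed
  define A where "A = reg2F1 a (a - of_nat m) (a + of_nat n + 1) x"
  define B where "B = reg2F1 (- of_nat n) (- of_nat (n + m)) (1 - a - of_nat n) x"
  have R2: "sin (of_real pi * s) / of_real pi * reg2F1 (of_nat p) (of_nat n + 1) C (1 - x) =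
     (1 - x) powr (a - of_nat p) *
       (rGamma (of_nat m + 1 - a) * rGamma (1 - a) * A - rGamma (of_nat p) * rGamma (of_nat n + 1) * (x powr s * B))"
  proof -
    have q: "of_nat p + (of_nat n + 1) + s = C" "1 - s = a + of_nat n + 1" "of_nat p + s = of_nat m + 1 - a"
      "of_nat n + 1 + s = 1 - a" "1 + s = 1 - a - of_nat n"
      by (simp_all add: s_def C_def p_def)
    have e1: "reg2F1 (of_nat p) (of_nat n + 1) (a + of_nat n + 1) x = (1 - x) powr (a - of_nat p) * A"
    proof -
      have "a + of_nat n + 1 - of_nat p - (of_nat n + 1) = a - of_nat p" "a + of_nat n + 1 - of_nat p = a - of_nat m"
        "a + of_nat n + 1 - (of_nat n + 1) = a" by (simp_all add: p_def)
      thus ?thesis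
        using reg2F1_euler[OF an x(1), of "of_nat p" "of_nat n + 1"] by (simp only: A_def reg2F1_commute[of a])
    qed
    have e2: "reg2F1 (of_nat m + 1 - a) (1 - a) (1 - a - of_nat n) x = (1 - x) powr (a - of_nat p) * B"
    proof -
      have "1 - a - of_nat n - (of_nat m + 1 - a) - (1 - a) = a - of_nat p" "1 - a - of_nat n - (of_nat m + 1 - a) = - of_nat (n + m)"
        "1 - a - of_nat n - (1 - a) = - of_nat n" by (simp_all add: p_def)
      thus ?thesis
        using reg2F1_euler[OF na x(1), of "of_nat m + 1 - a" "1 - a"] by (simp only: B_def reg2F1_commute[of "- of_nat n"])
    qed
    show ?thesis
      using reg2F1_connection[OF s, of "of_nat p" "of_nat n + 1" x, unfolded q, OF C x]
      unfolding e1 e2 by (simp add: algebra_simps)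
  qed
  define S where "S = sin (of_real pi * a)"
  have S: "S \<noteq> 0" using a by (simp add: S_def sin_pi_eq_0_iff)
  define e where "e = ((-1) ^ m :: complex)"
  define f where "f = ((-1) ^ n :: complex)"
  have ef: "e * e = 1" "f * f = 1" by (simp_all add: e_def f_def power_mult_distrib[symmetric])
  have sins: "sin (of_real pi * s) = - (f * S)"
  proof -
    have "sin (of_real pi * s) = sin (of_real pi * (- a - of_nat n))" by (simp add: s_def)
    also have "\<dots> = f * sin (of_real pi * (- a))" unfolding sin_pi_diff_nat f_def ..
    finally show ?thesis by (simp add: S_def)
  qed
  have branch: "(1 - z) powr (of_nat p - a) * (z powr (- of_nat p) * (1 - x) powr (a - of_nat p)) = - (e * f * (- z) powr (- a))"
  proof -
    have "(1 - z) powr (of_nat p - a) * (1 - x) powr (a - of_nat p) = (- z) powr (of_nat p - a)"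
    proof -
      have "1 - x \<noteq> 0" using zD by (simp add: x_def)
      hence "(1 - z) powr (of_nat p - a) * (1 - x) powr (a - of_nat p) =
          exp ((of_nat p - a) * Ln (1 - z) + (a - of_nat p) * Ln (1 - 1 / z))"
        using zD(8) by (simp only: powr_def x_def exp_add if_False)
      also have "(of_nat p - a) * Ln (1 - z) + (a - of_nat p) * Ln (1 - 1 / z) = (of_nat p - a) * Ln (- z)"
        unfolding Ln_branches_upper_half_plane(1)[OF z(1)] by (simp add: algebra_simps)
      finally show ?thesis
        using zD(7) by (simp add: powr_def)
    qed
    also have "(- z) powr (of_nat p - a) = (- z) ^ p * (- z) powr (- a)"
      using zD by (simp add: powr_diff powr_minus powr_nat' field_simps powr_of_nat')
    also have "(- z) ^ p = - (e * f * z ^ p)"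
      by (simp add: power_minus[of z] p_def e_def f_def power_add)
    finally have "(1 - z) powr (of_nat p - a) * (1 - x) powr (a - of_nat p) = - (e * f * z ^ p) * (- z) powr (- a)" .
    moreover have "z powr (- of_nat p) = inverse (z ^ p)"
      using zD by (simp add: powr_minus powr_of_nat')
    ultimately show ?thesis
      using zD by (simp add: field_simps)
  qed
  have xs: "x powr s = z ^ n * z powr a"
  proof -
    have "x \<noteq> 0" using zD by (simp add: x_def)
    hence "x powr s = exp (s * - Ln z)"
      using Ln_branches_upper_half_plane(3)[OF z(1)] by (simp add: powr_def x_def)
    also have "\<dots> = z powr (of_nat n + a)" using zD by (simp add: powr_def s_def algebra_simps)
    also have "\<dots> = z ^ n * z powr a" using zD by (simp add: powr_add powr_of_nat')
    finally show ?thesis .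
  qed
  have phase: "(- z) powr (- a) * z powr a = exp (\<i> * of_real pi * a)"
    using zD(7) unfolding powr_def Ln_branches_upper_half_plane(2)[OF z(1)]
    by (simp add: exp_add[symmetric] algebra_simps)
  have rev: "z ^ n * B = fact (n + m) * rGamma (1 - a) * reg2F1 (- of_nat n) a (of_nat m + 1) z"
    unfolding B_def x_def by (rule reg2F1_terminating_reverse) (use zD in auto)
  have rG: "rGamma (of_nat p) = 1 / (fact (n + m) :: complex)" "rGamma (of_nat n + 1) = 1 / (fact n :: complex)"
    using rGamma_of_nat_Suc[of "n + m"] rGamma_of_nat_Suc[of n] by (simp_all add: p_def add_ac)
  have G1: "Gamma (1 - a) * rGamma (1 - a) = 1"
    using not_nonpos_Ints_shift(4)[OF a] by (simp add: Gamma_def rGamma_eq_zero_iff)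
  define P where "P = pochhammer (a - of_nat m) (m + n + 1)"
  have P0: "P \<noteq> 0" using not_nonpos_Ints_shift(2)[OF a, of m] by (auto simp: P_def pochhammer_eq_0_iff)
  have AP: "rGamma (of_nat m + 1 - a) * A = e * S / of_real pi * (hyp2F1 a (a - of_nat m) (a + of_nat n + 1) x / P)"
  proof -
    have g: "rGamma (a + of_nat n + 1) \<noteq> 0" using an by (simp add: rGamma_eq_zero_iff)
    have "rGamma (a - of_nat m) = P * rGamma (a - of_nat m + of_nat (m + n + 1))"
      unfolding P_def by (rule pochhammer_rGamma)
    also have "a - of_nat m + of_nat (m + n + 1) = a + of_nat n + 1" by simp
    finally have "rGamma (of_nat m + 1 - a) * (P * rGamma (a + of_nat n + 1)) = e * S / of_real pi"
      using rGamma_shifted_reflection[of m a] by (simp add: e_def S_def)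
    thus ?thesis
      unfolding hyp2F1_eq_reg2F1[OF an x(1)] A_def[symmetric] Gamma_def using P0 g by (simp add: field_simps)
  qed
  have "U2 n m a z = - e * fact m * fact n * Gamma (1 - a) *
     ((1 - z) powr (of_nat p - a) * reg2F1 (of_nat m + 1 - a) (of_nat p) C (1 - z))"
    using U2_eq_reg2F1[OF a z(1,3), of n m] by (simp add: p_def C_def e_def add_ac)
  also have "reg2F1 (of_nat m + 1 - a) (of_nat p) C (1 - z) = - (of_real pi * f / S) * z powr (- of_nat p) *
     (sin (of_real pi * s) / of_real pi * reg2F1 (of_nat p) (of_nat n + 1) C (1 - x))"
    unfolding R1 sins using S ef by (simp add: field_simps)
  also have "(1 - z) powr (of_nat p - a) * \<dots> = - (of_real pi * f / S) *
      ((1 - z) powr (of_nat p - a) * (z powr (- of_nat p) * (1 - x) powr (a - of_nat p))) *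
       (rGamma (of_nat m + 1 - a) * rGamma (1 - a) * A - rGamma (of_nat p) * rGamma (of_nat n + 1) * (x powr s * B))"
    unfolding R2 by (simp only: mult_ac mult_minus_left mult_minus_right)
  also have "\<dots> = of_real pi * e / S * (- z) powr (- a) *
       (rGamma (of_nat m + 1 - a) * rGamma (1 - a) * A - rGamma (of_nat p) * rGamma (of_nat n + 1) * (x powr s * B))"
  proof -
    have "- (of_real pi * f / S) * (- (e * f * w)) * X = (f * f) * (of_real pi * e / S * w * X)" for w X
      by simp
    thus ?thesis unfolding branch ef by (simp only: mult_1)
  qed
  also have "- e * fact m * fact n * Gamma (1 - a) * \<dots> = - (fact m * fact n * of_real pi / S) * (e * e) * (- z) powr (- a) *
      (Gamma (1 - a) * rGamma (1 - a) * (rGamma (of_nat m + 1 - a) * A) - Gamma (1 - a) * rGamma (of_nat p) * rGamma (of_nat n + 1) * (x powr s * B))"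
    by (simp add: algebra_simps)
  also have "\<dots> = - (fact m * fact n * of_real pi / S) * (- z) powr (- a) * (rGamma (of_nat m + 1 - a) * A)
     + fact m * of_real pi / S * ((- z) powr (- a) * z powr a) * (Gamma (1 - a) * (z ^ n * B) / fact (n + m))"
  proof -
    have "- (fm * fn * pi' / S) * 1 * w * (1 * Y - g * (1 / N) * (1 / fn) * (u * v * B)) =
       - (fm * fn * pi' / S) * w * Y + fm * pi' / S * (w * v) * (g * (u * B) / N)"
      if "fn \<noteq> 0" for fm fn pi' w Y g N u v :: complex
    proof -
      have "- (fm * fn * pi' / S) * 1 * w * (1 * Y - g * (1 / N) * (1 / fn) * (u * v * B)) =
       - (fm * fn * pi' / S) * w * Y + fm * pi' / S * (w * v) * (g * (u * B) / N) * (fn * (1 / fn))"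
        by (simp add: right_diff_distrib)
      thus ?thesis using that by simp
    qed
    from this[OF fact_nonzero] show ?thesis
      unfolding ef G1 rG xs by blast
  qed
  also have "Gamma (1 - a) * (z ^ n * B) / fact (n + m) = (Gamma (1 - a) * rGamma (1 - a)) * reg2F1 (- of_nat n) a (of_nat m + 1) z"
    unfolding rev by simp
  finally show ?thesis
    unfolding phase G1 AP P_def[symmetric] S_def[symmetric] x_def[symmetric] e_def
    using S by (simp add: field_simps)
qed

lemma U2_at_infinity:
  assumes a: "a \<notin> \<int>" and z: "z \<in> upper_half_plane"
  shows "U2 n m a z =
       (-1) ^ (m + 1) * fact m * fact n / pochhammer (a - of_nat m) (m + n + 1)
         * (- z) powr (- a) * hyp2F1 a (a - of_nat m) (a + of_nat n + 1) (1 / z)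
       + of_real pi * exp (\<i> * of_real pi * a) / sin (of_real pi * a) * hyp2F1 (- of_nat n) a (of_nat m + 1) z"
proof -
  let ?G = "upper_half_plane \<inter> {z. norm z > 1} \<inter> {z. norm (1 - z) < 1}"
  let ?R = "\<lambda>z. (-1) ^ (m + 1) * fact m * fact n / pochhammer (a - of_nat m) (m + n + 1)
         * ((- z) powr (- a) * hyp2F1 a (a - of_nat m) (a + of_nat n + 1) (1 / z))
       + of_real pi * exp (\<i> * of_real pi * a) / sin (of_real pi * a) * (fact m * reg2F1 (- of_nat n) a (of_nat m + 1) z)"
  have an: "a + of_nat n + 1 \<notin> \<int>\<^sub>\<le>\<^sub>0" using not_nonpos_Ints_shift(3)[OF a, of "n + 1"] by (simp add: add_ac)
  have "U2 n m a z = ?R z"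
  proof (rule identity_upper_half_plane[of ?G "U2 n m a" ?R])
    show "open ?G"
      by (intro open_Int open_upper_half_plane open_Collect_less continuous_intros)
    have "1 + \<i> / 2 \<in> ?G"
      by (auto simp: upper_half_plane_iff cmod_def power2_eq_square)
    thus "?G \<noteq> {}" by blast
    show "U2 n m a holomorphic_on upper_half_plane" using a by (rule holomorphic_U2)
    have nz: "0 \<notin> upper_half_plane" by (simp add: upper_half_plane_iff)
    have "(hyp2F1 a (a - of_nat m) (a + of_nat n + 1) \<circ> (\<lambda>z. 1 / z)) holomorphic_on upper_half_plane"
      by (rule holomorphic_on_compose_gen[OF _ holomorphic_hyp2F1[OF an]])
         (use upper_half_planeD(3) nz in \<open>auto intro!: holomorphic_intros\<close>)
    thus "?R holomorphic_on upper_half_plane"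
      by (intro holomorphic_intros holomorphic_reg2F1_terminating)
         (use upper_half_planeD(5) in \<open>simp_all add: o_def\<close>)
    show "U2 n m a y = ?R y" if "y \<in> ?G" for y
      using that by (intro U2_at_infinity_near[OF a]) auto
  qed (use z in auto)
  thus ?thesis
    unfolding hyp2F1_terminating[OF upper_half_planeD(1)[OF z]] by (simp add: mult.assoc)
qed

section \<open>Collision of the exponents at the origin\<close>

lemma deriv_rGamma_shift:
  "((\<lambda>\<epsilon>. rGamma (w + \<epsilon>)) has_field_derivative deriv rGamma w) (at (0::complex))"
proof -
  have "(rGamma has_field_derivative deriv rGamma w) (at (0 + w))"
    by (simp add: field_differentiable_derivI[OF field_differentiable_rGamma])
  thus ?thesis
    unfolding DERIV_shift by (simp only: add.commute)
qed

lemma deriv_rGamma: "z \<notin> \<int>\<^sub>\<le>\<^sub>0 \<Longrightarrow> deriv rGamma (z::complex) = - rGamma z * Digamma z"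
  by (rule DERIV_imp_deriv) (rule has_field_derivative_rGamma_no_nonpos_int)

lemma deriv_rGamma_minus_of_nat: "deriv rGamma (- of_nat k :: complex) = (-1) ^ k * fact k"
  by (rule DERIV_imp_deriv) (rule has_field_derivative_rGamma_nonpos_int)

text \<open>
  The logarithmic derivative of \<open>(y)\<^sub>j = \<Gamma>(y + j) / \<Gamma>(y)\<close>.
\<close>
lemma has_field_derivative_pochhammer_Digamma:
  assumes y: "(y::complex) \<notin> \<int>\<^sub>\<le>\<^sub>0"
  shows "((\<lambda>\<epsilon>. pochhammer (y + \<epsilon>) j) has_field_derivative
           pochhammer y j * (Digamma (y + of_nat j) - Digamma y)) (at 0)"
proof -
  have yj: "y + of_nat j \<notin> \<int>\<^sub>\<le>\<^sub>0"
  proof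
    assume "y + of_nat j \<in> \<int>\<^sub>\<le>\<^sub>0"
    then obtain k where "y + of_nat j = - of_nat k" by (auto elim: nonpos_Ints_cases')
    hence "y = - of_nat (k + j)" by (simp add: eq_diff_eq)
    thus False using y by (metis minus_of_nat_in_nonpos_Ints)
  qed
  have nz: "rGamma (y + of_nat j) \<noteq> 0" using yj by (simp add: rGamma_eq_zero_iff)
  have d: "((\<lambda>\<epsilon>. rGamma (w + \<epsilon>)) has_field_derivative - rGamma w * Digamma w) (at 0)" if "w \<notin> \<int>\<^sub>\<le>\<^sub>0" for w :: complex
    using deriv_rGamma_shift[of w] unfolding deriv_rGamma[OF that] .
  have "((\<lambda>\<epsilon>. rGamma (y + \<epsilon>) / rGamma (y + of_nat j + \<epsilon>)) has_field_derivative
      (- rGamma y * Digamma y * rGamma (y + of_nat j) - rGamma y * (- rGamma (y + of_nat j) * Digamma (y + of_nat j)))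
        / (rGamma (y + of_nat j) * rGamma (y + of_nat j))) (at 0)"
    using DERIV_divide[OF d[OF y] d[OF yj]] nz by simp
  also have "(- rGamma y * Digamma y * rGamma (y + of_nat j) - rGamma y * (- rGamma (y + of_nat j) * Digamma (y + of_nat j)))
        / (rGamma (y + of_nat j) * rGamma (y + of_nat j)) = pochhammer y j * (Digamma (y + of_nat j) - Digamma y)"
    using nz by (subst (1 2) pochhammer_rGamma[of y j]) (simp add: field_simps)
  finally have D: "((\<lambda>\<epsilon>. rGamma (y + \<epsilon>) / rGamma (y + of_nat j + \<epsilon>)) has_field_derivative
      pochhammer y j * (Digamma (y + of_nat j) - Digamma y)) (at 0)" .
  have "isCont (\<lambda>\<epsilon>. rGamma (y + of_nat j + \<epsilon>)) 0"
    by (intro continuous_intros)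
  hence "((\<lambda>\<epsilon>. rGamma (y + of_nat j + \<epsilon>)) \<longlongrightarrow> rGamma (y + of_nat j)) (nhds 0)"
    by (simp add: isCont_def tendsto_nhds_iff)
  hence ev: "eventually (\<lambda>\<epsilon>. rGamma (y + of_nat j + \<epsilon>) \<noteq> 0) (nhds 0)"
    using nz by (rule tendsto_imp_eventually_ne)
  have "eventually (\<lambda>\<epsilon>. rGamma (y + \<epsilon>) / rGamma (y + of_nat j + \<epsilon>) = pochhammer (y + \<epsilon>) j) (nhds 0)"
    using ev
  proof eventually_elim
    case (elim \<epsilon>)
    thus ?case using pochhammer_rGamma[of "y + \<epsilon>" j] by (simp add: add_ac)
  qed
  with D show ?thesis
    by (subst (asm) DERIV_cong_ev[OF refl _ refl])
qed

text \<open>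
  A numerator parameter of the first solution at \<open>\<epsilon> = 0\<close>. With \<open>c = m + 1 + \<epsilon>\<close> the parameter is
  either \<open>c - e\<close> or \<open>e\<close>; the flag says which. The transformations of Euler and Pfaff exchange the
  two, so that the four pairs of flags for \<open>e = a\<close> and \<open>e = -n\<close> stand for the four forms of the
  expansion.
\<close>
definition upper_param :: "bool \<Rightarrow> complex \<Rightarrow> nat \<Rightarrow> complex" where
  "upper_param i e m = (if i then of_nat m + 1 - e else e)"

text \<open>
  The difference of the derivatives with respect to \<open>\<epsilon>\<close> of two corresponding factors, one in the
  coefficients of the solution with exponent \<open>0\<close>, one in those of the solution with exponent
  \<open>1 - c\<close>. In the second case the derivative of \<open>1 / \<Gamma>\<close> also covers the zeros of \<open>1 / \<Gamma>\<close>, where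
  no value of \<open>\<psi>\<close> exists; these give the infinite tails with factorials in place of \<open>\<psi>\<close>.
\<close>
definition psi_coeff :: "bool \<Rightarrow> complex \<Rightarrow> nat \<Rightarrow> nat \<Rightarrow> complex" where
  "psi_coeff i e m j = (if i then rGamma (1 - e) * pochhammer (of_nat m + 1 - e) j * Digamma (of_nat m + 1 - e + of_nat j)
     else - ((-1) ^ j * deriv rGamma (1 - e - of_nat j)))"

text \<open>
  At \<open>\<epsilon> = 0\<close> the factor with index \<open>m + j\<close> in the second solution agrees, up to the sign \<open>\<sigma>\<close>, with
  the factor with index \<open>j\<close> in the first one, which is why the two series cancel. For a fixed
  parameter \<open>e\<close> the second factor is \<open>\<plusminus>1 / \<Gamma>(m + 1 - e + \<epsilon> - k)\<close>, an entire function.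
\<close>
lemma log_factor:
  fixes e :: complex and m :: nat and i :: bool
  defines "A \<equiv> upper_param i e m" and "\<sigma> \<equiv> (if i then 1 else (-1) ^ m :: complex)"
    and "v \<equiv> of_bool i :: complex"
  assumes i: "i \<Longrightarrow> of_nat m + 1 - e \<notin> \<int>\<^sub>\<le>\<^sub>0"
  obtains dU dL where
    "\<And>j. ((\<lambda>\<epsilon>. rGamma (1 - e) * pochhammer (A + v * \<epsilon>) j) has_field_derivative dU j) (at 0)"
    "\<And>k. ((\<lambda>\<epsilon>. rGamma (of_nat m + 1 - e + \<epsilon>) * pochhammer (A - of_nat m + (v - 1) * \<epsilon>) k) has_field_derivative dL k) (at 0)"
    "\<And>j. rGamma (1 - e) * pochhammer A j = \<sigma> * (rGamma (of_nat m + 1 - e) * pochhammer (A - of_nat m) (m + j))"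
    "\<And>j. dU j - \<sigma> * dL (m + j) = psi_coeff i e m j"
proof (cases i)
  case True
  define y where "y = of_nat m + 1 - e"
  have y: "y \<notin> \<int>\<^sub>\<le>\<^sub>0" using i True by (simp add: y_def)
  have A: "A = y" "v = 1" "\<sigma> = 1" "A - of_nat m = 1 - e" using True by (auto simp: A_def v_def \<sigma>_def upper_param_def y_def)
  have val: "rGamma (1 - e) * pochhammer y j = rGamma y * pochhammer (1 - e) (m + j)" for j
  proof -
    have "rGamma (1 - e) = pochhammer (1 - e) m * rGamma y"
      using pochhammer_rGamma[of "1 - e" m] by (simp add: y_def algebra_simps)
    moreover have "pochhammer (1 - e) (m + j) = pochhammer (1 - e) m * pochhammer y j"
      using pochhammer_product'[of "1 - e" m j] by (simp add: y_def algebra_simps)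
    ultimately show ?thesis by simp
  qed
  show ?thesis
  proof (rule that)
    show "((\<lambda>\<epsilon>. rGamma (1 - e) * pochhammer (A + v * \<epsilon>) j) has_field_derivative
       rGamma (1 - e) * (pochhammer y j * (Digamma (y + of_nat j) - Digamma y))) (at 0)" for j
      using DERIV_cmult[OF has_field_derivative_pochhammer_Digamma[OF y]] by (simp add: A)
    show "((\<lambda>\<epsilon>. rGamma (of_nat m + 1 - e + \<epsilon>) * pochhammer (A - of_nat m + (v - 1) * \<epsilon>) k) has_field_derivative
       deriv rGamma y * pochhammer (1 - e) k) (at 0)" for k
      using DERIV_cmult_right[OF deriv_rGamma_shift[of y], of "pochhammer (1 - e) k"]
      unfolding A(4) A(2) y_def[symmetric] by simp
    show "rGamma (1 - e) * pochhammer A j = \<sigma> * (rGamma (of_nat m + 1 - e) * pochhammer (A - of_nat m) (m + j))" for j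
      unfolding A(4) A(3) y_def[symmetric] by (simp add: A(1) val)
    show "rGamma (1 - e) * (pochhammer y j * (Digamma (y + of_nat j) - Digamma y)) - \<sigma> * (deriv rGamma y * pochhammer (1 - e) (m + j)) =
       psi_coeff i e m j" for j
    proof -
      have "deriv rGamma y * pochhammer (1 - e) (m + j) = - Digamma y * (rGamma y * pochhammer (1 - e) (m + j))"
        by (simp add: deriv_rGamma[OF y])
      also have "\<dots> = - Digamma y * (rGamma (1 - e) * pochhammer y j)" by (simp only: val)
      finally show ?thesis
        using True unfolding psi_coeff_def y_def[symmetric] A(3) by (simp add: algebra_simps)
    qed
  qed
next
  case False
  have A: "A = e" "v = 0" "\<sigma> = (-1) ^ m" using False by (auto simp: A_def v_def \<sigma>_def upper_param_def)
  have L: "rGamma (of_nat m + 1 - e + \<epsilon>) * pochhammer (A - of_nat m + (v - 1) * \<epsilon>) k = (-1) ^ k * rGamma (of_nat m + 1 - e - of_nat k + \<epsilon>)" for k \<epsilon>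
  proof -
    have "rGamma (of_nat m + 1 - e - of_nat k + \<epsilon>) = (-1) ^ k * pochhammer (e - of_nat m - \<epsilon>) k * rGamma (of_nat m + 1 - e + \<epsilon>)"
      using rGamma_minus_of_nat_shift[of "e - of_nat m - \<epsilon>" k] by (simp add: algebra_simps)
    moreover have "(-1) ^ k * (-1) ^ k = (1::complex)" by (simp add: power_mult_distrib[symmetric])
    ultimately show ?thesis by (simp add: A mult.assoc[symmetric])
  qed
  have mj: "of_nat m + 1 - e - of_nat (m + j) = 1 - e - of_nat j" for j by simp
  have sg: "(-1) ^ m * (-1) ^ (m + j) = ((-1) ^ j :: complex)" for j
    by (simp add: power_add mult.assoc[symmetric])
  show ?thesis
  proof (rule that)
    show "((\<lambda>\<epsilon>. rGamma (1 - e) * pochhammer (A + v * \<epsilon>) j) has_field_derivative 0) (at 0)" for j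
      by (simp add: A)
    show "((\<lambda>\<epsilon>. rGamma (of_nat m + 1 - e + \<epsilon>) * pochhammer (A - of_nat m + (v - 1) * \<epsilon>) k) has_field_derivative
       (-1) ^ k * deriv rGamma (of_nat m + 1 - e - of_nat k)) (at 0)" for k
      unfolding L by (intro DERIV_cmult deriv_rGamma_shift)
    show "rGamma (1 - e) * pochhammer A j = \<sigma> * (rGamma (of_nat m + 1 - e) * pochhammer (A - of_nat m) (m + j))" for j
    proof -
      have "\<sigma> * (rGamma (of_nat m + 1 - e) * pochhammer (A - of_nat m) (m + j)) = (-1) ^ j * rGamma (1 - e - of_nat j)"
        using L[of 0 "m + j", unfolded mj] by (simp add: A mult.assoc[symmetric] sg)
      also have "\<dots> = rGamma (1 - e) * pochhammer e j"
        unfolding rGamma_minus_of_nat_shift by (simp add: mult.assoc[symmetric] power_mult_distrib[symmetric])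
      finally show ?thesis by (simp add: A)
    qed
    show "0 - \<sigma> * ((-1) ^ (m + j) * deriv rGamma (of_nat m + 1 - e - of_nat (m + j))) = psi_coeff i e m j" for j
      unfolding mj using False by (simp add: psi_coeff_def A mult.assoc[symmetric] sg)
  qed
qed

lemma suminf_split_first:
  fixes f :: "nat \<Rightarrow> complex"
  assumes "summable f"
  shows "suminf f = (\<Sum>k<m. f k) + (\<Sum>j. f (m + j))"
  using suminf_split_initial_segment[OF assms, of m] by (simp add: add.commute)

text \<open>
  The product rule applied to the two numerator factors and to \<open>1 / (\<Gamma>(c + j) j!)\<close>. The last
  factor contributes \<open>-\<psi>(m + j + 1) - \<psi>(j + 1)\<close>.
\<close>
definition log_coeff :: "bool \<Rightarrow> bool \<Rightarrow> complex \<Rightarrow> complex \<Rightarrow> nat \<Rightarrow> nat \<Rightarrow> complex" where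
  "log_coeff i1 i2 e1 e2 m j =
     (psi_coeff i1 e1 m j * (rGamma (1 - e2) * pochhammer (upper_param i2 e2 m) j)
      + rGamma (1 - e1) * pochhammer (upper_param i1 e1 m) j * psi_coeff i2 e2 m j
      - rGamma (1 - e1) * pochhammer (upper_param i1 e1 m) j * (rGamma (1 - e2) * pochhammer (upper_param i2 e2 m) j)
        * (Digamma (of_nat (m + j + 1)) + Digamma (of_nat (j + 1)))) / (fact (m + j) * fact j)"

text \<open>
  The derivative at \<open>\<epsilon> = 0\<close> of the combination of the two solutions that appears in the
  connection formula. The first \<open>m\<close> coefficients of the second solution vanish at \<open>\<epsilon> = 0\<close>, owing to
  the poles of \<open>\<Gamma>(1 - m + k)\<close>, and only their derivatives contribute. The others are paired with
  the coefficients of the first solution. The variable \<open>t\<close> of the power and of the logarithm and the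
  variable \<open>x\<close> of the series agree up to a sign that compensates the signs of \<open>log_factor\<close>.
\<close>
theorem log_limit:
  fixes e1 e2 x t :: complex and m :: nat and i1 i2 :: bool
  defines "A \<equiv> upper_param i1 e1 m" and "B \<equiv> upper_param i2 e2 m"
    and "v1 \<equiv> of_bool i1 :: complex" and "v2 \<equiv> of_bool i2 :: complex"
    and "\<eta> \<equiv> (if i1 = i2 then 1 else -1 :: complex)"
    and "d \<equiv> log_coeff i1 i2 e1 e2 m"
  assumes e1: "i1 \<Longrightarrow> of_nat m + 1 - e1 \<notin> \<int>\<^sub>\<le>\<^sub>0" and e2: "i2 \<Longrightarrow> of_nat m + 1 - e2 \<notin> \<int>\<^sub>\<le>\<^sub>0"
    and x: "norm x < 1" "x = \<eta> * t" and t: "t \<noteq> 0"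
  shows "summable (\<lambda>j. d j * x ^ j)"
    and "((\<lambda>\<epsilon>. rGamma (1 - e1) * rGamma (1 - e2) * reg2F1 (A + v1 * \<epsilon>) (B + v2 * \<epsilon>) (of_nat m + 1 + \<epsilon>) x
           - rGamma (of_nat m + 1 - e1 + \<epsilon>) * rGamma (of_nat m + 1 - e2 + \<epsilon>) * (t powr (- of_nat m - \<epsilon>) *
              reg2F1 (A - of_nat m + (v1 - 1) * \<epsilon>) (B - of_nat m + (v2 - 1) * \<epsilon>) (1 - of_nat m - \<epsilon>) x))
        has_field_derivative
          (\<Sum>j. d j * x ^ j)
          + ln t * (rGamma (1 - e1) * rGamma (1 - e2) * reg2F1 A B (of_nat m + 1) x)
          + rGamma (of_nat m + 1 - e1) * rGamma (of_nat m + 1 - e2) * inverse (t ^ m) *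
             (\<Sum>k<m. pochhammer (A - of_nat m) k * pochhammer (B - of_nat m) k * ((-1) ^ (m - 1 - k) * fact (m - 1 - k)) / fact k * x ^ k))
        (at 0)"
    (is ?deriv)
proof -
  define \<gamma> where "\<gamma> j = 1 / (fact (m + j) * fact j :: complex)" for j
  define \<alpha> \<beta> where "\<alpha> j = rGamma (1 - e1) * pochhammer A j" and "\<beta> j = rGamma (1 - e2) * pochhammer B j" for j
  have d: "d j = psi_coeff i1 e1 m j * \<beta> j * \<gamma> j + \<alpha> j * psi_coeff i2 e2 m j * \<gamma> j
      - \<alpha> j * \<beta> j * \<gamma> j * (Digamma (of_nat (m + j + 1)) + Digamma (of_nat (j + 1)))" for j
    by (simp add: d_def log_coeff_def \<alpha>_def \<beta>_def \<gamma>_def A_def B_def add_divide_distrib diff_divide_distrib mult.assoc)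
  define \<sigma>1 \<sigma>2 where "\<sigma>1 = (if i1 then 1 else (-1) ^ m :: complex)" and "\<sigma>2 = (if i2 then 1 else (-1) ^ m :: complex)"
  obtain dU1 dL1 where F1:
    "\<And>j. ((\<lambda>\<epsilon>. rGamma (1 - e1) * pochhammer (A + v1 * \<epsilon>) j) has_field_derivative dU1 j) (at 0)"
    "\<And>k. ((\<lambda>\<epsilon>. rGamma (of_nat m + 1 - e1 + \<epsilon>) * pochhammer (A - of_nat m + (v1 - 1) * \<epsilon>) k) has_field_derivative dL1 k) (at 0)"
    "\<And>j. rGamma (1 - e1) * pochhammer A j = \<sigma>1 * (rGamma (of_nat m + 1 - e1) * pochhammer (A - of_nat m) (m + j))"
    "\<And>j. dU1 j - \<sigma>1 * dL1 (m + j) = psi_coeff i1 e1 m j"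
    using log_factor[of i1 m e1] e1 unfolding A_def v1_def \<sigma>1_def by blast
  obtain dU2 dL2 where F2:
    "\<And>j. ((\<lambda>\<epsilon>. rGamma (1 - e2) * pochhammer (B + v2 * \<epsilon>) j) has_field_derivative dU2 j) (at 0)"
    "\<And>k. ((\<lambda>\<epsilon>. rGamma (of_nat m + 1 - e2 + \<epsilon>) * pochhammer (B - of_nat m + (v2 - 1) * \<epsilon>) k) has_field_derivative dL2 k) (at 0)"
    "\<And>j. rGamma (1 - e2) * pochhammer B j = \<sigma>2 * (rGamma (of_nat m + 1 - e2) * pochhammer (B - of_nat m) (m + j))"
    "\<And>j. dU2 j - \<sigma>2 * dL2 (m + j) = psi_coeff i2 e2 m j"
    using log_factor[of i2 m e2] e2 unfolding B_def v2_def \<sigma>2_def by blast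
  define L1 L2 where "L1 k = rGamma (of_nat m + 1 - e1) * pochhammer (A - of_nat m) k"
    and "L2 k = rGamma (of_nat m + 1 - e2) * pochhammer (B - of_nat m) k" for k
  have \<sigma>: "\<eta> ^ m = \<sigma>1 * \<sigma>2" by (auto simp: \<eta>_def \<sigma>1_def \<sigma>2_def power_mult_distrib[symmetric])
  have \<alpha>: "\<alpha> j = \<sigma>1 * L1 (m + j)" and \<beta>: "\<beta> j = \<sigma>2 * L2 (m + j)" for j
    by (simp_all add: \<alpha>_def \<beta>_def L1_def L2_def F1(3) F2(3))
  \<comment> \<open>coefficients \<open>T k \<epsilon>\<close> of the solution with exponent \<open>0\<close>; their derivatives are identified below by
     the product rule and uniqueness of the derivative\<close>
  define P where "P = rGamma (1 - e1) * rGamma (1 - e2)"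
  define T where "T k \<epsilon> = reg2F1_coeff (A + v1 * \<epsilon>) (B + v2 * \<epsilon>) (of_nat m + 1 + 1 * \<epsilon>) k" for k \<epsilon>
  have diffT: "T k field_differentiable (at 0)" for k
    unfolding T_def reg2F1_coeff_def pochhammer_prod
    by (rule holomorphic_on_imp_differentiable_at[of _ UNIV]) (auto intro!: holomorphic_intros)
  define DT where "DT k = deriv (T k) 0" for k
  have DT: "(T k has_field_derivative DT k) (at 0)" for k
    unfolding DT_def by (rule field_differentiable_derivI[OF diffT])
  note sumT = reg2F1_affine_parameters[OF x(1) DT[unfolded T_def]]
  have PDT: "P * DT j = dU1 j * \<beta> j * \<gamma> j + \<alpha> j * dU2 j * \<gamma> j - \<alpha> j * \<beta> j * \<gamma> j * Digamma (of_nat (m + j + 1))" for j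
  proof -
    have nz: "of_nat (m + j + 1) \<notin> (\<int>\<^sub>\<le>\<^sub>0 :: complex set)" by (rule Re_pos_notin_nonpos_Ints) simp
    have \<gamma>: "\<gamma> j = rGamma (of_nat (m + j + 1)) / fact j"
      using rGamma_of_nat_Suc[of "m + j"] by (simp add: \<gamma>_def add_ac)
    have d\<gamma>: "((\<lambda>\<epsilon>. rGamma (of_nat (m + j + 1) + \<epsilon>) / fact j) has_field_derivative - \<gamma> j * Digamma (of_nat (m + j + 1))) (at 0)"
      using DERIV_cdivide[OF deriv_rGamma_shift[of "of_nat (m + j + 1)"], of "fact j"]
      unfolding deriv_rGamma[OF nz] \<gamma> by simp
    have "((\<lambda>\<epsilon>. (rGamma (1 - e1) * pochhammer (A + v1 * \<epsilon>) j) * (rGamma (1 - e2) * pochhammer (B + v2 * \<epsilon>) j) * (rGamma (of_nat (m + j + 1) + \<epsilon>) / fact j))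
       has_field_derivative (dU1 j * \<beta> j + dU2 j * \<alpha> j) * \<gamma> j + - \<gamma> j * Digamma (of_nat (m + j + 1)) * (\<alpha> j * \<beta> j)) (at 0)"
      using DERIV_mult[OF DERIV_mult[OF F1(1)[of j] F2(1)[of j]] d\<gamma>] by (simp add: \<alpha>_def \<beta>_def \<gamma>)
    moreover have "(\<lambda>\<epsilon>. (rGamma (1 - e1) * pochhammer (A + v1 * \<epsilon>) j) * (rGamma (1 - e2) * pochhammer (B + v2 * \<epsilon>) j) * (rGamma (of_nat (m + j + 1) + \<epsilon>) / fact j))
       = (\<lambda>\<epsilon>. P * T j \<epsilon>)"
      by (simp add: P_def T_def reg2F1_coeff_def add_ac mult_ac)
    ultimately have "((\<lambda>\<epsilon>. P * T j \<epsilon>) has_field_derivative (dU1 j * \<beta> j + dU2 j * \<alpha> j) * \<gamma> j + - \<gamma> j * Digamma (of_nat (m + j + 1)) * (\<alpha> j * \<beta> j)) (at 0)"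
      by (simp only:)
    from DERIV_unique[OF DERIV_cmult[OF DT] this] show ?thesis
      by (simp add: algebra_simps)
  qed
  have PT: "P * T j 0 = \<alpha> j * \<beta> j * \<gamma> j" for j
    using rGamma_of_nat_Suc[of "m + j"]
    by (simp add: P_def T_def reg2F1_coeff_def \<alpha>_def \<beta>_def \<gamma>_def add_ac)
  \<comment> \<open>coefficients \<open>S k \<epsilon>\<close> of the solution with exponent \<open>-m - \<epsilon>\<close>; the factor \<open>Q \<epsilon>\<close> depends on \<open>\<epsilon>\<close> and
     is differentiated together with them\<close>
  define Q where "Q \<epsilon> = rGamma (of_nat m + 1 - e1 + \<epsilon>) * rGamma (of_nat m + 1 - e2 + \<epsilon>)" for \<epsilon>
  define S where "S k \<epsilon> = reg2F1_coeff (A - of_nat m + (v1 - 1) * \<epsilon>) (B - of_nat m + (v2 - 1) * \<epsilon>) (1 - of_nat m + (-1) * \<epsilon>) k" for k \<epsilon>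
  have diffS: "S k field_differentiable (at 0)" for k
    unfolding S_def reg2F1_coeff_def pochhammer_prod
    by (rule holomorphic_on_imp_differentiable_at[of _ UNIV]) (auto intro!: holomorphic_intros)
  define DS where "DS k = deriv (S k) 0" for k
  have DS: "(S k has_field_derivative DS k) (at 0)" for k
    unfolding DS_def by (rule field_differentiable_derivI[OF diffS])
  define Q' where "Q' = deriv rGamma (of_nat m + 1 - e1) * rGamma (of_nat m + 1 - e2) + deriv rGamma (of_nat m + 1 - e2) * rGamma (of_nat m + 1 - e1)"
  have Q': "(Q has_field_derivative Q') (at 0)"
    using DERIV_mult[OF deriv_rGamma_shift[of "of_nat m + 1 - e1"] deriv_rGamma_shift[of "of_nat m + 1 - e2"]]
    by (simp add: Q_def [abs_def] Q'_def)
  note sumS = reg2F1_affine_parameters[OF x(1) DS[unfolded S_def]]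
  define ES where "ES k = Q' * S k 0 + DS k * Q 0" for k
  have ES: "ES k = (dL1 k * L2 k + dL2 k * L1 k) * (rGamma (1 - of_nat m + of_nat k) / fact k) - deriv rGamma (1 - of_nat m + of_nat k) / fact k * (L1 k * L2 k)" for k
  proof -
    have d\<gamma>: "((\<lambda>\<epsilon>::complex. rGamma (1 - of_nat m + of_nat k - \<epsilon>) / fact k) has_field_derivative - deriv rGamma (1 - of_nat m + of_nat k) / fact k) (at 0)"
    proof -
      have "((\<lambda>\<epsilon>::complex. rGamma (1 - of_nat m + of_nat k + \<epsilon>)) has_field_derivative deriv rGamma (1 - of_nat m + of_nat k)) (at (- 0 :: complex))"
        using deriv_rGamma_shift[of "1 - of_nat m + of_nat k"] by simp
      moreover have "(uminus has_field_derivative (-1)) (at (0::complex))"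
        by (auto intro!: derivative_eq_intros)
      ultimately have "((\<lambda>\<epsilon>::complex. rGamma (1 - of_nat m + of_nat k + (- \<epsilon>))) has_field_derivative deriv rGamma (1 - of_nat m + of_nat k) * (-1)) (at 0)"
        by (rule DERIV_chain2)
      from DERIV_cdivide[OF this, of "fact k"] show ?thesis by simp
    qed
    have "((\<lambda>\<epsilon>. (rGamma (of_nat m + 1 - e1 + \<epsilon>) * pochhammer (A - of_nat m + (v1 - 1) * \<epsilon>) k) * (rGamma (of_nat m + 1 - e2 + \<epsilon>) * pochhammer (B - of_nat m + (v2 - 1) * \<epsilon>) k) * (rGamma (1 - of_nat m + of_nat k - \<epsilon>) / fact k))
       has_field_derivative (dL1 k * L2 k + dL2 k * L1 k) * (rGamma (1 - of_nat m + of_nat k) / fact k) + - deriv rGamma (1 - of_nat m + of_nat k) / fact k * (L1 k * L2 k)) (at 0)"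
      using DERIV_mult[OF DERIV_mult[OF F1(2)[of k] F2(2)[of k]] d\<gamma>] by (simp add: L1_def L2_def)
    moreover have "(\<lambda>\<epsilon>. (rGamma (of_nat m + 1 - e1 + \<epsilon>) * pochhammer (A - of_nat m + (v1 - 1) * \<epsilon>) k) * (rGamma (of_nat m + 1 - e2 + \<epsilon>) * pochhammer (B - of_nat m + (v2 - 1) * \<epsilon>) k) * (rGamma (1 - of_nat m + of_nat k - \<epsilon>) / fact k))
       = (\<lambda>\<epsilon>. Q \<epsilon> * S k \<epsilon>)"
    proof
      fix \<epsilon> :: complex
      have "1 - of_nat m + (-1) * \<epsilon> + of_nat k = 1 - of_nat m + of_nat k - \<epsilon>" by simp
      thus "(rGamma (of_nat m + 1 - e1 + \<epsilon>) * pochhammer (A - of_nat m + (v1 - 1) * \<epsilon>) k) * (rGamma (of_nat m + 1 - e2 + \<epsilon>) * pochhammer (B - of_nat m + (v2 - 1) * \<epsilon>) k) * (rGamma (1 - of_nat m + of_nat k - \<epsilon>) / fact k)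
        = Q \<epsilon> * S k \<epsilon>"
        unfolding Q_def S_def reg2F1_coeff_def by (simp only: times_divide_eq_right mult_ac)
    qed
    ultimately have "((\<lambda>\<epsilon>. Q \<epsilon> * S k \<epsilon>) has_field_derivative (dL1 k * L2 k + dL2 k * L1 k) * (rGamma (1 - of_nat m + of_nat k) / fact k) + - deriv rGamma (1 - of_nat m + of_nat k) / fact k * (L1 k * L2 k)) (at 0)"
      by (simp only:)
    from DERIV_unique[OF DERIV_mult[OF Q' DS[of k]] this] show ?thesis
      by (simp add: ES_def)
  qed
  have QS: "Q 0 * S k 0 = L1 k * L2 k * (rGamma (1 - of_nat m + of_nat k) / fact k)" for k
    by (simp add: Q_def S_def reg2F1_coeff_def L1_def L2_def)
  have QS_low: "S k 0 = 0" if "k < m" for k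
  proof -
    have "1 - of_nat m + of_nat k = (- of_nat (m - 1 - k) :: complex)" using that by (simp add: of_nat_diff)
    hence "rGamma (1 - of_nat m + of_nat k :: complex) = 0" by (simp only: rGamma_eq_zero_iff minus_of_nat_in_nonpos_Ints)
    thus ?thesis by (simp add: S_def reg2F1_coeff_def)
  qed
  have ES_low: "ES k = - (L1 k * L2 k * ((-1) ^ (m - 1 - k) * fact (m - 1 - k)) / fact k)" if "k < m" for k
  proof -
    have *: "1 - of_nat m + of_nat k = (- of_nat (m - 1 - k) :: complex)" using that by (simp add: of_nat_diff)
    have "rGamma (- of_nat (m - 1 - k) :: complex) = 0" by (simp only: rGamma_eq_zero_iff minus_of_nat_in_nonpos_Ints)
    thus ?thesis unfolding ES * deriv_rGamma_minus_of_nat by simp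
  qed
  have high: "1 - of_nat m + of_nat (m + j) = (of_nat (j + 1) :: complex)" for j by simp
  have \<gamma>': "rGamma (of_nat (j + 1)) / fact (m + j) = \<gamma> j" for j
    using rGamma_of_nat_Suc[of j] by (simp add: \<gamma>_def add_ac)
  have QS_high: "\<eta> ^ m * (Q 0 * S (m + j) 0) = P * T j 0" for j
    unfolding QS high \<gamma>' PT \<alpha> \<beta> \<sigma> by (simp only: mult_ac)
  have d_eq: "P * DT j - \<eta> ^ m * ES (m + j) = d j" for j
  proof -
    have nz: "of_nat (j + 1) \<notin> (\<int>\<^sub>\<le>\<^sub>0 :: complex set)" by (rule Re_pos_notin_nonpos_Ints) simp
    have "deriv rGamma (of_nat (j + 1) :: complex) / fact (m + j) = - (rGamma (of_nat (j + 1)) / fact (m + j)) * Digamma (of_nat (j + 1))"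
      unfolding deriv_rGamma[OF nz] by simp
    hence E: "ES (m + j) = (dL1 (m + j) * L2 (m + j) + dL2 (m + j) * L1 (m + j)) * \<gamma> j + \<gamma> j * Digamma (of_nat (j + 1)) * (L1 (m + j) * L2 (m + j))"
      unfolding ES high \<gamma>' by simp
    have "\<eta> ^ m * ES (m + j) = (\<sigma>1 * dL1 (m + j)) * \<beta> j * \<gamma> j + \<alpha> j * (\<sigma>2 * dL2 (m + j)) * \<gamma> j + \<alpha> j * \<beta> j * \<gamma> j * Digamma (of_nat (j + 1))"
      unfolding E \<sigma> \<alpha> \<beta> by (simp add: algebra_simps)
    thus ?thesis
      unfolding PDT d F1(4)[symmetric] F2(4)[symmetric] by (simp add: algebra_simps)
  qed
  have \<eta>2: "\<eta> * \<eta> = 1" by (simp add: \<eta>_def)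
  have tx: "inverse (t ^ m) * x ^ m = \<eta> ^ m"
    using t by (simp add: x power_mult_distrib)
  have summES: "summable (\<lambda>k. ES k * x ^ k)"
  proof -
    have "summable (\<lambda>k. Q' * (S k 0 * x ^ k) + (DS k * x ^ k) * Q 0)"
      using summable_reg2F1[OF x(1)] sumS(1) unfolding S_def by (intro summable_add summable_mult summable_mult2)
    thus ?thesis by (simp add: ES_def algebra_simps)
  qed
  have summES': "summable (\<lambda>j. ES (m + j) * x ^ j)"
  proof (cases "x = 0")
    case False
    have "summable (\<lambda>j. ES (m + j) * x ^ (m + j))"
      using summES summable_iff_shift[of "\<lambda>k. ES k * x ^ k" m] by (simp add: add.commute)
    hence "summable (\<lambda>j. inverse (x ^ m) * (ES (m + j) * x ^ (m + j)))" by (rule summable_mult)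
    moreover have "(\<lambda>j. inverse (x ^ m) * (ES (m + j) * x ^ (m + j))) = (\<lambda>j. ES (m + j) * x ^ j)"
      using False by (intro ext) (simp add: power_add field_simps)
    ultimately show ?thesis by simp
  next
    case True
    have "(\<lambda>j. ES (m + j) * x ^ j) sums (\<Sum>j\<in>{0}. ES (m + j) * x ^ j)"
      by (rule sums_finite) (auto simp: True power_0_left)
    thus ?thesis by (rule sums_summable)
  qed
  have "summable (\<lambda>j. P * (DT j * x ^ j) - \<eta> ^ m * (ES (m + j) * x ^ j))"
    by (intro summable_diff summable_mult sumT(1) summES')
  moreover have dx: "P * (DT j * x ^ j) - \<eta> ^ m * (ES (m + j) * x ^ j) = d j * x ^ j" for j
    unfolding d_eq[symmetric] by (simp add: algebra_simps)
  ultimately show "summable (\<lambda>j. d j * x ^ j)" by simp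
  have sum_d: "(\<Sum>j. d j * x ^ j) = P * (\<Sum>j. DT j * x ^ j) - \<eta> ^ m * (\<Sum>j. ES (m + j) * x ^ j)"
  proof -
    have "(\<Sum>j. d j * x ^ j) = (\<Sum>j. P * (DT j * x ^ j) - \<eta> ^ m * (ES (m + j) * x ^ j))"
      by (simp only: dx)
    also have "\<dots> = (\<Sum>j. P * (DT j * x ^ j)) - (\<Sum>j. \<eta> ^ m * (ES (m + j) * x ^ j))"
      by (intro suminf_diff[symmetric] summable_mult sumT(1) summES')
    also have "\<dots> = P * (\<Sum>j. DT j * x ^ j) - \<eta> ^ m * (\<Sum>j. ES (m + j) * x ^ j)"
      by (simp only: suminf_mult[OF sumT(1)] suminf_mult[OF summES'])
    finally show ?thesis .
  qed
  define low where "low = (\<Sum>k<m. pochhammer (A - of_nat m) k * pochhammer (B - of_nat m) k * ((-1) ^ (m - 1 - k) * fact (m - 1 - k)) / fact k * x ^ k)"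
  have sum_ES: "(\<Sum>k. ES k * x ^ k) = - (Q 0 * low) + x ^ m * (\<Sum>j. ES (m + j) * x ^ j)"
  proof -
    have "(\<Sum>k. ES k * x ^ k) = (\<Sum>k<m. ES k * x ^ k) + (\<Sum>j. ES (m + j) * x ^ (m + j))"
      by (rule suminf_split_first[OF summES])
    also have "(\<Sum>k<m. ES k * x ^ k) = - (Q 0 * low)"
      unfolding low_def sum_distrib_left sum_negf[symmetric]
      by (intro sum.cong) (auto simp: ES_low Q_def L1_def L2_def)
    also have "(\<Sum>j. ES (m + j) * x ^ (m + j)) = (\<Sum>j. x ^ m * (ES (m + j) * x ^ j))"
      by (simp add: power_add mult_ac)
    also have "\<dots> = x ^ m * (\<Sum>j. ES (m + j) * x ^ j)" by (rule suminf_mult[OF summES'])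
    finally show ?thesis .
  qed
  have sum_QS: "inverse (t ^ m) * (Q 0 * reg2F1 (A - of_nat m) (B - of_nat m) (1 - of_nat m) x) = P * reg2F1 A B (of_nat m + 1) x"
  proof -
    have summ: "summable (\<lambda>k. Q 0 * (S k 0 * x ^ k))"
      unfolding S_def by (intro summable_mult summable_reg2F1 x(1))
    have "Q 0 * reg2F1 (A - of_nat m) (B - of_nat m) (1 - of_nat m) x = (\<Sum>k. Q 0 * (S k 0 * x ^ k))"
      unfolding reg2F1_def S_def using suminf_mult[OF summable_reg2F1[OF x(1)], of "Q 0" "A - of_nat m" "B - of_nat m" "1 - of_nat m"] by simp
    also have "\<dots> = (\<Sum>k<m. Q 0 * (S k 0 * x ^ k)) + (\<Sum>j. Q 0 * (S (m + j) 0 * x ^ (m + j)))"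
      by (rule suminf_split_first[OF summ])
    also have "(\<Sum>k<m. Q 0 * (S k 0 * x ^ k)) = 0" by (intro sum.neutral) (auto simp: QS_low)
    finally have 1: "Q 0 * reg2F1 (A - of_nat m) (B - of_nat m) (1 - of_nat m) x = (\<Sum>j. Q 0 * (S (m + j) 0 * x ^ (m + j)))" by simp
    have summ': "summable (\<lambda>j. Q 0 * (S (m + j) 0 * x ^ (m + j)))"
      using summ summable_iff_shift[of "\<lambda>k. Q 0 * (S k 0 * x ^ k)" m] by (simp add: add.commute)
    have "inverse (t ^ m) * (\<Sum>j. Q 0 * (S (m + j) 0 * x ^ (m + j))) = (\<Sum>j. inverse (t ^ m) * (Q 0 * (S (m + j) 0 * x ^ (m + j))))"
      by (rule suminf_mult[OF summ', symmetric])
    also have "(\<lambda>j. inverse (t ^ m) * (Q 0 * (S (m + j) 0 * x ^ (m + j)))) = (\<lambda>j. P * (T j 0 * x ^ j))"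
    proof
      fix j
      have "inverse (t ^ m) * (Q 0 * (S (m + j) 0 * x ^ (m + j))) = (inverse (t ^ m) * x ^ m) * (Q 0 * S (m + j) 0) * x ^ j"
        by (simp add: power_add mult_ac)
      also have "\<dots> = P * (T j 0 * x ^ j)"
        unfolding tx QS_high by (simp add: mult.assoc)
      finally show "inverse (t ^ m) * (Q 0 * (S (m + j) 0 * x ^ (m + j))) = P * (T j 0 * x ^ j)" .
    qed
    also have "(\<Sum>j. P * (T j 0 * x ^ j)) = P * reg2F1 A B (of_nat m + 1) x"
      unfolding reg2F1_def T_def using suminf_mult[OF summable_reg2F1[OF x(1)], of P A B "of_nat m + 1"] by simp
    finally show ?thesis unfolding 1 .
  qed
  have D1: "((\<lambda>\<epsilon>. P * reg2F1 (A + v1 * \<epsilon>) (B + v2 * \<epsilon>) (of_nat m + 1 + \<epsilon>) x) has_field_derivative P * (\<Sum>j. DT j * x ^ j)) (at 0)"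
    using DERIV_cmult[OF sumT(2), of P] by simp
  have Dt: "((\<lambda>\<epsilon>. t powr (- of_nat m - \<epsilon>)) has_field_derivative - (ln t * inverse (t ^ m))) (at 0)"
  proof -
    have "((\<lambda>\<epsilon>. exp ((- of_nat m - \<epsilon>) * ln t)) has_field_derivative - (ln t * exp ((- of_nat m) * ln t))) (at 0)"
      by (auto intro!: derivative_eq_intros)
    moreover have "exp ((- of_nat m) * ln t) = inverse (t ^ m)"
    proof -
      have "exp ((- of_nat m) * ln t) = t powr (- of_nat m)" using t by (simp add: powr_def)
      thus ?thesis using t by (simp add: powr_minus powr_of_nat')
    qed
    ultimately show ?thesis using t by (simp add: powr_def)
  qed
  let ?S = "\<lambda>\<epsilon>. reg2F1 (A - of_nat m + (v1 - 1) * \<epsilon>) (B - of_nat m + (v2 - 1) * \<epsilon>) (1 - of_nat m - \<epsilon>) x"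
  have D2: "(?S has_field_derivative (\<Sum>k. DS k * x ^ k)) (at 0)"
    using sumS(2) by simp
  have D3: "((\<lambda>\<epsilon>. Q \<epsilon> * ?S \<epsilon>) has_field_derivative (\<Sum>k. ES k * x ^ k)) (at 0)"
  proof -
    have "((\<lambda>\<epsilon>. Q \<epsilon> * ?S \<epsilon>) has_field_derivative Q' * ?S 0 + (\<Sum>k. DS k * x ^ k) * Q 0) (at 0)"
      by (rule DERIV_mult[OF Q' D2])
    moreover have "Q' * ?S 0 + (\<Sum>k. DS k * x ^ k) * Q 0 = (\<Sum>k. ES k * x ^ k)"
    proof -
      have s1: "(\<lambda>k. S k 0 * x ^ k) sums ?S 0" unfolding S_def using reg2F1_sums[OF x(1)] by simp
      have "(\<lambda>k. Q' * (S k 0 * x ^ k) + (DS k * x ^ k) * Q 0) sums (Q' * ?S 0 + (\<Sum>k. DS k * x ^ k) * Q 0)"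
        by (intro sums_add sums_mult sums_mult2 s1 summable_sums sumS(1))
      hence "(\<lambda>k. ES k * x ^ k) sums (Q' * ?S 0 + (\<Sum>k. DS k * x ^ k) * Q 0)"
        by (simp add: ES_def algebra_simps)
      thus ?thesis by (simp add: sums_iff)
    qed
    ultimately show ?thesis by simp
  qed
  have D4: "((\<lambda>\<epsilon>. t powr (- of_nat m - \<epsilon>) * (Q \<epsilon> * ?S \<epsilon>)) has_field_derivative
      - (ln t * inverse (t ^ m)) * (Q 0 * ?S 0) + (\<Sum>k. ES k * x ^ k) * t powr (- of_nat m - 0)) (at 0)"
    by (rule DERIV_mult[OF Dt D3])
  have t0: "t powr (- of_nat m - 0) = inverse (t ^ m)" using t by (simp add: powr_minus powr_of_nat')
  have val: "P * (\<Sum>j. DT j * x ^ j) - (- (ln t * inverse (t ^ m)) * (Q 0 * ?S 0) + (\<Sum>k. ES k * x ^ k) * t powr (- of_nat m - 0))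
      = (\<Sum>j. d j * x ^ j) + ln t * (P * reg2F1 A B (of_nat m + 1) x) + Q 0 * inverse (t ^ m) * low"
  proof -
    define Y where "Y = (\<Sum>j. ES (m + j) * x ^ j)"
    have Y: "\<eta> ^ m * Y = inverse (t ^ m) * (x ^ m * Y)"
      unfolding tx[symmetric] by simp
    show ?thesis
      unfolding t0 sum_d sum_ES sum_QS[symmetric] Y_def[symmetric] Y by (simp add: algebra_simps)
  qed
  have "((\<lambda>\<epsilon>. P * reg2F1 (A + v1 * \<epsilon>) (B + v2 * \<epsilon>) (of_nat m + 1 + \<epsilon>) x - t powr (- of_nat m - \<epsilon>) * (Q \<epsilon> * ?S \<epsilon>))
     has_field_derivative (\<Sum>j. d j * x ^ j) + ln t * (P * reg2F1 A B (of_nat m + 1) x) + Q 0 * inverse (t ^ m) * low) (at 0)"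
    unfolding val[symmetric] by (rule DERIV_diff[OF D1 D4])
  moreover have "(\<lambda>\<epsilon>. P * reg2F1 (A + v1 * \<epsilon>) (B + v2 * \<epsilon>) (of_nat m + 1 + \<epsilon>) x - t powr (- of_nat m - \<epsilon>) * (Q \<epsilon> * ?S \<epsilon>))
    = (\<lambda>\<epsilon>. rGamma (1 - e1) * rGamma (1 - e2) * reg2F1 (A + v1 * \<epsilon>) (B + v2 * \<epsilon>) (of_nat m + 1 + \<epsilon>) x
           - rGamma (of_nat m + 1 - e1 + \<epsilon>) * rGamma (of_nat m + 1 - e2 + \<epsilon>) * (t powr (- of_nat m - \<epsilon>) * ?S \<epsilon>))"
    by (simp add: P_def Q_def mult_ac)
  moreover have "Q 0 = rGamma (of_nat m + 1 - e1) * rGamma (of_nat m + 1 - e2)" by (simp add: Q_def)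
  ultimately show ?deriv
    unfolding P_def low_def by (simp only:)
qed

section \<open>The logarithmic expansion in its four forms\<close>

lemma reg2F1_affine_differentiable:
  assumes x: "norm x < 1"
  shows "(\<lambda>\<epsilon>. reg2F1 (a0 + a1 * \<epsilon>) (b0 + b1 * \<epsilon>) (c0 + c1 * \<epsilon>) x) field_differentiable (at 0)"
proof -
  have "(\<lambda>\<epsilon>. reg2F1_coeff (a0 + a1 * \<epsilon>) (b0 + b1 * \<epsilon>) (c0 + c1 * \<epsilon>) k) field_differentiable (at 0)" for k
    unfolding reg2F1_coeff_def pochhammer_prod
    by (rule holomorphic_on_imp_differentiable_at[of _ UNIV]) (auto intro!: holomorphic_intros)
  from reg2F1_affine_parameters(2)[OF x field_differentiable_derivI[OF this]] show ?thesis
    by (auto simp: field_differentiable_def)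
qed

lemma eventually_not_Ints_at_0: "eventually (\<lambda>\<epsilon>::complex. \<epsilon> \<notin> \<int>) (at 0)"
proof -
  have "eventually (\<lambda>\<epsilon>::complex. \<epsilon> \<in> ball 0 1) (at 0)"
    by (intro eventually_at_in_open') auto
  moreover have "eventually (\<lambda>\<epsilon>::complex. \<epsilon> \<noteq> 0) (at 0)" by (rule eventually_neq_at_within)
  ultimately show ?thesis
  proof eventually_elim
    case (elim \<epsilon>)
    show ?case
    proof
      assume "\<epsilon> \<in> \<int>"
      then obtain k where k: "\<epsilon> = of_int k" by (auto elim: Ints_cases)
      have "norm (of_int k :: complex) < 1" using elim k by simp
      hence "k = 0" by (simp only: norm_of_int flip: of_int_abs)
      thus False using elim k by simp
    qed
  qed
qed

text \<open>
  Both sides of the connection formula for \<open>c = m + 1 + \<epsilon>\<close> vanish at \<open>\<epsilon> = 0\<close>, so that their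
  derivatives can be compared there. On one side the sine has derivative \<open>\<plusminus>\<pi>\<close>, on the other side
  \<open>E\<close> contributes only its value. The formula itself holds for noninteger \<open>\<epsilon>\<close> only; continuity
  supplies it at \<open>\<epsilon> = 0\<close>.
\<close>
lemma connection_log_limit:
  fixes g E :: "complex \<Rightarrow> complex"
  assumes a: "a \<notin> \<int>" and z: "z \<in> upper_half_plane" "norm z < 1" "norm (1 - z) < 1"
    and g: "(g has_field_derivative D) (at 0)" and E: "(E has_field_derivative E') (at 0)" "E 0 \<noteq> 0"
    and eq: "\<And>\<epsilon>. \<epsilon> \<notin> \<int> \<Longrightarrow>
        rGamma (1 - a) * rGamma (of_nat n + 1) * reg2F1 (of_nat m + 1 - a + \<epsilon>) (of_nat m + 1 + of_nat n + \<epsilon>) (of_nat m + 1 + \<epsilon>) z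
        - rGamma (of_nat m + 1 - a + \<epsilon>) * rGamma (of_nat m + 1 + of_nat n + \<epsilon>) *
          (z powr (- of_nat m - \<epsilon>) * reg2F1 (1 - a) (of_nat n + 1) (1 - of_nat m - \<epsilon>) z) = E \<epsilon> * g \<epsilon>"
  shows "U2 n m a z = fact m * fact n * Gamma (1 - a) * ((1 - z) powr (of_nat m + of_nat n + 1 - a) * (E 0 * D))"
proof -
  define \<Phi> where "\<Phi> \<epsilon> = reg2F1 (of_nat m + 1 - a + \<epsilon>) (of_nat m + of_nat n + 1 + \<epsilon>) (of_nat m + of_nat n + 2 - a + \<epsilon>) (1 - z)" for \<epsilon>
  have "\<Phi> field_differentiable (at 0)"
    using reg2F1_affine_differentiable[OF z(3), of "of_nat m + 1 - a" 1 "of_nat m + of_nat n + 1" 1 "of_nat m + of_nat n + 2 - a" 1]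
    by (simp add: \<Phi>_def [abs_def])
  then obtain \<Phi>' where \<Phi>': "(\<Phi> has_field_derivative \<Phi>') (at 0)" by (auto simp: field_differentiable_def)
  define h where "h \<epsilon> = - ((-1) ^ m * sin (of_real pi * \<epsilon>) / of_real pi) * \<Phi> \<epsilon>" for \<epsilon> :: complex
  have dh: "(h has_field_derivative - ((-1) ^ m * \<Phi> 0)) (at 0)"
  proof -
    have "((\<lambda>\<epsilon>::complex. - ((-1) ^ m * sin (of_real pi * \<epsilon>) / of_real pi)) has_field_derivative - ((-1) ^ m)) (at 0)"
      by (auto intro!: derivative_eq_intros)
    from DERIV_mult[OF this \<Phi>'] show ?thesis
      by (simp add: h_def [abs_def])
  qed
  have "eventually (\<lambda>\<epsilon>. \<epsilon> \<in> - {\<epsilon>. a - \<epsilon> \<in> \<int>}) (at 0)"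
  proof (rule eventually_at_in_open')
    have "closed ((\<lambda>\<epsilon>. a - \<epsilon>) -` \<int>)" by (intro closed_vimage closed_Ints continuous_intros)
    thus "open (- {\<epsilon>. a - \<epsilon> \<in> \<int>})" by (simp add: vimage_def open_Compl)
  qed (use a in auto)
  hence ev: "eventually (\<lambda>\<epsilon>. h \<epsilon> = E \<epsilon> * g \<epsilon>) (at 0)"
    using eventually_not_Ints_at_0
  proof eventually_elim
    case (elim \<epsilon>)
    define s where "s = - of_nat m - \<epsilon>"
    have s: "s \<notin> \<int>"
      using of_int_not_Ints_shift(3)[OF elim(2), of "- int m"] by (simp add: s_def)
    have p: "of_nat m + 1 - a + \<epsilon> + (of_nat m + 1 + of_nat n + \<epsilon>) + s = of_nat m + of_nat n + 2 - a + \<epsilon>"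
      "1 - s = of_nat m + 1 + \<epsilon>" "of_nat m + 1 - a + \<epsilon> + s = 1 - a" "of_nat m + 1 + of_nat n + \<epsilon> + s = of_nat n + 1"
      "1 + s = 1 - of_nat m - \<epsilon>"
      by (simp_all add: s_def)
    have "a - \<epsilon> \<notin> \<int>" using elim(1) by simp
    hence C: "of_nat m + of_nat n + 2 - a + \<epsilon> \<notin> \<int>\<^sub>\<le>\<^sub>0"
      using not_nonpos_Ints_shift(1)[of "a - \<epsilon>" "m + n + 2"] by (simp add: algebra_simps)
    have sins: "sin (of_real pi * s) = - ((-1) ^ m * sin (of_real pi * \<epsilon>))"
    proof -
      have "s = - \<epsilon> - of_nat m" by (simp add: s_def)
      thus ?thesis using sin_pi_diff_nat[of "- \<epsilon>" m] by simp
    qed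
    have "sin (of_real pi * s) / of_real pi * reg2F1 (of_nat m + 1 - a + \<epsilon>) (of_nat m + 1 + of_nat n + \<epsilon>) (of_nat m + of_nat n + 2 - a + \<epsilon>) (1 - z) =
      rGamma (1 - a) * rGamma (of_nat n + 1) * reg2F1 (of_nat m + 1 - a + \<epsilon>) (of_nat m + 1 + of_nat n + \<epsilon>) (of_nat m + 1 + \<epsilon>) z
        - rGamma (of_nat m + 1 - a + \<epsilon>) * rGamma (of_nat m + 1 + of_nat n + \<epsilon>) *
          (z powr s * reg2F1 (1 - a) (of_nat n + 1) (1 - of_nat m - \<epsilon>) z)"
      using reg2F1_connection[OF s, of "of_nat m + 1 - a + \<epsilon>" "of_nat m + 1 + of_nat n + \<epsilon>" z, unfolded p, OF C z(2,3)] .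
    also have "\<dots> = E \<epsilon> * g \<epsilon>"
      unfolding s_def by (rule eq[OF elim(2)])
    also have "sin (of_real pi * s) / of_real pi * reg2F1 (of_nat m + 1 - a + \<epsilon>) (of_nat m + 1 + of_nat n + \<epsilon>) (of_nat m + of_nat n + 2 - a + \<epsilon>) (1 - z) = h \<epsilon>"
      unfolding sins h_def \<Phi>_def by (simp add: add_ac)
    finally show ?case .
  qed
  have dEg: "((\<lambda>\<epsilon>. E \<epsilon> * g \<epsilon>) has_field_derivative E' * g 0 + D * E 0) (at 0)"
    by (rule DERIV_mult[OF E(1) g])
  have h0: "h 0 = E 0 * g 0"
  proof (rule tendsto_unique[of "at (0::complex)"])
    show "(h \<longlongrightarrow> h 0) (at 0)" using DERIV_isCont[OF dh] by (simp add: isCont_def)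
    have "((\<lambda>\<epsilon>. E \<epsilon> * g \<epsilon>) \<longlongrightarrow> E 0 * g 0) (at 0)" using DERIV_isCont[OF dEg] by (simp add: isCont_def)
    thus "(h \<longlongrightarrow> E 0 * g 0) (at 0)" using ev by (subst tendsto_cong)
  qed auto
  hence g0: "g 0 = 0" using E(2) by (simp add: h_def)
  have "eventually (\<lambda>\<epsilon>. h \<epsilon> = E \<epsilon> * g \<epsilon>) (nhds 0)"
    using ev h0 by (simp add: eventually_nhds_conv_at)
  with dh have "((\<lambda>\<epsilon>. E \<epsilon> * g \<epsilon>) has_field_derivative - ((-1) ^ m * \<Phi> 0)) (at 0)"
    by (subst (asm) DERIV_cong_ev[OF refl _ refl])
  from DERIV_unique[OF this dEg] have key: "- ((-1) ^ m * \<Phi> 0) = E 0 * D" by (simp add: g0 mult.commute)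
  have "U2 n m a z = fact m * fact n * Gamma (1 - a) * ((1 - z) powr (of_nat m + of_nat n + 1 - a) * (- ((-1) ^ m * \<Phi> 0)))"
    unfolding U2_eq_reg2F1[OF a z(1,3)] \<Phi>_def by simp
  thus ?thesis unfolding key .
qed

lemma powr_affine_has_field_derivative:
  assumes "w \<noteq> (0::complex)"
  shows "((\<lambda>\<epsilon>. w powr (p + q * \<epsilon>)) has_field_derivative q * ln w * w powr p) (at 0)"
proof -
  have "((\<lambda>\<epsilon>. exp ((p + q * \<epsilon>) * ln w)) has_field_derivative q * ln w * exp (p * ln w)) (at 0)"
    by (auto intro!: derivative_eq_intros)
  thus ?thesis using assms by (simp add: powr_def)
qed

text \<open>
  The power of \<open>1 - z\<close> that the chosen transformation leaves in front of the series at \<open>\<epsilon> = 0\<close>.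
  The pairs \<open>True, True\<close> and \<open>False, False\<close> belong to series in \<open>z\<close>, the mixed pairs to series in
  \<open>z / (z - 1)\<close>.
\<close>
definition log_prefactor :: "bool \<Rightarrow> bool \<Rightarrow> complex \<Rightarrow> nat \<Rightarrow> nat \<Rightarrow> complex \<Rightarrow> complex" where
  "log_prefactor i1 i2 a n m z =
     (if i1 then if i2 then (1 - z) powr (of_nat (m + n + 1) - a) else (1 - z) ^ n
      else if i2 then (1 - z) powr (- a) else 1)"

definition log_var :: "bool \<Rightarrow> bool \<Rightarrow> complex \<Rightarrow> complex" where
  "log_var i1 i2 z = (if i1 = i2 then z else z / (1 - z))"

definition ser_var :: "bool \<Rightarrow> bool \<Rightarrow> complex \<Rightarrow> complex" where
  "ser_var i1 i2 z = (if i1 = i2 then z else z / (z - 1))"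

lemma ser_var_eq: "ser_var i1 i2 z = (if i1 = i2 then 1 else -1) * log_var i1 i2 z"
  by (simp add: ser_var_def log_var_def) (metis minus_diff_eq minus_divide_right)

lemma log_var_powr:
  assumes "z \<in> upper_half_plane"
  shows "(z / (1 - z)) powr s = z powr s * (1 - z) powr (- s)"
proof -
  note zD = upper_half_planeD[OF assms]
  have "(z / (1 - z)) powr s = exp (s * (Ln z - Ln (1 - z)))"
    using zD(7,8) Ln_branches_upper_half_plane(4)[OF assms] by (simp add: powr_def)
  thus ?thesis using zD(7,8) by (simp add: powr_def exp_add[symmetric] algebra_simps)
qed

text \<open>
  The common source of the four logarithmic forms. The connection formula, with \<open>c - a\<close> and
  \<open>c + n\<close> as numerator parameters, is the case of two flags \<open>True\<close>; Euler's transformation clears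
  both flags and Pfaff's transformation clears one. Both solutions acquire the same power \<open>E \<epsilon>\<close>
  of \<open>1 - z\<close>, once \<open>z\<^sup>1\<^sup>-\<^sup>c\<close> is rewritten as a power of \<open>t\<close>.
\<close>
lemma U2_log_expansion:
  fixes n m :: nat and a z :: complex and i1 i2 :: bool
  defines "x \<equiv> ser_var i1 i2 z" and "t \<equiv> log_var i1 i2 z" and "W \<equiv> log_prefactor i1 i2 a n m z"
    and "A \<equiv> upper_param i1 a m" and "B \<equiv> upper_param i2 (- of_nat n) m"
  assumes a: "a \<notin> \<int>" and z: "z \<in> upper_half_plane" "norm z < 1" "norm (1 - z) < 1" "norm x < 1"
  shows "U2 n m a z = hyp2F1 (- of_nat n) a (of_nat m + 1) z * ln t
     + fact m * fact n * Gamma (1 - a) * W * (\<Sum>j. log_coeff i1 i2 a (- of_nat n) m j * x ^ j)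
     + fact m * fact n / (pochhammer (1 - a) m * fact (m + n)) * W * inverse (t ^ m) *
       (\<Sum>k<m. pochhammer (A - of_nat m) k * pochhammer (B - of_nat m) k * ((-1) ^ (m - 1 - k) * fact (m - 1 - k)) / fact k * x ^ k)"
    (is ?expansion)
    and "summable (\<lambda>j. log_coeff i1 i2 a (- of_nat n) m j * x ^ j)"
    and "fact m * W * reg2F1 A B (of_nat m + 1) x = hyp2F1 (- of_nat n) a (of_nat m + 1) z"
proof -
  note zD = upper_half_planeD[OF z(1)]
  define v1 v2 :: complex where "v1 = of_bool i1" and "v2 = of_bool i2"
  have t0: "t \<noteq> 0" using zD by (simp add: t_def log_var_def)
  have xt: "x = (if i1 = i2 then 1 else -1) * t" unfolding x_def t_def by (rule ser_var_eq)
  have ReX: "Re z < 1 / 2" if "i1 \<noteq> i2"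
    using z(4) that norm_pfaff_less_1_iff[OF zD(9)] by (simp add: x_def ser_var_def)
  have mna: "of_nat m + 1 - a \<notin> \<int>\<^sub>\<le>\<^sub>0" using not_nonpos_Ints_shift(1)[OF a, of "m + 1"] by (simp add: add.commute)
  have mnn: "of_nat m + 1 - (- of_nat n) \<notin> (\<int>\<^sub>\<le>\<^sub>0 :: complex set)" by (rule Re_pos_notin_nonpos_Ints) simp
  have a1: "1 - a \<notin> \<int>\<^sub>\<le>\<^sub>0" using not_nonpos_Ints_shift(4)[OF a] .
  define P where "P = rGamma (1 - a) * rGamma (1 - (- of_nat n) :: complex)"
  define Q where "Q = rGamma (of_nat m + 1 - a) * rGamma (of_nat m + 1 - (- of_nat n) :: complex)"
  define low where "low = (\<Sum>k<m. pochhammer (A - of_nat m) k * pochhammer (B - of_nat m) k * ((-1) ^ (m - 1 - k) * fact (m - 1 - k)) / fact k * x ^ k)"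
  define g where "g \<epsilon> = P * reg2F1 (A + v1 * \<epsilon>) (B + v2 * \<epsilon>) (of_nat m + 1 + \<epsilon>) x
           - rGamma (of_nat m + 1 - a + \<epsilon>) * rGamma (of_nat m + 1 - (- of_nat n) + \<epsilon>) * (t powr (- of_nat m - \<epsilon>) *
              reg2F1 (A - of_nat m + (v1 - 1) * \<epsilon>) (B - of_nat m + (v2 - 1) * \<epsilon>) (1 - of_nat m - \<epsilon>) x)" for \<epsilon>
  define D where "D = (\<Sum>j. log_coeff i1 i2 a (- of_nat n) m j * x ^ j)
          + ln t * (P * reg2F1 A B (of_nat m + 1) x) + Q * inverse (t ^ m) * low"
  note lim = log_limit[OF mna mnn z(4) xt t0, folded A_def B_def v1_def v2_def]
  show "summable (\<lambda>j. log_coeff i1 i2 a (- of_nat n) m j * x ^ j)" by (rule lim(1))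
  have dg: "(g has_field_derivative D) (at 0)"
    using lim(2) unfolding g_def [abs_def] D_def P_def Q_def low_def by simp
  \<comment> \<open>\<open>E \<epsilon>\<close> is the product of the powers split off by the transformations; its exponents are, for the
     flags in turn, \<open>0\<close>, \<open>a - c\<close>, \<open>- c - n\<close> and \<open>a - n - c\<close>\<close>
  define p q where "p = (if i1 then if i2 then 0 else - (of_nat m + 1 - a) else if i2 then - (of_nat m + 1 + of_nat n) else a - of_nat n - of_nat m - 1)"
    and "q = (if i1 \<and> i2 then 0 else -1 :: complex)"
  define E where "E \<epsilon> = (1 - z) powr (p + q * \<epsilon>)" for \<epsilon>
  have dE: "(E has_field_derivative q * ln (1 - z) * (1 - z) powr p) (at 0)"
    unfolding E_def by (rule powr_affine_has_field_derivative[OF zD(8)])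
  have eq: "rGamma (1 - a) * rGamma (of_nat n + 1) * reg2F1 (of_nat m + 1 - a + \<epsilon>) (of_nat m + 1 + of_nat n + \<epsilon>) (of_nat m + 1 + \<epsilon>) z
        - rGamma (of_nat m + 1 - a + \<epsilon>) * rGamma (of_nat m + 1 + of_nat n + \<epsilon>) *
          (z powr (- of_nat m - \<epsilon>) * reg2F1 (1 - a) (of_nat n + 1) (1 - of_nat m - \<epsilon>) z) = E \<epsilon> * g \<epsilon>" if e: "\<epsilon> \<notin> \<int>" for \<epsilon>
  proof -
    define c where "c = of_nat m + 1 + \<epsilon>"
    define c' where "c' = 1 - of_nat m - \<epsilon>"
    have c: "c \<notin> \<int>\<^sub>\<le>\<^sub>0" using not_nonpos_Ints_shift(3)[OF e, of "m + 1"] by (simp add: c_def add_ac)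
    have c': "c' \<notin> \<int>\<^sub>\<le>\<^sub>0"
      using of_int_not_Ints_shift(3)[OF e, of "1 - int m"] not_Ints_imp_not_nonpos_Ints[of c'] by (simp add: c'_def)
    have 1: "E \<epsilon> * reg2F1 (A + v1 * \<epsilon>) (B + v2 * \<epsilon>) c x = reg2F1 (of_nat m + 1 - a + \<epsilon>) (of_nat m + 1 + of_nat n + \<epsilon>) c z"
    proof -
      consider "i1" "i2" | "i1" "\<not> i2" | "\<not> i1" "i2" | "\<not> i1" "\<not> i2" by blast
      thus ?thesis
      proof cases
        case 1
        thus ?thesis using zD by (simp add: E_def p_def q_def A_def B_def v1_def v2_def upper_param_def x_def ser_var_def)
      next
        case 2
        have r: "c - (of_nat m + 1 + of_nat n + \<epsilon>) = - of_nat n" by (simp add: c_def)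
        have "- (of_nat m + 1 - a + \<epsilon>) = p + q * \<epsilon>" using 2 by (simp add: p_def q_def)
        thus ?thesis
          using 2 reg2F1_pfaff[OF c z(2) ReX, of "of_nat m + 1 - a + \<epsilon>" "of_nat m + 1 + of_nat n + \<epsilon>"] unfolding r
          by (simp add: E_def A_def B_def v1_def v2_def upper_param_def x_def ser_var_def)
      next
        case 3
        have r: "c - (of_nat m + 1 - a + \<epsilon>) = a" by (simp add: c_def)
        have "- (of_nat m + 1 + of_nat n + \<epsilon>) = p + q * \<epsilon>" using 3 by (simp add: p_def q_def)
        thus ?thesis
          using 3 reg2F1_pfaff[OF c z(2) ReX, of "of_nat m + 1 + of_nat n + \<epsilon>" "of_nat m + 1 - a + \<epsilon>"] unfolding r
          by (simp add: E_def A_def B_def v1_def v2_def upper_param_def x_def ser_var_def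
              reg2F1_commute[of a] reg2F1_commute[of "of_nat m + 1 - a + \<epsilon>"])
      next
        case 4
        have r: "c - (of_nat m + 1 - a + \<epsilon>) = a" "c - (of_nat m + 1 + of_nat n + \<epsilon>) = - of_nat n" by (simp_all add: c_def)
        have "a - (of_nat m + 1 + of_nat n + \<epsilon>) = p + q * \<epsilon>" using 4 by (simp add: p_def q_def)
        thus ?thesis
          using 4 reg2F1_euler[OF c z(2), of "of_nat m + 1 - a + \<epsilon>" "of_nat m + 1 + of_nat n + \<epsilon>"] unfolding r
          by (simp add: E_def A_def B_def v1_def v2_def upper_param_def x_def ser_var_def)
      qed
    qed
    have 2: "E \<epsilon> * (t powr (- of_nat m - \<epsilon>) * reg2F1 (A - of_nat m + (v1 - 1) * \<epsilon>) (B - of_nat m + (v2 - 1) * \<epsilon>) c' x)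
        = z powr (- of_nat m - \<epsilon>) * reg2F1 (1 - a) (of_nat n + 1) c' z"
    proof -
      consider "i1" "i2" | "i1" "\<not> i2" | "\<not> i1" "i2" | "\<not> i1" "\<not> i2" by blast
      thus ?thesis
      proof cases
        case 1
        thus ?thesis using zD by (simp add: E_def p_def q_def A_def B_def v1_def v2_def upper_param_def x_def ser_var_def t_def log_var_def add.commute)
      next
        case 2
        have r: "c' - (of_nat n + 1) = - of_nat n - of_nat m - \<epsilon>" by (simp add: c'_def)
        have "E \<epsilon> * t powr (- of_nat m - \<epsilon>) = z powr (- of_nat m - \<epsilon>) * (1 - z) powr (- (1 - a))"
        proof -
          have "p + q * \<epsilon> + - (- of_nat m - \<epsilon>) = - (1 - a)" using 2 by (simp add: p_def q_def)
          hence "(1 - z) powr (p + q * \<epsilon>) * (1 - z) powr (- (- of_nat m - \<epsilon>)) = (1 - z) powr (- (1 - a))"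
            by (simp only: powr_add[symmetric])
          thus ?thesis using 2 log_var_powr[OF z(1), of "- of_nat m - \<epsilon>"] by (simp add: E_def t_def log_var_def mult_ac)
        qed
        moreover have "reg2F1 (1 - a) (of_nat n + 1) c' z = (1 - z) powr (- (1 - a)) * reg2F1 (1 - a) (- of_nat n - of_nat m - \<epsilon>) c' x"
          using 2 reg2F1_pfaff[OF c' z(2) ReX, of "1 - a" "of_nat n + 1"] unfolding r by (simp add: x_def ser_var_def)
        moreover have "A - of_nat m + (v1 - 1) * \<epsilon> = 1 - a" "B - of_nat m + (v2 - 1) * \<epsilon> = - of_nat n - of_nat m - \<epsilon>"
          using 2 by (simp_all add: A_def B_def v1_def v2_def upper_param_def)
        ultimately show ?thesis by (simp only: mult.assoc[symmetric])
      next
        case 3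
        have r: "c' - (1 - a) = a - of_nat m - \<epsilon>" by (simp add: c'_def)
        have "E \<epsilon> * t powr (- of_nat m - \<epsilon>) = z powr (- of_nat m - \<epsilon>) * (1 - z) powr (- (of_nat n + 1))"
        proof -
          have "p + q * \<epsilon> + - (- of_nat m - \<epsilon>) = - (of_nat n + 1)" using 3 by (simp add: p_def q_def)
          hence "(1 - z) powr (p + q * \<epsilon>) * (1 - z) powr (- (- of_nat m - \<epsilon>)) = (1 - z) powr (- (of_nat n + 1))"
            by (simp only: powr_add[symmetric])
          thus ?thesis using 3 log_var_powr[OF z(1), of "- of_nat m - \<epsilon>"] by (simp add: E_def t_def log_var_def mult_ac)
        qed
        moreover have "reg2F1 (1 - a) (of_nat n + 1) c' z = (1 - z) powr (- (of_nat n + 1)) * reg2F1 (a - of_nat m - \<epsilon>) (of_nat n + 1) c' x"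
          using 3 reg2F1_pfaff[OF c' z(2) ReX, of "of_nat n + 1" "1 - a"] unfolding r
          by (simp add: x_def ser_var_def reg2F1_commute[of "of_nat n + 1"])
        moreover have "A - of_nat m + (v1 - 1) * \<epsilon> = a - of_nat m - \<epsilon>" "B - of_nat m + (v2 - 1) * \<epsilon> = of_nat n + 1"
          using 3 by (simp_all add: A_def B_def v1_def v2_def upper_param_def)
        ultimately show ?thesis by (simp only: mult.assoc[symmetric])
      next
        case 4
        have r: "c' - (1 - a) = a - of_nat m - \<epsilon>" "c' - (of_nat n + 1) = - of_nat n - of_nat m - \<epsilon>"
          by (simp_all add: c'_def)
        have "a - of_nat m - \<epsilon> - (of_nat n + 1) = p + q * \<epsilon>" using 4 by (simp add: p_def q_def)
        hence "reg2F1 (1 - a) (of_nat n + 1) c' z = E \<epsilon> * reg2F1 (a - of_nat m - \<epsilon>) (- of_nat n - of_nat m - \<epsilon>) c' z"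
          using reg2F1_euler[OF c' z(2), of "1 - a" "of_nat n + 1"] unfolding r by (simp only: E_def)
        moreover have "A - of_nat m + (v1 - 1) * \<epsilon> = a - of_nat m - \<epsilon>" "B - of_nat m + (v2 - 1) * \<epsilon> = - of_nat n - of_nat m - \<epsilon>"
          using 4 by (simp_all add: A_def B_def v1_def v2_def upper_param_def)
        moreover have "x = z" "t = z" using 4 by (simp_all add: x_def t_def ser_var_def log_var_def)
        ultimately show ?thesis by (simp only: mult_ac)
      qed
    qed
    have "E \<epsilon> * g \<epsilon> = P * (E \<epsilon> * reg2F1 (A + v1 * \<epsilon>) (B + v2 * \<epsilon>) c x)
       - rGamma (of_nat m + 1 - a + \<epsilon>) * rGamma (of_nat m + 1 - (- of_nat n) + \<epsilon>) *
          (E \<epsilon> * (t powr (- of_nat m - \<epsilon>) * reg2F1 (A - of_nat m + (v1 - 1) * \<epsilon>) (B - of_nat m + (v2 - 1) * \<epsilon>) c' x))"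
      unfolding g_def c_def c'_def by (simp only: right_diff_distrib mult_ac)
    thus ?thesis
      unfolding 1 2 by (simp add: P_def c_def c'_def add.commute)
  qed
  have WE: "(1 - z) powr (of_nat m + of_nat n + 1 - a) * E 0 = W"
  proof -
    have "(1 - z) powr (of_nat m + of_nat n + 1 - a) * E 0 = (1 - z) powr (of_nat m + of_nat n + 1 - a + p)"
      by (simp add: E_def powr_add)
    moreover have "of_nat m + of_nat n + 1 - a + p = (if i1 then if i2 then of_nat (m + n + 1) - a else of_nat n else if i2 then - a else 0)"
      by (simp add: p_def)
    ultimately show ?thesis
      using zD(8) by (simp add: W_def log_prefactor_def powr_of_nat')
  qed
  have U: "U2 n m a z = fact m * fact n * Gamma (1 - a) * (W * D)"
    using connection_log_limit[OF a z(1-3) dg dE _ eq] zD(8)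
    unfolding WE[symmetric] by (simp add: E_def mult.assoc)
  show F: "fact m * W * reg2F1 A B (of_nat m + 1) x = hyp2F1 (- of_nat n) a (of_nat m + 1) z"
  proof -
    have m1: "of_nat m + 1 \<notin> (\<int>\<^sub>\<le>\<^sub>0 :: complex set)"
      by (rule Re_pos_notin_nonpos_Ints) simp
    have "W * reg2F1 A B (of_nat m + 1) x = reg2F1 (- of_nat n) a (of_nat m + 1) z"
    proof -
      consider "i1" "i2" | "i1" "\<not> i2" | "\<not> i1" "i2" | "\<not> i1" "\<not> i2" by blast
      thus ?thesis
      proof cases
        case 1
        have r: "of_nat m + 1 - a - - of_nat n = of_nat (m + n + 1) - a" by simp
        show ?thesis
          using 1 reg2F1_euler[OF m1 z(2), of a "- of_nat n"] unfolding r
          by (simp add: W_def log_prefactor_def A_def B_def upper_param_def x_def ser_var_def reg2F1_commute[of "- of_nat n"])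
      next
        case 2
        show ?thesis
          using 2 reg2F1_pfaff[OF m1 z(2) ReX, of "- of_nat n" a] zD(8)
          by (simp add: W_def log_prefactor_def A_def B_def upper_param_def x_def ser_var_def reg2F1_commute[of "- of_nat n" "of_nat m + 1 - a"] powr_of_nat')
      next
        case 3
        show ?thesis
          using 3 reg2F1_pfaff[OF m1 z(2) ReX, of a "- of_nat n"]
          by (simp add: W_def log_prefactor_def A_def B_def upper_param_def x_def ser_var_def reg2F1_commute[of "- of_nat n"])
      next
        case 4
        thus ?thesis
          by (simp add: W_def log_prefactor_def A_def B_def upper_param_def x_def ser_var_def reg2F1_commute[of "- of_nat n"])
      qed
    qed
    thus ?thesis unfolding hyp2F1_terminating[OF zD(1)] by (simp add: mult.assoc)
  qed
  have rG: "rGamma (1 - (- of_nat n)) = 1 / (fact n :: complex)" "rGamma (of_nat m + 1 - (- of_nat n)) = 1 / (fact (m + n) :: complex)"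
    using rGamma_of_nat_Suc[of n] rGamma_of_nat_Suc[of "m + n"] by (simp_all add: add_ac)
  have G1: "Gamma (1 - a) * rGamma (1 - a) = 1"
    using a1 by (simp add: Gamma_def rGamma_eq_zero_iff)
  have Gm: "Gamma (1 - a) * rGamma (of_nat m + 1 - a) = 1 / pochhammer (1 - a) m"
    using pochhammer_eq_Gamma_rGamma[OF a1, of m] by (simp add: algebra_simps)
  have e1: "fact m * fact n * Gamma (1 - a) * (W * (ln t * (P * reg2F1 A B (of_nat m + 1) x))) =
      (Gamma (1 - a) * rGamma (1 - a)) * (fact n * (1 / fact n)) * (fact m * W * reg2F1 A B (of_nat m + 1) x * ln t)"
    unfolding P_def rG by (simp only: mult_ac)
  have e2: "fact m * fact n * Gamma (1 - a) * (W * (Q * inverse (t ^ m) * low)) =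
      fact m * fact n * (Gamma (1 - a) * rGamma (of_nat m + 1 - a)) * (1 / fact (m + n)) * W * inverse (t ^ m) * low"
    unfolding Q_def rG by (simp only: mult_ac)
  have "U2 n m a z = fact m * fact n * Gamma (1 - a) * (W * (\<Sum>j. log_coeff i1 i2 a (- of_nat n) m j * x ^ j))
     + fact m * fact n * Gamma (1 - a) * (W * (ln t * (P * reg2F1 A B (of_nat m + 1) x)))
     + fact m * fact n * Gamma (1 - a) * (W * (Q * inverse (t ^ m) * low))"
    unfolding U D_def by (simp only: distrib_left)
  also have "\<dots> = hyp2F1 (- of_nat n) a (of_nat m + 1) z * ln t
     + fact m * fact n * Gamma (1 - a) * W * (\<Sum>j. log_coeff i1 i2 a (- of_nat n) m j * x ^ j)
     + fact m * fact n / (pochhammer (1 - a) m * fact (m + n)) * W * inverse (t ^ m) * low"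
    unfolding e1 e2 G1 Gm F by (simp add: mult.assoc)
  finally show ?expansion
    unfolding low_def .
qed

section \<open>Coefficients of the logarithmic series\<close>

text \<open>
  The logarithmic derivative of Euler's reflection formula.
\<close>
lemma Digamma_reflection:
  assumes y: "(y::complex) \<notin> \<int>"
  shows "Digamma (1 - y) = Digamma y + of_real pi / tan (of_real pi * y)"
proof -
  have y': "y \<notin> \<int>\<^sub>\<le>\<^sub>0" "1 - y \<notin> \<int>\<^sub>\<le>\<^sub>0"
    using y not_Ints_imp_not_nonpos_Ints not_nonpos_Ints_shift(4) by auto
  have "(rGamma has_field_derivative - rGamma (1 - y) * Digamma (1 - y)) (at (1 - y))"
    by (rule has_field_derivative_rGamma_no_nonpos_int[OF y'(2)])
  moreover have "((\<lambda>y::complex. 1 - y) has_field_derivative -1) (at y)"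
    by (auto intro!: derivative_eq_intros)
  ultimately have d2: "((\<lambda>y. rGamma (1 - y)) has_field_derivative - rGamma (1 - y) * Digamma (1 - y) * -1) (at y)"
    by (rule DERIV_chain2)
  have "((\<lambda>y. rGamma y * rGamma (1 - y)) has_field_derivative
      - rGamma y * Digamma y * rGamma (1 - y) + - rGamma (1 - y) * Digamma (1 - y) * -1 * rGamma y) (at y)"
    by (rule DERIV_mult[OF has_field_derivative_rGamma_no_nonpos_int[OF y'(1)] d2])
  moreover have "((\<lambda>y. rGamma y * rGamma (1 - y)) has_field_derivative cos (of_real pi * y)) (at y)"
    unfolding rGamma_reflection_complex by (auto intro!: derivative_eq_intros)
  ultimately have "- rGamma y * Digamma y * rGamma (1 - y) + - rGamma (1 - y) * Digamma (1 - y) * -1 * rGamma y = cos (of_real pi * y)"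
    by (rule DERIV_unique)
  hence "(rGamma y * rGamma (1 - y)) * (Digamma (1 - y) - Digamma y) = cos (of_real pi * y)"
    by (simp add: algebra_simps)
  hence "sin (of_real pi * y) * (Digamma (1 - y) - Digamma y) = of_real pi * cos (of_real pi * y)"
    unfolding rGamma_reflection_complex by (simp add: field_simps)
  moreover have "sin (of_real pi * y) \<noteq> 0" using y by (simp add: sin_pi_eq_0_iff)
  ultimately show ?thesis by (simp add: tan_def field_simps)
qed

lemma tan_pi_add_nat: "tan (of_real pi * (a + of_nat j)) = tan (of_real pi * (a :: complex))"
proof (induction j)
  case (Suc j)
  have "of_real pi * (a + of_nat (Suc j)) = of_real pi * (a + of_nat j) + of_real pi"
    by (simp add: algebra_simps)
  hence "tan (of_real pi * (a + of_nat (Suc j))) = tan (of_real pi * (a + of_nat j) + of_real pi)" by simp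
  also have "\<dots> = tan (of_real pi * (a + of_nat j))"
    unfolding tan_def sin_add cos_add by simp
  finally show ?case using Suc by simp
qed simp

lemma psi_coeff_True:
  "psi_coeff True a m j = rGamma (1 - a) * pochhammer (of_nat (m + 1) - a) j * Digamma (of_nat (m + j + 1) - a)"
  by (simp add: psi_coeff_def algebra_simps)

text \<open>
  Passing from \<open>\<psi>(1 - a - j)\<close> to \<open>\<psi>(a + j)\<close> costs \<open>\<pi> cot (\<pi> a)\<close> in every coefficient. Summed up,
  these terms are the multiple of \<open>F\<close> that accompanies the logarithm in two of the forms.
\<close>
lemma psi_coeff_False:
  assumes a: "a \<notin> \<int>"
  shows "psi_coeff False a m j = rGamma (1 - a) * pochhammer a j * (Digamma (a + of_nat j) + of_real pi / tan (of_real pi * a))"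
proof -
  have aj: "a + of_nat j \<notin> \<int>" using of_int_not_Ints_shift(1)[OF a, of "int j"] by simp
  have 1: "1 - a - of_nat j = 1 - (a + of_nat j)" by simp
  have nz: "1 - (a + of_nat j) \<notin> \<int>\<^sub>\<le>\<^sub>0" using not_nonpos_Ints_shift(4)[OF aj] .
  have "psi_coeff False a m j = (-1) ^ j * rGamma (1 - a - of_nat j) * Digamma (1 - (a + of_nat j))"
    unfolding psi_coeff_def 1 deriv_rGamma[OF nz] by simp
  also have "(-1) ^ j * rGamma (1 - a - of_nat j) = rGamma (1 - a) * pochhammer a j"
    unfolding rGamma_minus_of_nat_shift by (simp add: mult.assoc[symmetric] power_mult_distrib[symmetric])
  also have "Digamma (1 - (a + of_nat j)) = Digamma (a + of_nat j) + of_real pi / tan (of_real pi * a)"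
    unfolding Digamma_reflection[OF aj] tan_pi_add_nat ..
  finally show ?thesis .
qed

lemma rGamma_one_plus_nat: "rGamma (1 - (- of_nat n)) = 1 / (fact n :: complex)"
  using rGamma_of_nat_Suc[of n] by (simp add: add.commute)

lemma fact_mult_pochhammer: "fact k * pochhammer (of_nat k + 1 :: complex) j = fact (k + j)"
  using pochhammer_product'[of "1::complex" k j] by (simp add: pochhammer_fact add.commute)

lemma upper_param_True_nat: "upper_param True (- of_nat n) m = of_nat (m + n) + 1"
  by (simp add: upper_param_def)

lemma psi_coeff_True_nat:
  "psi_coeff True (- of_nat n) m j = 1 / fact n * (fact (m + n + j) / fact (m + n)) * Digamma (of_nat (m + n + j + 1))"
proof -
  have "of_nat m + 1 - (- of_nat n) = (of_nat (m + n) + 1 :: complex)" by simp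
  moreover have "pochhammer (of_nat (m + n) + 1 :: complex) j = fact (m + n + j) / fact (m + n)"
    using fact_mult_pochhammer[of "m + n" j] by (simp add: field_simps)
  moreover have "of_nat (m + n) + 1 + of_nat j = (of_nat (m + n + j + 1) :: complex)" by simp
  ultimately show ?thesis
    by (simp only: psi_coeff_def if_True rGamma_one_plus_nat)
qed

lemma psi_coeff_False_nat_le:
  assumes "j \<le> n"
  shows "psi_coeff False (- of_nat n) m j = (-1) ^ j / fact (n - j) * Digamma (of_nat (n - j + 1))"
proof -
  have 1: "1 - (- of_nat n) - of_nat j = (of_nat (n - j + 1) :: complex)" using assms by (simp add: of_nat_diff)
  have nz: "of_nat (n - j + 1) \<notin> (\<int>\<^sub>\<le>\<^sub>0 :: complex set)" by (rule Re_pos_notin_nonpos_Ints) simp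
  have "rGamma (of_nat (n - j + 1) :: complex) = 1 / fact (n - j)"
    using rGamma_of_nat_Suc[of "n - j"] by (simp add: add.commute)
  thus ?thesis
    unfolding psi_coeff_def 1 deriv_rGamma[OF nz] by simp
qed

text \<open>
  Beyond the degree of the polynomial, \<open>1 / \<Gamma>\<close> has a zero and its derivative there is a signed
  factorial.
\<close>
lemma psi_coeff_False_nat_gt:
  assumes "j > n"
  shows "psi_coeff False (- of_nat n) m j = (-1) ^ n * fact (j - n - 1)"
proof -
  define k where "k = j - n - 1"
  have j: "j = n + 1 + k" using assms by (simp add: k_def)
  have 1: "1 - (- of_nat n) - of_nat j = (- of_nat k :: complex)" by (simp add: j)
  have "- ((-1) ^ j * ((-1) ^ k * fact k)) = ((-1) ^ n * fact k :: complex)"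
    by (simp add: j power_add mult.assoc[symmetric])
  thus ?thesis
    unfolding psi_coeff_def 1 deriv_rGamma_minus_of_nat by (simp add: k_def)
qed

lemma pochhammer_minus_nat_scaled:
  "rGamma (1 - (- of_nat n)) * pochhammer (upper_param False (- of_nat n) m) j =
     (if j \<le> n then (-1) ^ j / fact (n - j) else 0 :: complex)"
  unfolding rGamma_one_plus_nat
  by (simp add: upper_param_def pochhammer_minus_of_nat pochhammer_minus_of_nat_eq_0)

lemma pochhammer_plus_nat_scaled:
  "rGamma (1 - (- of_nat n)) * pochhammer (upper_param True (- of_nat n) m) j =
     1 / fact n * (fact (m + n + j) / fact (m + n) :: complex)"
  unfolding rGamma_one_plus_nat upper_param_True_nat
  using fact_mult_pochhammer[of "m + n" j] by (simp add: field_simps)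

lemma sign_reverse: "k < m \<Longrightarrow> (-1) ^ (m - 1 - k) = ((-1) ^ (m + 1) * (-1) ^ k :: complex)"
proof -
  assume "k < m"
  then obtain l where l: "m = k + 1 + l" by (metis Suc_eq_plus1 add_Suc_right less_iff_Suc_add add.commute)
  show ?thesis
    by (simp add: l power_add mult.assoc[symmetric])
qed

lemma principal_part_True:
  "fact n * (\<Sum>k<m. p k * pochhammer (upper_param True (- of_nat n) m - of_nat m) k * ((-1) ^ (m - 1 - k) * fact (m - 1 - k)) / fact k * x ^ k)
   = (-1) ^ (m + 1) * (\<Sum>k<m. p k * fact (m - k - 1) * fact (n + k) / fact k * (- x :: complex) ^ k)"
  unfolding sum_distrib_left
proof (rule sum.cong)
  fix k assume "k \<in> {..<m}"
  hence k: "k < m" by simp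
  have "upper_param True (- of_nat n) m - of_nat m = (of_nat n + 1 :: complex)" by (simp add: upper_param_True_nat)
  hence 1: "fact n * pochhammer (upper_param True (- of_nat n) m - of_nat m) k = (fact (n + k) :: complex)"
    by (simp only: fact_mult_pochhammer)
  have "(- x) ^ k = (-1) ^ k * x ^ k" by (rule power_minus)
  moreover have "m - 1 - k = m - k - 1" by simp
  ultimately show "fact n * (p k * pochhammer (upper_param True (- of_nat n) m - of_nat m) k * ((-1) ^ (m - 1 - k) * fact (m - 1 - k)) / fact k * x ^ k)
    = (-1) ^ (m + 1) * (p k * fact (m - k - 1) * fact (n + k) / fact k * (- x) ^ k)"
    unfolding 1[symmetric] sign_reverse[OF k] by simp
qed simp

lemma principal_part_False:
  "(\<Sum>k<m. p k * pochhammer (upper_param False (- of_nat n) m - of_nat m) k * ((-1) ^ (m - 1 - k) * fact (m - 1 - k)) / fact k * x ^ k)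
   = (-1) ^ (m + 1) * fact (m + n) * (\<Sum>k<m. p k * fact (m - k - 1) / (fact (m + n - k) * fact k) * (x :: complex) ^ k)"
  unfolding sum_distrib_left
proof (rule sum.cong)
  fix k assume "k \<in> {..<m}"
  hence k: "k < m" by simp
  have "upper_param False (- of_nat n) m - of_nat m = (- of_nat (m + n) :: complex)" by (simp add: upper_param_def)
  hence 1: "pochhammer (upper_param False (- of_nat n) m - of_nat m) k = ((-1) ^ k * fact (m + n) / fact (m + n - k) :: complex)"
    using k by (simp only: pochhammer_minus_of_nat)
  have 2: "((-1) ^ k :: complex) * (-1) ^ k = 1" by (simp add: power_mult_distrib[symmetric])
  have 3: "m - 1 - k = m - k - 1" by simp
  have "p k * ((-1) ^ k * fact (m + n) / fact (m + n - k)) * ((-1) ^ (m + 1) * (-1) ^ k * fact (m - k - 1)) / fact k * x ^ k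
    = ((-1) ^ k * (-1) ^ k) * ((-1) ^ (m + 1) * fact (m + n) * (p k * fact (m - k - 1) / (fact (m + n - k) * fact k) * x ^ k))"
    by (simp del: power_Suc)
  thus "p k * pochhammer (upper_param False (- of_nat n) m - of_nat m) k * ((-1) ^ (m - 1 - k) * fact (m - 1 - k)) / fact k * x ^ k
    = (-1) ^ (m + 1) * fact (m + n) * (p k * fact (m - k - 1) / (fact (m + n - k) * fact k) * x ^ k)"
    unfolding 1 sign_reverse[OF k] 2 3[symmetric] by (simp only: mult_1)
qed simp

lemma summable_log_coeff:
  assumes a: "a \<notin> \<int>" and w: "norm w < 1"
  shows "summable (\<lambda>j. log_coeff i1 i2 a (- of_nat n) m j * w ^ j)"
proof (cases "w = 0")
  case True
  have "(\<lambda>j. log_coeff i1 i2 a (- of_nat n) m j * w ^ j) sums (\<Sum>j\<in>{0}. log_coeff i1 i2 a (- of_nat n) m j * w ^ j)"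
    by (rule sums_finite) (auto simp: True power_0_left)
  thus ?thesis by (rule sums_summable)
next
  case False
  have mna: "of_nat m + 1 - a \<notin> \<int>\<^sub>\<le>\<^sub>0" using not_nonpos_Ints_shift(1)[OF a, of "m + 1"] by (simp add: add.commute)
  have mnn: "of_nat m + 1 - (- of_nat n) \<notin> (\<int>\<^sub>\<le>\<^sub>0 :: complex set)" by (rule Re_pos_notin_nonpos_Ints) simp
  define t where "t = (if i1 = i2 then 1 else -1) * w"
  have t: "w = (if i1 = i2 then 1 else -1) * t" "t \<noteq> 0" using False by (simp_all add: t_def)
  show ?thesis by (rule log_limit(1)[OF mna mnn w t])
qed

text \<open>
  The sum of a series is known only where it converges, and the identity has been proved only near
  the segment from \<open>0\<close> to \<open>1\<close>. Solving the identity for the sum defines a holomorphic function on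
  the whole half-plane; it agrees with the series on the convex set where that converges.
\<close>
lemma continue_series:
  fixes s :: "nat \<Rightarrow> complex"
  assumes U: "U holomorphic_on upper_half_plane" and R: "R holomorphic_on upper_half_plane"
    and c: "c holomorphic_on upper_half_plane" "\<And>z. z \<in> upper_half_plane \<Longrightarrow> c z \<noteq> 0"
    and summ: "\<And>w. norm w < 1 \<Longrightarrow> summable (\<lambda>k. s k * w ^ k)"
    and near: "\<And>z. z \<in> upper_half_plane \<Longrightarrow> norm z < 1 \<Longrightarrow> norm (1 - z) < 1 \<Longrightarrow> norm (ser_var i1 i2 z) < 1 \<Longrightarrow>
       U z = R z + c z * (\<Sum>k. s k * ser_var i1 i2 z ^ k)"
  obtains S where "S holomorphic_on upper_half_plane"
    "\<And>z. z \<in> upper_half_plane \<Longrightarrow> norm (ser_var i1 i2 z) < 1 \<Longrightarrow> (\<lambda>k. s k * ser_var i1 i2 z ^ k) sums S z"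
    "\<And>z. z \<in> upper_half_plane \<Longrightarrow> U z = R z + c z * S z"
proof -
  define S where "S z = (U z - R z) / c z" for z
  let ?x = "ser_var i1 i2"
  define V where "V = upper_half_plane \<inter> {z. norm (?x z) < 1}"
  have V: "V = (if i1 = i2 then upper_half_plane \<inter> ball 0 1 else upper_half_plane \<inter> {z. Re z < 1 / 2})"
    using norm_pfaff_less_1_iff upper_half_planeD(9) by (auto simp: V_def ser_var_def)
  have "convex V" "open V"
  proof -
    have H: "convex upper_half_plane"
      unfolding upper_half_plane_def by (rule convex_halfspace_Im_gt)
    have "convex (upper_half_plane \<inter> ball 0 1)" "convex (upper_half_plane \<inter> {z. Re z < 1 / 2})"
      by (intro convex_Int H convex_ball convex_halfspace_Re_lt)+
    moreover have "open (upper_half_plane \<inter> ball 0 1)" "open (upper_half_plane \<inter> {z. Re z < 1 / 2})"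
      by (intro open_Int open_upper_half_plane open_ball open_halfspace_Re_lt)+
    ultimately show "convex V" "open V" unfolding V by (cases "i1 = i2"; simp only: if_True if_False simp_thms)+
  qed
  have holS: "S holomorphic_on upper_half_plane"
    unfolding S_def [abs_def] using U R c by (intro holomorphic_intros) auto
  have U_eq: "U z = R z + c z * S z" if "z \<in> upper_half_plane" for z
    using c(2)[OF that] by (simp add: S_def)
  let ?\<Sigma> = "\<lambda>w. \<Sum>k. s k * w ^ k"
  have h1: "?\<Sigma> holomorphic_on ball 0 1"
  proof (subst holomorphic_on_open[OF open_ball], safe)
    fix w :: complex assume "w \<in> ball 0 1"
    thus "\<exists>f'. (?\<Sigma> has_field_derivative f') (at w)"
      using termdiffs_strong'[OF summ, of 1 w] by auto
  qed
  have h2: "?x holomorphic_on V"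
  proof (cases "i1 = i2")
    case False
    have "(\<lambda>z. z / (z - 1)) holomorphic_on V"
      using upper_half_planeD(9) by (intro holomorphic_intros) (auto simp: V_def)
    thus ?thesis using False by (simp add: ser_var_def [abs_def])
  qed (simp add: ser_var_def [abs_def])
  have "(?\<Sigma> \<circ> ?x) holomorphic_on V"
    by (rule holomorphic_on_compose_gen[OF h2 h1]) (auto simp: V_def)
  hence hol\<Sigma>: "(\<lambda>z. ?\<Sigma> (?x z)) holomorphic_on V" by (simp add: o_def)
  \<comment> \<open>a point of the half-plane with \<open>|z| < 1\<close>, \<open>|1 - z| < 1\<close> and \<open>Re z < 1/2\<close>\<close>
  define z0 :: complex where "z0 = Complex (2/5) (3/10)"
  have z0: "z0 \<in> V \<inter> lens"
    by (auto simp: V z0_def upper_half_plane_iff dist_norm cmod_def power2_eq_square intro!: real_less_lsqrt)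
  have S: "S z = ?\<Sigma> (?x z)" if "z \<in> V" for z
  proof (rule analytic_continuation_open[of "V \<inter> lens" V S "\<lambda>z. ?\<Sigma> (?x z)"])
    show "open (V \<inter> lens)" using \<open>open V\<close> open_lens by blast
    show "S holomorphic_on V" using holS by (rule holomorphic_on_subset) (auto simp: V_def)
    show "connected V" using \<open>convex V\<close> by (rule convex_connected)
    fix y assume y: "y \<in> V \<inter> lens"
    hence yH: "y \<in> upper_half_plane" by (simp add: V_def)
    have "U y = R y + c y * ?\<Sigma> (?x y)"
      using y lens_notin_nonpos_Reals[of y] by (intro near) (auto simp: V_def)
    thus "S y = ?\<Sigma> (?x y)" using c(2)[OF yH] by (simp add: S_def)
  qed (use z0 \<open>open V\<close> that hol\<Sigma> in auto)
  show ?thesis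
  proof (rule that[of S])
    show "(\<lambda>k. s k * ?x z ^ k) sums S z" if "z \<in> upper_half_plane" "norm (?x z) < 1" for z
      using S[of z] summable_sums[OF summ[OF that(2)]] that by (simp add: V_def)
  qed (use holS U_eq in auto)
qed

lemma suminf_split_tail:
  fixes d s :: "nat \<Rightarrow> complex"
  assumes "summable s" "\<And>j. j \<le> n \<Longrightarrow> s j = 0" "\<And>j. j > n \<Longrightarrow> d j = \<kappa> * s j"
  shows "suminf d = (\<Sum>j\<le>n. d j) + \<kappa> * suminf s"
proof -
  have "(\<lambda>j. (if j \<in> {..n} then d j else 0) + \<kappa> * s j) sums ((\<Sum>j\<in>{..n}. d j) + \<kappa> * suminf s)"
    by (intro sums_add sums_If_finite_set sums_mult summable_sums assms(1)) simp
  moreover have "(if j \<in> {..n} then d j else 0) + \<kappa> * s j = d j" for j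
    using assms(2,3)[of j] by (cases "j \<le> n") auto
  ultimately show ?thesis by (simp add: sums_iff)
qed

lemma sums_tail_iff:
  fixes f :: "nat \<Rightarrow> complex"
  assumes "\<And>j. j \<le> n \<Longrightarrow> f j = 0"
  shows "(\<lambda>j. f (n + 1 + j)) sums S \<longleftrightarrow> f sums S"
proof -
  have "(\<Sum>i<n + 1. f i) = 0" using assms by (intro sum.neutral) auto
  thus ?thesis using sums_iff_shift[of f "n + 1" S] by (simp add: add_ac)
qed

lemma Gamma_mult_rGamma_1_minus:
  assumes "a \<notin> \<int>"
  shows "Gamma (1 - a) * rGamma (1 - a :: complex) = 1"
  using not_nonpos_Ints_shift(4)[OF assms] by (simp add: Gamma_def rGamma_eq_zero_iff)

lemma holomorphic_hyp2F1_upper_half_plane: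
  "hyp2F1 (- of_nat n) a (of_nat m + 1) holomorphic_on upper_half_plane"
proof -
  have m1: "of_nat m + 1 \<notin> (\<int>\<^sub>\<le>\<^sub>0 :: complex set)"
    by (rule Re_pos_notin_nonpos_Ints) simp
  show ?thesis
    by (rule holomorphic_on_subset[OF holomorphic_hyp2F1[OF m1]]) (use upper_half_planeD(1) in auto)
qed

lemma log_coeff_True_True:
  assumes a: "a \<notin> \<int>"
  shows "fact m * fact n * Gamma (1 - a) * log_coeff True True a (- of_nat n) m k =
    fact m / fact (m + n) * (pochhammer (of_nat (m + 1) - a) k * fact (m + n + k) / (fact (m + k) * fact k)
       * (Digamma (of_nat (m + k + 1) - a) + Digamma (of_nat (m + n + k + 1)) - Digamma (of_nat (m + k + 1)) - Digamma (of_nat (k + 1))))"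
proof -
  have u: "upper_param True a m = of_nat (m + 1) - a" by (simp add: upper_param_def)
  define A where "A = pochhammer (of_nat (m + 1) - a) k"
  define B where "B = fact (m + n + k) / (fact (m + n) :: complex)"
  define x1 x2 x3 x4 where "x1 = Digamma (of_nat (m + k + 1) - a)" and "x2 = (Digamma (of_nat (m + n + k + 1)) :: complex)"
     and "x3 = (Digamma (of_nat (m + k + 1)) :: complex)" and "x4 = (Digamma (of_nat (k + 1)) :: complex)"
  have "fact m * fact n * Gamma (1 - a) * log_coeff True True a (- of_nat n) m k =
     (Gamma (1 - a) * rGamma (1 - a)) * (fact n * (1 / fact n)) * (fact m * (A * B * (x1 + x2 - x3 - x4)) / (fact (m + k) * fact k))"
    unfolding log_coeff_def psi_coeff_True[of a] psi_coeff_True_nat pochhammer_plus_nat_scaled u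
      A_def[symmetric] B_def[symmetric] x1_def[symmetric] x2_def[symmetric] x3_def[symmetric] x4_def[symmetric]
    by (simp add: algebra_simps add_divide_distrib diff_divide_distrib)
  thus ?thesis
    unfolding Gamma_mult_rGamma_1_minus[OF a] by (simp add: A_def B_def x1_def x2_def x3_def x4_def)
qed

lemma log_coeff_False_True:
  assumes a: "a \<notin> \<int>"
  shows "fact m * fact n * Gamma (1 - a) * log_coeff False True a (- of_nat n) m k =
    fact m / fact (m + n) * (pochhammer a k * fact (m + n + k) / (fact (m + k) * fact k)
       * (Digamma (a + of_nat k) + Digamma (of_nat (m + n + k + 1)) - Digamma (of_nat (m + k + 1)) - Digamma (of_nat (k + 1))))
    + of_real pi / tan (of_real pi * a) * (fact m * reg2F1_coeff a (of_nat (m + n) + 1) (of_nat m + 1) k)"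
proof -
  have u: "upper_param False a m = a" by (simp add: upper_param_def)
  define A where "A = pochhammer a k"
  define B where "B = fact (m + n + k) / (fact (m + n) :: complex)"
  define x1 x2 x3 x4 where "x1 = Digamma (a + of_nat k)" and "x2 = (Digamma (of_nat (m + n + k + 1)) :: complex)"
     and "x3 = (Digamma (of_nat (m + k + 1)) :: complex)" and "x4 = (Digamma (of_nat (k + 1)) :: complex)"
  define \<tau> where "\<tau> = of_real pi / tan (of_real pi * a)"
  have "fact m * fact n * Gamma (1 - a) * log_coeff False True a (- of_nat n) m k =
     (Gamma (1 - a) * rGamma (1 - a)) * (fact n * (1 / fact n)) * (fact m * (A * B * (x1 + \<tau> + x2 - x3 - x4)) / (fact (m + k) * fact k))"
    unfolding log_coeff_def psi_coeff_False[OF a] psi_coeff_True_nat pochhammer_plus_nat_scaled u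
      A_def[symmetric] B_def[symmetric] x1_def[symmetric] x2_def[symmetric] x3_def[symmetric] x4_def[symmetric] \<tau>_def[symmetric]
    by (simp add: algebra_simps add_divide_distrib diff_divide_distrib)
  hence "fact m * fact n * Gamma (1 - a) * log_coeff False True a (- of_nat n) m k =
     fact m * (A * B * (x1 + x2 - x3 - x4)) / (fact (m + k) * fact k) + \<tau> * (fact m * (A * B * (1 / fact (m + k)) / fact k))"
    unfolding Gamma_mult_rGamma_1_minus[OF a] by (simp add: algebra_simps add_divide_distrib diff_divide_distrib)
  moreover have "reg2F1_coeff a (of_nat (m + n) + 1) (of_nat m + 1) k = A * B * (1 / fact (m + k)) / fact k"
  proof -
    have "pochhammer (of_nat (m + n) + 1 :: complex) k = B"
      using fact_mult_pochhammer[of "m + n" k] by (simp add: B_def field_simps)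
    moreover have "rGamma (of_nat m + 1 + of_nat k :: complex) = 1 / fact (m + k)"
      using rGamma_of_nat_Suc[of "m + k"] by (simp add: add_ac)
    ultimately show ?thesis by (simp only: reg2F1_coeff_def A_def)
  qed
  ultimately show ?thesis
    by (simp add: A_def B_def x1_def x2_def x3_def x4_def \<tau>_def)
qed

lemma log_coeff_False_gt:
  assumes a: "a \<notin> \<int>" and k: "k > n"
  shows "fact m * fact n * Gamma (1 - a) * log_coeff i False a (- of_nat n) m k =
    (-1) ^ n * fact n * fact m * (pochhammer (upper_param i a m) k * fact (k - n - 1) / (fact (m + k) * fact k))"
proof -
  have "fact m * fact n * Gamma (1 - a) * log_coeff i False a (- of_nat n) m k =
     (Gamma (1 - a) * rGamma (1 - a)) * ((-1) ^ n * fact n * fact m * (pochhammer (upper_param i a m) k * fact (k - n - 1) / (fact (m + k) * fact k)))"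
    using k unfolding log_coeff_def pochhammer_minus_nat_scaled psi_coeff_False_nat_gt[OF k] by simp
  thus ?thesis unfolding Gamma_mult_rGamma_1_minus[OF a] by simp
qed

lemma log_coeff_True_False_le:
  assumes a: "a \<notin> \<int>" and k: "k \<le> n"
  shows "fact m * fact n * Gamma (1 - a) * log_coeff True False a (- of_nat n) m k =
    fact m * fact n * (pochhammer (of_nat (m + 1) - a) k / (fact (m + k) * fact (n - k) * fact k)
       * (Digamma (of_nat (m + k + 1) - a) + Digamma (of_nat (n - k + 1)) - Digamma (of_nat (m + k + 1)) - Digamma (of_nat (k + 1)))) * (-1) ^ k"
proof -
  have u: "upper_param True a m = of_nat (m + 1) - a" by (simp add: upper_param_def)
  define A where "A = pochhammer (of_nat (m + 1) - a) k"
  define x1 x2 x3 x4 where "x1 = Digamma (of_nat (m + k + 1) - a)" and "x2 = (Digamma (of_nat (n - k + 1)) :: complex)"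
     and "x3 = (Digamma (of_nat (m + k + 1)) :: complex)" and "x4 = (Digamma (of_nat (k + 1)) :: complex)"
  have "fact m * fact n * Gamma (1 - a) * log_coeff True False a (- of_nat n) m k =
     (Gamma (1 - a) * rGamma (1 - a)) * (fact m * fact n * (A * ((-1) ^ k / fact (n - k)) * (x1 + x2 - x3 - x4)) / (fact (m + k) * fact k))"
    using k unfolding log_coeff_def psi_coeff_True[of a] psi_coeff_False_nat_le[OF k] pochhammer_minus_nat_scaled u
      A_def[symmetric] x1_def[symmetric] x2_def[symmetric] x3_def[symmetric] x4_def[symmetric]
    by (simp add: algebra_simps add_divide_distrib diff_divide_distrib)
  thus ?thesis
    unfolding Gamma_mult_rGamma_1_minus[OF a] A_def[symmetric] x1_def[symmetric] x2_def[symmetric] x3_def[symmetric] x4_def[symmetric]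
    by (simp add: mult_ac)
qed

lemma log_coeff_False_False_le:
  assumes a: "a \<notin> \<int>" and k: "k \<le> n"
  shows "fact m * fact n * Gamma (1 - a) * log_coeff False False a (- of_nat n) m k =
    fact m * fact n * pochhammer a k / (fact (m + k) * fact (n - k) * fact k)
       * (Digamma (a + of_nat k) + Digamma (of_nat (n - k + 1)) - Digamma (of_nat (m + k + 1)) - Digamma (of_nat (k + 1))) * (-1) ^ k
    + of_real pi / tan (of_real pi * a) * (fact m * reg2F1_coeff (- of_nat n) a (of_nat m + 1) k)"
proof -
  have u: "upper_param False a m = a" by (simp add: upper_param_def)
  define A where "A = pochhammer a k"
  define x1 x2 x3 x4 where "x1 = Digamma (a + of_nat k)" and "x2 = (Digamma (of_nat (n - k + 1)) :: complex)"
     and "x3 = (Digamma (of_nat (m + k + 1)) :: complex)" and "x4 = (Digamma (of_nat (k + 1)) :: complex)"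
  define \<tau> where "\<tau> = of_real pi / tan (of_real pi * a)"
  have "fact m * fact n * Gamma (1 - a) * log_coeff False False a (- of_nat n) m k =
     (Gamma (1 - a) * rGamma (1 - a)) * (fact m * fact n * (A * ((-1) ^ k / fact (n - k)) * (x1 + \<tau> + x2 - x3 - x4)) / (fact (m + k) * fact k))"
    using k unfolding log_coeff_def psi_coeff_False[OF a] psi_coeff_False_nat_le[OF k] pochhammer_minus_nat_scaled u
      A_def[symmetric] x1_def[symmetric] x2_def[symmetric] x3_def[symmetric] x4_def[symmetric] \<tau>_def[symmetric]
    by (simp add: algebra_simps add_divide_distrib diff_divide_distrib)
  hence "fact m * fact n * Gamma (1 - a) * log_coeff False False a (- of_nat n) m k =
     fact m * fact n * A / (fact (m + k) * fact (n - k) * fact k) * (x1 + x2 - x3 - x4) * (-1) ^ k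
     + \<tau> * (fact m * ((-1) ^ k * fact n / fact (n - k) * A * (1 / fact (m + k)) / fact k))"
    unfolding Gamma_mult_rGamma_1_minus[OF a] by (simp add: algebra_simps add_divide_distrib diff_divide_distrib)
  moreover have "reg2F1_coeff (- of_nat n) a (of_nat m + 1) k = (-1) ^ k * fact n / fact (n - k) * A * (1 / fact (m + k)) / fact k"
  proof -
    have "rGamma (of_nat m + 1 + of_nat k :: complex) = 1 / fact (m + k)"
      using rGamma_of_nat_Suc[of "m + k"] by (simp add: add_ac)
    thus ?thesis by (simp only: reg2F1_coeff_def A_def pochhammer_minus_of_nat[OF k])
  qed
  ultimately show ?thesis
    by (simp only: A_def x1_def x2_def x3_def x4_def \<tau>_def)
qed

section \<open>Continuation of the logarithmic expansions\<close>

lemma upper_half_plane_div_notin_nonpos_Reals: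
  assumes "z \<in> upper_half_plane"
  shows "z / (1 - z) \<notin> \<real>\<^sub>\<le>\<^sub>0"
proof -
  have im: "Im z > 0" using assms by (simp add: upper_half_plane_iff)
  hence "Im (z / (1 - z)) > 0" by (simp add: Im_complex_div_gt_0 algebra_simps)
  thus ?thesis by (auto simp: complex_nonpos_Reals_iff)
qed

lemma power_int_minus_nat: "z powi (- int m) = inverse ((z::complex) ^ m)"
  by (simp add: power_int_minus)

text \<open>
  Both parameters move with \<open>c\<close>, no transformation is needed, and every coefficient has its
  values of \<open>\<psi>\<close>.
\<close>
lemma U2_log_series_euler:
  fixes n m :: nat and a :: complex
  assumes a: "a \<notin> \<int>"
  defines "F \<equiv> hyp2F1 (- of_nat n) a (of_nat m + 1)"
  shows "\<exists>S. S holomorphic_on upper_half_plane \<and>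
       (\<forall>z\<in>upper_half_plane. norm z < 1 \<longrightarrow>
          (\<lambda>k. pochhammer (of_nat (m + 1) - a) k * fact (m + n + k) / (fact (m + k) * fact k)
                * (Digamma (of_nat (m + k + 1) - a) + Digamma (of_nat (m + n + k + 1))
                   - Digamma (of_nat (m + k + 1)) - Digamma (of_nat (k + 1)))
                * z ^ k) sums S z) \<and>
       (\<forall>z\<in>upper_half_plane. U2 n m a z =
          F z * ln z
          + (-1) ^ (m + 1) * fact m / (pochhammer (1 - a) m * fact (m + n)) * z powi (- int m)
            * (1 - z) powr (of_nat (m + n + 1) - a)
            * (\<Sum>k<m. pochhammer (1 - a) k * fact (m - k - 1) * fact (n + k) / fact k * (- z) ^ k)
          + fact m / fact (m + n) * (1 - z) powr (of_nat (m + n + 1) - a) * S z)"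
proof -
  define s where "s k = pochhammer (of_nat (m + 1) - a) k * fact (m + n + k) / (fact (m + k) * fact k)
                * (Digamma (of_nat (m + k + 1) - a) + Digamma (of_nat (m + n + k + 1))
                   - Digamma (of_nat (m + k + 1)) - Digamma (of_nat (k + 1)))" for k
  define W where "W z = (1 - z) powr (of_nat (m + n + 1) - a)" for z
  define R where "R z = F z * ln z
          + (-1) ^ (m + 1) * fact m / (pochhammer (1 - a) m * fact (m + n)) * z powi (- int m)
            * W z
            * (\<Sum>k<m. pochhammer (1 - a) k * fact (m - k - 1) * fact (n + k) / fact k * (- z) ^ k)" for z
  define N where "N = fact m * fact n * Gamma (1 - a)"
  let ?l = "log_coeff True True a (- of_nat n) m"
  have ls: "N * ?l k = fact m / fact (m + n) * s k" for k
    unfolding N_def s_def by (rule log_coeff_True_True[OF a])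
  obtain S where S: "S holomorphic_on upper_half_plane"
    "\<And>z. z \<in> upper_half_plane \<Longrightarrow> norm (ser_var True True z) < 1 \<Longrightarrow> (\<lambda>k. s k * ser_var True True z ^ k) sums S z"
    "\<And>z. z \<in> upper_half_plane \<Longrightarrow> U2 n m a z = R z + fact m / fact (m + n) * W z * S z"
  proof (rule continue_series[of "U2 n m a" R "\<lambda>z. fact m / fact (m + n) * W z" s True True])
    show "U2 n m a holomorphic_on upper_half_plane" by (rule holomorphic_U2[OF a])
    have W: "W holomorphic_on upper_half_plane"
      unfolding W_def [abs_def] by (intro holomorphic_intros) (use upper_half_planeD(4) in auto)
    thus "(\<lambda>z. fact m / fact (m + n) * W z) holomorphic_on upper_half_plane" by (intro holomorphic_intros)
    show "R holomorphic_on upper_half_plane"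
      unfolding R_def [abs_def] F_def
      by (intro holomorphic_intros holomorphic_hyp2F1_upper_half_plane W) (use upper_half_planeD(6,7) in auto)
    show "fact m / fact (m + n) * W z \<noteq> 0" if "z \<in> upper_half_plane" for z
      using upper_half_planeD(8)[OF that] by (simp add: W_def)
    have sl: "s k = fact (m + n) / fact m * N * ?l k" for k
      using ls[of k] by (simp add: field_simps)
    show "summable (\<lambda>k. s k * w ^ k)" if "norm w < 1" for w
      using summable_mult[OF summable_log_coeff[OF a that, of True True n m], of "fact (m + n) / fact m * N"]
      by (simp only: sl mult.assoc)
    fix z assume z: "z \<in> upper_half_plane" "norm z < 1" "norm (1 - z) < 1" "norm (ser_var True True z) < 1"
    note U = U2_log_expansion[OF a z, where n = n and m = m]
    define L where "L = (\<Sum>k<m. pochhammer (1 - a) k * pochhammer (upper_param True (- of_nat n) m - of_nat m) k * ((-1) ^ (m - 1 - k) * fact (m - 1 - k)) / fact k * z ^ k)"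
    have 0: "upper_param True a m - of_nat m = 1 - a" by (simp add: upper_param_def)
    have 1: "ser_var True True z = z" "log_var True True z = z" "log_prefactor True True a n m z = W z"
      by (simp_all add: ser_var_def log_var_def log_prefactor_def W_def)
    have "U2 n m a z = F z * ln z + N * W z * (\<Sum>j. ?l j * z ^ j) + fact m * fact n / (pochhammer (1 - a) m * fact (m + n)) * W z * inverse (z ^ m) * L"
      using U(1) unfolding 1 0 L_def F_def N_def .
    also have "N * W z * (\<Sum>j. ?l j * z ^ j) = fact m / fact (m + n) * W z * (\<Sum>k. s k * z ^ k)"
    proof -
      have "N * (\<Sum>j. ?l j * z ^ j) = (\<Sum>j. N * (?l j * z ^ j))"
        by (rule suminf_mult[symmetric]) (use U(2) 1 in simp)
      also have "\<dots> = (\<Sum>j. fact m / fact (m + n) * (s j * z ^ j))"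
        by (simp only: mult.assoc[symmetric] ls)
      also have "\<dots> = fact m / fact (m + n) * (\<Sum>j. s j * z ^ j)"
      proof (rule suminf_mult)
        show "summable (\<lambda>j. s j * z ^ j)"
          using summable_mult[OF summable_log_coeff[OF a z(2), of True True n m], of "fact (m + n) / fact m * N"]
          by (simp only: sl mult.assoc)
      qed
      finally have eq: "N * (\<Sum>j. ?l j * z ^ j) = fact m / fact (m + n) * (\<Sum>j. s j * z ^ j)" .
      have "N * W z * (\<Sum>j. ?l j * z ^ j) = W z * (N * (\<Sum>j. ?l j * z ^ j))" by (simp only: mult_ac)
      thus ?thesis unfolding eq by (simp only: mult_ac)
    qed
    also have "fact m * fact n / (pochhammer (1 - a) m * fact (m + n)) * W z * inverse (z ^ m) * L =
       fact m / (pochhammer (1 - a) m * fact (m + n)) * z powi (- int m) * W z * (fact n * L)"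
      by (simp add: power_int_minus_nat)
    also have "fact n * L = (-1) ^ (m + 1) * (\<Sum>k<m. pochhammer (1 - a) k * fact (m - k - 1) * fact (n + k) / fact k * (- z) ^ k)"
      unfolding L_def by (rule principal_part_True)
    finally show "U2 n m a z = R z + fact m / fact (m + n) * W z * (\<Sum>k. s k * ser_var True True z ^ k)"
      unfolding 1 R_def by (simp add: mult_ac)
  qed auto
  have "\<forall>z\<in>upper_half_plane. norm z < 1 \<longrightarrow> (\<lambda>k. s k * z ^ k) sums S z"
    using S(2) by (simp add: ser_var_def)
  thus ?thesis
    using S(1,3) unfolding s_def R_def W_def by blast
qed

text \<open>
  Pfaff's transformation with fixed parameter \<open>a\<close>. The cotangent terms add up to a multiple of the
  transformed series for \<open>F\<close>.
\<close>
lemma U2_log_series_pfaff: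
  fixes n m :: nat and a :: complex
  assumes a: "a \<notin> \<int>"
  defines "F \<equiv> hyp2F1 (- of_nat n) a (of_nat m + 1)"
  shows "\<exists>S. S holomorphic_on upper_half_plane \<and>
       (\<forall>z\<in>upper_half_plane. norm (z / (z - 1)) < 1 \<longrightarrow>
          (\<lambda>k. pochhammer a k * fact (m + n + k) / (fact (m + k) * fact k)
                * (Digamma (a + of_nat k) + Digamma (of_nat (m + n + k + 1))
                   - Digamma (of_nat (m + k + 1)) - Digamma (of_nat (k + 1)))
                * (z ^ k / (z - 1) ^ k)) sums S z) \<and>
       (\<forall>z\<in>upper_half_plane. U2 n m a z =
          F z * ln (z / (1 - z)) + of_real pi / tan (of_real pi * a) * F z
          + (-1) ^ (m + 1) * fact m / (pochhammer (1 - a) m * fact (m + n)) * z powi (- int m)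
            * (1 - z) powr (of_nat m - a)
            * (\<Sum>k<m. pochhammer (a - of_nat m) k * fact (m - k - 1) * fact (n + k) / fact k
                       * (z ^ k / (1 - z) ^ k))
          + fact m / fact (m + n) * (1 - z) powr (- a) * S z)"
proof -
  define s where "s k = pochhammer a k * fact (m + n + k) / (fact (m + k) * fact k)
                * (Digamma (a + of_nat k) + Digamma (of_nat (m + n + k + 1))
                   - Digamma (of_nat (m + k + 1)) - Digamma (of_nat (k + 1)))" for k
  define W where "W z = (1 - z) powr (- a)" for z
  define \<tau> where "\<tau> = of_real pi / tan (of_real pi * a)"
  define R where "R z = F z * ln (z / (1 - z)) + \<tau> * F z
          + (-1) ^ (m + 1) * fact m / (pochhammer (1 - a) m * fact (m + n)) * z powi (- int m)
            * (1 - z) powr (of_nat m - a)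
            * (\<Sum>k<m. pochhammer (a - of_nat m) k * fact (m - k - 1) * fact (n + k) / fact k
                       * (z ^ k / (1 - z) ^ k))" for z
  define N where "N = fact m * fact n * Gamma (1 - a)"
  let ?l = "log_coeff False True a (- of_nat n) m"
  let ?x = "ser_var False True"
  define t where "t k = fact m * reg2F1_coeff a (of_nat (m + n) + 1) (of_nat m + 1) k" for k
  have ls: "N * ?l k = fact m / fact (m + n) * s k + \<tau> * t k" for k
    unfolding N_def s_def t_def \<tau>_def by (rule log_coeff_False_True[OF a])
  have sumt: "(\<lambda>k. t k * w ^ k) sums (fact m * reg2F1 a (of_nat (m + n) + 1) (of_nat m + 1) w)" if "norm w < 1" for w
    using sums_mult[OF reg2F1_sums[OF that]] unfolding t_def by (simp only: mult.assoc)
  have sl: "s k = fact (m + n) / fact m * (N * ?l k - \<tau> * t k)" for k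
    unfolding ls by simp
  have summs: "summable (\<lambda>k. s k * w ^ k)" if "norm w < 1" for w
  proof -
    have "summable (\<lambda>k. fact (m + n) / fact m * (N * (?l k * w ^ k) - \<tau> * (t k * w ^ k)))"
      by (intro summable_mult summable_diff summable_log_coeff[OF a that] sums_summable[OF sumt[OF that]])
    thus ?thesis unfolding sl by (simp add: algebra_simps)
  qed
  obtain S where S: "S holomorphic_on upper_half_plane"
    "\<And>z. z \<in> upper_half_plane \<Longrightarrow> norm (?x z) < 1 \<Longrightarrow> (\<lambda>k. s k * ?x z ^ k) sums S z"
    "\<And>z. z \<in> upper_half_plane \<Longrightarrow> U2 n m a z = R z + fact m / fact (m + n) * W z * S z"
  proof (rule continue_series[of "U2 n m a" R "\<lambda>z. fact m / fact (m + n) * W z" s False True])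
    show "U2 n m a holomorphic_on upper_half_plane" by (rule holomorphic_U2[OF a])
    have W: "W holomorphic_on upper_half_plane"
      unfolding W_def [abs_def] by (intro holomorphic_intros) (use upper_half_planeD(4) in auto)
    thus "(\<lambda>z. fact m / fact (m + n) * W z) holomorphic_on upper_half_plane" by (intro holomorphic_intros)
    show "R holomorphic_on upper_half_plane"
      unfolding R_def [abs_def] F_def
      by (intro holomorphic_intros holomorphic_hyp2F1_upper_half_plane)
         (use upper_half_planeD(4,7,8) upper_half_plane_div_notin_nonpos_Reals in auto)
    show "fact m / fact (m + n) * W z \<noteq> 0" if "z \<in> upper_half_plane" for z
      using upper_half_planeD(8)[OF that] by (simp add: W_def)
    show "summable (\<lambda>k. s k * w ^ k)" if "norm w < 1" for w using that by (rule summs)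
    fix z assume z: "z \<in> upper_half_plane" "norm z < 1" "norm (1 - z) < 1" "norm (?x z) < 1"
    note zD = upper_half_planeD[OF z(1)]
    note U = U2_log_expansion[OF a z, where n = n and m = m]
    define x where "x = ?x z"
    have x: "x = - (z / (1 - z))" using ser_var_eq[of False True z] by (simp add: x_def log_var_def)
    define L where "L = (\<Sum>k<m. pochhammer (a - of_nat m) k * pochhammer (upper_param True (- of_nat n) m - of_nat m) k * ((-1) ^ (m - 1 - k) * fact (m - 1 - k)) / fact k * x ^ k)"
    have 1: "log_var False True z = z / (1 - z)" "log_prefactor False True a n m z = W z" "upper_param False a m = a"
      by (simp_all add: log_var_def log_prefactor_def W_def upper_param_def)
    have "U2 n m a z = F z * ln (z / (1 - z)) + N * W z * (\<Sum>j. ?l j * x ^ j) + fact m * fact n / (pochhammer (1 - a) m * fact (m + n)) * W z * inverse ((z / (1 - z)) ^ m) * L"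
      using U(1) unfolding 1 L_def F_def N_def x_def .
    also have "N * W z * (\<Sum>j. ?l j * x ^ j) = \<tau> * F z + fact m / fact (m + n) * W z * (\<Sum>k. s k * x ^ k)"
    proof -
      have x1: "norm x < 1" using z(4) by (simp add: x_def)
      have "N * (\<Sum>j. ?l j * x ^ j) = (\<Sum>j. N * (?l j * x ^ j))"
        by (rule suminf_mult[symmetric]) (rule summable_log_coeff[OF a x1])
      also have "\<dots> = (\<Sum>j. fact m / fact (m + n) * (s j * x ^ j) + \<tau> * (t j * x ^ j))"
        by (simp only: mult.assoc[symmetric] ls distrib_right)
      also have "\<dots> = fact m / fact (m + n) * (\<Sum>j. s j * x ^ j) + \<tau> * (fact m * reg2F1 a (of_nat (m + n) + 1) (of_nat m + 1) x)"
        by (intro sums_unique[symmetric] sums_add sums_mult summable_sums summs sumt x1)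
      finally have eq: "N * (\<Sum>j. ?l j * x ^ j) = fact m / fact (m + n) * (\<Sum>j. s j * x ^ j)
          + \<tau> * (fact m * reg2F1 a (of_nat (m + n) + 1) (of_nat m + 1) x)" .
      have "N * W z * (\<Sum>j. ?l j * x ^ j) = W z * (N * (\<Sum>j. ?l j * x ^ j))" by (simp only: mult_ac)
      also have "\<dots> = fact m / fact (m + n) * W z * (\<Sum>j. s j * x ^ j)
          + \<tau> * (fact m * W z * reg2F1 a (of_nat (m + n) + 1) (of_nat m + 1) x)"
        unfolding eq by (simp add: distrib_left)
      also have "fact m * W z * reg2F1 a (of_nat (m + n) + 1) (of_nat m + 1) x = F z"
        using U(3) unfolding 1 upper_param_True_nat F_def x_def .
      finally show ?thesis by (simp only: add.commute)
    qed
    also have "fact m * fact n / (pochhammer (1 - a) m * fact (m + n)) * W z * inverse ((z / (1 - z)) ^ m) * L =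
       fact m / (pochhammer (1 - a) m * fact (m + n)) * z powi (- int m) * (1 - z) powr (of_nat m - a) * (fact n * L)"
    proof -
      have "(1 - z) powr (of_nat m - a) = (1 - z) ^ m * W z"
        using zD(8) by (simp add: W_def powr_diff powr_minus powr_of_nat' divide_inverse)
      moreover have "inverse ((z / (1 - z)) ^ m) = z powi (- int m) * (1 - z) ^ m"
        unfolding power_int_minus_nat power_divide by (simp add: divide_inverse)
      ultimately show ?thesis by simp
    qed
    also have "fact n * L = (-1) ^ (m + 1) * (\<Sum>k<m. pochhammer (a - of_nat m) k * fact (m - k - 1) * fact (n + k) / fact k * (- x) ^ k)"
      unfolding L_def by (rule principal_part_True)
    also have "- x = z / (1 - z)" by (simp add: x)
    finally show "U2 n m a z = R z + fact m / fact (m + n) * W z * (\<Sum>k. s k * ?x z ^ k)"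
      unfolding x_def[symmetric] R_def power_divide by (simp add: mult_ac)
  qed auto
  have "\<forall>z\<in>upper_half_plane. norm (z / (z - 1)) < 1 \<longrightarrow> (\<lambda>k. s k * (z ^ k / (z - 1) ^ k)) sums S z"
    using S(2) by (simp add: ser_var_def power_divide)
  thus ?thesis
    using S(1,3) unfolding s_def R_def W_def \<tau>_def by blast
qed

text \<open>
  The coefficients of the part of the second solution beyond the degree \<open>n\<close> of the polynomial, up
  to the constant \<open>(-1)\<^sup>n m! n!\<close>.
\<close>
definition tail_coeff :: "bool \<Rightarrow> complex \<Rightarrow> nat \<Rightarrow> nat \<Rightarrow> nat \<Rightarrow> complex" where
  "tail_coeff i a n m k =
     (if k \<le> n then 0 else pochhammer (upper_param i a m) k * fact (k - n - 1) / (fact (m + k) * fact k))"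

lemma log_coeff_tail_split:
  fixes n m :: nat and a w :: complex and i :: bool
  assumes a: "a \<notin> \<int>" and w: "norm w < 1"
  defines "N \<equiv> fact m * fact n * Gamma (1 - a)" and "l \<equiv> log_coeff i False a (- of_nat n) m"
  shows "summable (\<lambda>k. tail_coeff i a n m k * w ^ k)"
    and "N * (\<Sum>j. l j * w ^ j) =
       (\<Sum>j\<le>n. N * l j * w ^ j) + (-1) ^ n * fact n * fact m * (\<Sum>k. tail_coeff i a n m k * w ^ k)"
proof -
  define \<kappa> where "\<kappa> = ((-1) ^ n * fact n * fact m :: complex)"
  have \<kappa>0: "\<kappa> \<noteq> 0" by (simp add: \<kappa>_def)
  have l_gt: "N * l k = \<kappa> * tail_coeff i a n m k" if "k > n" for k
    using log_coeff_False_gt[OF a that, of m i] that by (simp add: N_def l_def \<kappa>_def tail_coeff_def)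
  have suml: "summable (\<lambda>k. l k * w ^ k)"
    unfolding l_def by (rule summable_log_coeff[OF a w])
  have "summable (\<lambda>k. N / \<kappa> * (l k * w ^ k))"
    by (intro summable_mult suml)
  also have "?this \<longleftrightarrow> summable (\<lambda>k. tail_coeff i a n m k * w ^ k)"
  proof (rule summable_cong)
    show "eventually (\<lambda>k. N / \<kappa> * (l k * w ^ k) = tail_coeff i a n m k * w ^ k) sequentially"
      using eventually_gt_at_top[of n]
    proof eventually_elim
      case (elim k)
      have "N / \<kappa> * (l k * w ^ k) = (N * l k) / \<kappa> * w ^ k" by simp
      thus ?case unfolding l_gt[OF elim] using \<kappa>0 by simp
    qed
  qed
  finally show summ: "summable (\<lambda>k. tail_coeff i a n m k * w ^ k)" .
  have "N * (\<Sum>j. l j * w ^ j) = (\<Sum>j. N * l j * w ^ j)"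
    unfolding suminf_mult[OF suml, symmetric] by (simp only: mult.assoc)
  also have "\<dots> = (\<Sum>j\<le>n. N * l j * w ^ j) + \<kappa> * (\<Sum>k. tail_coeff i a n m k * w ^ k)"
    by (rule suminf_split_tail[OF summ]) (simp_all add: tail_coeff_def l_gt)
  finally show "N * (\<Sum>j. l j * w ^ j) =
       (\<Sum>j\<le>n. N * l j * w ^ j) + (-1) ^ n * fact n * fact m * (\<Sum>k. tail_coeff i a n m k * w ^ k)"
    unfolding \<kappa>_def .
qed

text \<open>
  Euler's transformation makes the first solution the polynomial \<open>F\<close>. Its coefficients up to
  degree \<open>n\<close> carry the values of \<open>\<psi>\<close>, while the second solution does not terminate for \<open>\<epsilon> \<noteq> 0\<close> and
  leaves the infinite tail.
\<close>
lemma U2_log_series_terminating: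
  fixes n m :: nat and a :: complex
  assumes a: "a \<notin> \<int>"
  defines "F \<equiv> hyp2F1 (- of_nat n) a (of_nat m + 1)"
  shows "\<exists>S. S holomorphic_on upper_half_plane \<and>
       (\<forall>z\<in>upper_half_plane. norm z < 1 \<longrightarrow>
          (\<lambda>j. let k = n + 1 + j in
             pochhammer a k * fact (k - n - 1) / (fact (m + k) * fact k) * z ^ k) sums S z) \<and>
       (\<forall>z\<in>upper_half_plane. U2 n m a z =
          F z * ln z + of_real pi / tan (of_real pi * a) * F z
          + (-1) ^ (m + 1) * fact m * fact n / pochhammer (1 - a) m * z powi (- int m)
            * (\<Sum>k<m. pochhammer (a - of_nat m) k * fact (m - k - 1)
                       / (fact (m + n - k) * fact k) * z ^ k)
          + (\<Sum>k\<le>n. fact m * fact n * pochhammer a k / (fact (m + k) * fact (n - k) * fact k)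
                       * (Digamma (a + of_nat k) + Digamma (of_nat (n - k + 1))
                          - Digamma (of_nat (m + k + 1)) - Digamma (of_nat (k + 1)))
                       * (- z) ^ k)
          + (-1) ^ n * fact n * fact m * S z)"
proof -
  define s where "s = tail_coeff False a n m"
  define \<kappa> where "\<kappa> = ((-1) ^ n * fact n * fact m :: complex)"
  have \<kappa>0: "\<kappa> \<noteq> 0" by (simp add: \<kappa>_def)
  define \<tau> where "\<tau> = of_real pi / tan (of_real pi * a)"
  define q where "q k = fact m * fact n * pochhammer a k / (fact (m + k) * fact (n - k) * fact k)
                       * (Digamma (a + of_nat k) + Digamma (of_nat (n - k + 1))
                          - Digamma (of_nat (m + k + 1)) - Digamma (of_nat (k + 1)))" for k
  define R where "R z = F z * ln z + \<tau> * F z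
          + (-1) ^ (m + 1) * fact m * fact n / pochhammer (1 - a) m * z powi (- int m)
            * (\<Sum>k<m. pochhammer (a - of_nat m) k * fact (m - k - 1)
                       / (fact (m + n - k) * fact k) * z ^ k)
          + (\<Sum>k\<le>n. q k * (- z) ^ k)" for z
  define N where "N = fact m * fact n * Gamma (1 - a)"
  let ?l = "log_coeff False False a (- of_nat n) m"
  let ?x = "ser_var False False"
  have u: "upper_param False a m = a" by (simp add: upper_param_def)
  have l_le: "N * ?l k = q k * (-1) ^ k + \<tau> * (fact m * reg2F1_coeff (- of_nat n) a (of_nat m + 1) k)" if "k \<le> n" for k
    unfolding N_def q_def \<tau>_def by (rule log_coeff_False_False_le[OF a that])
  note split = log_coeff_tail_split[OF a, where i = False and n = n and m = m, folded N_def s_def]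
  obtain S where S: "S holomorphic_on upper_half_plane"
    "\<And>z. z \<in> upper_half_plane \<Longrightarrow> norm (?x z) < 1 \<Longrightarrow> (\<lambda>k. s k * ?x z ^ k) sums S z"
    "\<And>z. z \<in> upper_half_plane \<Longrightarrow> U2 n m a z = R z + \<kappa> * S z"
  proof (rule continue_series[of "U2 n m a" R "\<lambda>z. \<kappa>" s False False])
    show "U2 n m a holomorphic_on upper_half_plane" by (rule holomorphic_U2[OF a])
    show "R holomorphic_on upper_half_plane"
      unfolding R_def [abs_def] F_def
      by (intro holomorphic_intros holomorphic_hyp2F1_upper_half_plane)
         (use upper_half_planeD(6,7) in auto)
    show "\<kappa> \<noteq> 0" by (rule \<kappa>0)
    show "summable (\<lambda>k. s k * w ^ k)" if "norm w < 1" for w using that by (rule split(1))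
    fix z assume z: "z \<in> upper_half_plane" "norm z < 1" "norm (1 - z) < 1" "norm (?x z) < 1"
    note U = U2_log_expansion[OF a z, where n = n and m = m]
    define L where "L = (\<Sum>k<m. pochhammer (a - of_nat m) k * pochhammer (upper_param False (- of_nat n) m - of_nat m) k * ((-1) ^ (m - 1 - k) * fact (m - 1 - k)) / fact k * z ^ k)"
    have 1: "?x z = z" "log_var False False z = z" "log_prefactor False False a n m z = 1"
      by (simp_all add: ser_var_def log_var_def log_prefactor_def)
    have "U2 n m a z = F z * ln z + N * 1 * (\<Sum>j. ?l j * z ^ j) + fact m * fact n / (pochhammer (1 - a) m * fact (m + n)) * 1 * inverse (z ^ m) * L"
      using U(1) unfolding 1 u L_def F_def N_def .
    also have "N * 1 * (\<Sum>j. ?l j * z ^ j) = \<tau> * F z + (\<Sum>k\<le>n. q k * (- z) ^ k) + \<kappa> * (\<Sum>k. s k * z ^ k)"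
    proof -
      have "N * 1 * (\<Sum>j. ?l j * z ^ j) = (\<Sum>j\<le>n. N * ?l j * z ^ j) + \<kappa> * (\<Sum>k. s k * z ^ k)"
        using split(2)[OF z(2)] by (simp only: \<kappa>_def mult_1_right)
      also have "(\<Sum>j\<le>n. N * ?l j * z ^ j) = (\<Sum>j\<le>n. \<tau> * (fact m * (reg2F1_coeff (- of_nat n) a (of_nat m + 1) j * z ^ j)) + q j * (- z) ^ j)"
      proof (rule sum.cong)
        fix j assume "j \<in> {..n}"
        hence j: "j \<le> n" by simp
        have "(- z) ^ j = (-1) ^ j * z ^ j" by (rule power_minus)
        thus "N * ?l j * z ^ j = \<tau> * (fact m * (reg2F1_coeff (- of_nat n) a (of_nat m + 1) j * z ^ j)) + q j * (- z) ^ j"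
          unfolding l_le[OF j] by (simp add: algebra_simps)
      qed simp
      also have "\<dots> = \<tau> * (fact m * reg2F1 (- of_nat n) a (of_nat m + 1) z) + (\<Sum>k\<le>n. q k * (- z) ^ k)"
        unfolding reg2F1_terminating sum.distrib sum_distrib_left ..
      also have "fact m * reg2F1 (- of_nat n) a (of_nat m + 1) z = F z"
        unfolding F_def by (rule hyp2F1_terminating[OF upper_half_planeD(1)[OF z(1)], symmetric])
      finally show ?thesis .
    qed
    also have "L = (-1) ^ (m + 1) * fact (m + n) * (\<Sum>k<m. pochhammer (a - of_nat m) k * fact (m - k - 1) / (fact (m + n - k) * fact k) * z ^ k)"
      unfolding L_def by (rule principal_part_False)
    finally show "U2 n m a z = R z + \<kappa> * (\<Sum>k. s k * ?x z ^ k)"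
      unfolding 1 R_def power_int_minus_nat by (simp add: mult_ac)
  qed auto
  have "(\<lambda>j. let k = n + 1 + j in pochhammer a k * fact (k - n - 1) / (fact (m + k) * fact k) * z ^ k) sums S z"
    if z: "z \<in> upper_half_plane" "norm z < 1" for z
  proof -
    have "(\<lambda>k. s k * z ^ k) sums S z" using S(2)[of z] z by (simp add: ser_var_def)
    hence "(\<lambda>j. s (n + 1 + j) * z ^ (n + 1 + j)) sums S z"
      by (subst sums_tail_iff[of n "\<lambda>k. s k * z ^ k"]) (simp_all add: s_def tail_coeff_def)
    thus ?thesis by (simp add: s_def tail_coeff_def u Let_def)
  qed
  thus ?thesis
    using S(1,3) unfolding R_def \<tau>_def \<kappa>_def q_def by blast
qed

text \<open>
  Pfaff's transformation with fixed parameter \<open>-n\<close>. As before the series splits into a polynomial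
  part and a tail, and no cotangent occurs because the parameter attached to \<open>a\<close> moves with \<open>c\<close>.
\<close>
lemma U2_log_series_terminating_pfaff:
  fixes n m :: nat and a :: complex
  assumes a: "a \<notin> \<int>"
  defines "F \<equiv> hyp2F1 (- of_nat n) a (of_nat m + 1)"
  shows "\<exists>S. S holomorphic_on upper_half_plane \<and>
       (\<forall>z\<in>upper_half_plane. norm (z / (z - 1)) < 1 \<longrightarrow>
          (\<lambda>j. let k = n + 1 + j in
             pochhammer (of_nat (m + 1) - a) k * fact (k - n - 1) / (fact (m + k) * fact k)
                * (z ^ k / (z - 1) ^ k)) sums S z) \<and>
       (\<forall>z\<in>upper_half_plane. U2 n m a z =
          F z * ln (z / (1 - z))
          + (-1) ^ (m + 1) * fact m * fact n / pochhammer (1 - a) m * z powi (- int m)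
            * (1 - z) ^ (n + m)
            * (\<Sum>k<m. pochhammer (1 - a) k * fact (m - k - 1) / (fact (m + n - k) * fact k)
                       * (z ^ k / (z - 1) ^ k))
          + fact m * fact n * (1 - z) ^ n
            * (\<Sum>k\<le>n. pochhammer (of_nat (m + 1) - a) k / (fact (m + k) * fact (n - k) * fact k)
                       * (Digamma (of_nat (m + k + 1) - a) + Digamma (of_nat (n - k + 1))
                          - Digamma (of_nat (m + k + 1)) - Digamma (of_nat (k + 1)))
                       * (z ^ k / (1 - z) ^ k))
          + fact m * fact n * (z - 1) ^ n * S z)"
proof -
  define s where "s = tail_coeff True a n m"
  define \<kappa> where "\<kappa> = ((-1) ^ n * fact n * fact m :: complex)"
  define q where "q k = pochhammer (of_nat (m + 1) - a) k / (fact (m + k) * fact (n - k) * fact k)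
                       * (Digamma (of_nat (m + k + 1) - a) + Digamma (of_nat (n - k + 1))
                          - Digamma (of_nat (m + k + 1)) - Digamma (of_nat (k + 1)))" for k
  define R where "R z = F z * ln (z / (1 - z))
          + (-1) ^ (m + 1) * fact m * fact n / pochhammer (1 - a) m * z powi (- int m)
            * (1 - z) ^ (n + m)
            * (\<Sum>k<m. pochhammer (1 - a) k * fact (m - k - 1) / (fact (m + n - k) * fact k)
                       * (z ^ k / (z - 1) ^ k))
          + fact m * fact n * (1 - z) ^ n * (\<Sum>k\<le>n. q k * (z ^ k / (1 - z) ^ k))" for z
  define N where "N = fact m * fact n * Gamma (1 - a)"
  let ?l = "log_coeff True False a (- of_nat n) m"
  let ?x = "ser_var True False"
  have u: "upper_param True a m = of_nat (m + 1) - a" by (simp add: upper_param_def)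
  have l_le: "N * ?l k = fact m * fact n * q k * (-1) ^ k" if "k \<le> n" for k
    unfolding N_def q_def by (rule log_coeff_True_False_le[OF a that])
  note split = log_coeff_tail_split[OF a, where i = True and n = n and m = m, folded N_def s_def]
  have sign: "(z - 1) ^ n = (-1) ^ n * (1 - z) ^ n" for z :: complex
    using power_minus[of "1 - z" n] by simp
  obtain S where S: "S holomorphic_on upper_half_plane"
    "\<And>z. z \<in> upper_half_plane \<Longrightarrow> norm (?x z) < 1 \<Longrightarrow> (\<lambda>k. s k * ?x z ^ k) sums S z"
    "\<And>z. z \<in> upper_half_plane \<Longrightarrow> U2 n m a z = R z + fact m * fact n * (z - 1) ^ n * S z"
  proof (rule continue_series[of "U2 n m a" R "\<lambda>z. fact m * fact n * (z - 1) ^ n" s True False])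
    show "U2 n m a holomorphic_on upper_half_plane" by (rule holomorphic_U2[OF a])
    show "R holomorphic_on upper_half_plane"
      unfolding R_def [abs_def] F_def
      by (intro holomorphic_intros holomorphic_hyp2F1_upper_half_plane)
         (use upper_half_planeD(7,8,9) upper_half_plane_div_notin_nonpos_Reals in auto)
    show "(\<lambda>z. fact m * fact n * (z - 1) ^ n) holomorphic_on upper_half_plane"
      by (intro holomorphic_intros)
    show "fact m * fact n * (z - 1) ^ n \<noteq> 0" if "z \<in> upper_half_plane" for z
      using upper_half_planeD(9)[OF that] by simp
    show "summable (\<lambda>k. s k * w ^ k)" if "norm w < 1" for w using that by (rule split(1))
    fix z assume z: "z \<in> upper_half_plane" "norm z < 1" "norm (1 - z) < 1" "norm (?x z) < 1"
    note U = U2_log_expansion[OF a z, where n = n and m = m]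
    define x where "x = ?x z"
    have x1: "norm x < 1" using z(4) by (simp add: x_def)
    have x: "x = - (z / (1 - z))" using ser_var_eq[of True False z] by (simp add: x_def log_var_def)
    have x': "x = z / (z - 1)" by (simp add: x_def ser_var_def)
    define L where "L = (\<Sum>k<m. pochhammer (1 - a) k * pochhammer (upper_param False (- of_nat n) m - of_nat m) k * ((-1) ^ (m - 1 - k) * fact (m - 1 - k)) / fact k * x ^ k)"
    have 0: "upper_param True a m - of_nat m = 1 - a" by (simp add: upper_param_def)
    have 1: "log_var True False z = z / (1 - z)" "log_prefactor True False a n m z = (1 - z) ^ n"
      by (simp_all add: log_var_def log_prefactor_def)
    have "U2 n m a z = F z * ln (z / (1 - z)) + N * (1 - z) ^ n * (\<Sum>j. ?l j * x ^ j) + fact m * fact n / (pochhammer (1 - a) m * fact (m + n)) * (1 - z) ^ n * inverse ((z / (1 - z)) ^ m) * L"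
      using U(1) unfolding 1 0 L_def F_def N_def x_def .
    also have "N * (1 - z) ^ n * (\<Sum>j. ?l j * x ^ j) = fact m * fact n * (1 - z) ^ n * (\<Sum>k\<le>n. q k * (z ^ k / (1 - z) ^ k))
        + fact m * fact n * (z - 1) ^ n * (\<Sum>k. s k * x ^ k)"
    proof -
      have "N * (\<Sum>j. ?l j * x ^ j) = (\<Sum>j\<le>n. N * ?l j * x ^ j) + \<kappa> * (\<Sum>k. s k * x ^ k)"
        using split(2)[OF x1] by (simp only: \<kappa>_def)
      also have "(\<Sum>j\<le>n. N * ?l j * x ^ j) = (\<Sum>j\<le>n. fact m * fact n * (q j * (z ^ j / (1 - z) ^ j)))"
      proof (rule sum.cong)
        fix j assume "j \<in> {..n}"
        hence j: "j \<le> n" by simp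
        have "x ^ j = (-1) ^ j * (z ^ j / (1 - z) ^ j)"
          unfolding x power_minus[of "z / (1 - z)"] power_divide ..
        moreover have "(-1) ^ j * (-1) ^ j = (1::complex)" by (simp add: power_mult_distrib[symmetric])
        hence "fact m * fact n * q j * (-1) ^ j * ((-1) ^ j * y) = fact m * fact n * (q j * y)" for y
          by (simp add: mult.assoc)
        ultimately show "N * ?l j * x ^ j = fact m * fact n * (q j * (z ^ j / (1 - z) ^ j))"
          unfolding l_le[OF j] by (simp only:)
      qed simp
      also have "\<dots> = fact m * fact n * (\<Sum>k\<le>n. q k * (z ^ k / (1 - z) ^ k))"
        by (simp only: sum_distrib_left)
      finally have eq: "N * (\<Sum>j. ?l j * x ^ j) = fact m * fact n * (\<Sum>k\<le>n. q k * (z ^ k / (1 - z) ^ k)) + \<kappa> * (\<Sum>k. s k * x ^ k)" .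
      have "N * (1 - z) ^ n * (\<Sum>j. ?l j * x ^ j) = (1 - z) ^ n * (N * (\<Sum>j. ?l j * x ^ j))" by (simp only: mult_ac)
      thus ?thesis unfolding eq \<kappa>_def sign by (simp add: algebra_simps)
    qed
    also have "L = (-1) ^ (m + 1) * fact (m + n) * (\<Sum>k<m. pochhammer (1 - a) k * fact (m - k - 1) / (fact (m + n - k) * fact k) * x ^ k)"
      unfolding L_def by (rule principal_part_False)
    also have "fact m * fact n / (pochhammer (1 - a) m * fact (m + n)) * (1 - z) ^ n * inverse ((z / (1 - z)) ^ m) *
        ((-1) ^ (m + 1) * fact (m + n) * (\<Sum>k<m. pochhammer (1 - a) k * fact (m - k - 1) / (fact (m + n - k) * fact k) * x ^ k))
      = (-1) ^ (m + 1) * fact m * fact n / pochhammer (1 - a) m * z powi (- int m) * (1 - z) ^ (n + m)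
          * (\<Sum>k<m. pochhammer (1 - a) k * fact (m - k - 1) / (fact (m + n - k) * fact k) * x ^ k)"
    proof -
      have 1: "inverse ((z / (1 - z)) ^ m) = z powi (- int m) * (1 - z) ^ m"
        unfolding power_int_minus_nat power_divide by (simp add: divide_inverse)
      have "fm * fn / (p * f) * w * (zi * v) * (g * f * S) = g * fm * fn / p * zi * (w * v) * S"
        if "f \<noteq> 0" for fm fn p f w zi v g S :: complex
        using that by (cases "p = 0") (simp_all add: field_simps)
      from this[OF fact_nonzero] show ?thesis
        unfolding 1 power_add .
    qed
    finally show "U2 n m a z = R z + fact m * fact n * (z - 1) ^ n * (\<Sum>k. s k * ?x z ^ k)"
      unfolding x_def[symmetric] R_def x' power_divide by (simp only: add_ac)
  qed auto
  have "(\<lambda>j. let k = n + 1 + j in pochhammer (of_nat (m + 1) - a) k * fact (k - n - 1) / (fact (m + k) * fact k)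
          * (z ^ k / (z - 1) ^ k)) sums S z"
    if z: "z \<in> upper_half_plane" "norm (z / (z - 1)) < 1" for z
  proof -
    have "(\<lambda>k. s k * (z ^ k / (z - 1) ^ k)) sums S z" using S(2)[of z] z by (simp add: ser_var_def power_divide)
    hence "(\<lambda>j. s (n + 1 + j) * (z ^ (n + 1 + j) / (z - 1) ^ (n + 1 + j))) sums S z"
      by (subst sums_tail_iff[of n "\<lambda>k. s k * (z ^ k / (z - 1) ^ k)"]) (simp_all add: s_def tail_coeff_def)
    thus ?thesis by (simp add: s_def tail_coeff_def u Let_def)
  qed
  thus ?thesis
    using S(1,3) unfolding R_def q_def by blast
qed

theorem theorem6p1:
  fixes n m :: nat and a :: complex
  assumes "a \<notin> \<int>"
  defines "F \<equiv> hyp2F1 (- of_nat n) a (of_nat m + 1)"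
  shows
    "(\<forall>z\<in>upper_half_plane.
       ((\<lambda>b. U2_generic m a b z) \<longlongrightarrow> U2 n m a z) (at (- of_nat n))) \<and>
    (\<forall>z\<in>upper_half_plane. U2 n m a z =
       (-1) ^ (m + 1) * fact m * fact n / pochhammer (1 - a) (m + n + 1)
         * (1 - z) powr (of_nat (m + n + 1) - a)
         * hyp2F1 (of_nat (m + 1) - a) (of_nat (m + n + 1)) (of_nat (m + n + 2) - a) (1 - z)) \<and>
    (\<forall>z\<in>upper_half_plane. U2 n m a z =
       (-1) ^ (m + 1) * fact m * fact n / pochhammer (a - of_nat m) (m + n + 1)
         * (- z) powr (- a) * hyp2F1 a (a - of_nat m) (a + of_nat n + 1) (1 / z)
       + of_real pi * exp (\<i> * of_real pi * a) / sin (of_real pi * a) * F z) \<and>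
    (\<exists>S. S holomorphic_on upper_half_plane \<and>
       (\<forall>z\<in>upper_half_plane. norm z < 1 \<longrightarrow>
          (\<lambda>j. let k = n + 1 + j in
             pochhammer a k * fact (k - n - 1) / (fact (m + k) * fact k) * z ^ k) sums S z) \<and>
       (\<forall>z\<in>upper_half_plane. U2 n m a z =
          F z * ln z + of_real pi / tan (of_real pi * a) * F z
          + (-1) ^ (m + 1) * fact m * fact n / pochhammer (1 - a) m * z powi (- int m)
            * (\<Sum>k<m. pochhammer (a - of_nat m) k * fact (m - k - 1)
                       / (fact (m + n - k) * fact k) * z ^ k)
          + (\<Sum>k\<le>n. fact m * fact n * pochhammer a k / (fact (m + k) * fact (n - k) * fact k)
                       * (Digamma (a + of_nat k) + Digamma (of_nat (n - k + 1))
                          - Digamma (of_nat (m + k + 1)) - Digamma (of_nat (k + 1)))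
                       * (- z) ^ k)
          + (-1) ^ n * fact n * fact m * S z)) \<and>
    (\<exists>S. S holomorphic_on upper_half_plane \<and>
       (\<forall>z\<in>upper_half_plane. norm z < 1 \<longrightarrow>
          (\<lambda>k. pochhammer (of_nat (m + 1) - a) k * fact (m + n + k) / (fact (m + k) * fact k)
                * (Digamma (of_nat (m + k + 1) - a) + Digamma (of_nat (m + n + k + 1))
                   - Digamma (of_nat (m + k + 1)) - Digamma (of_nat (k + 1)))
                * z ^ k) sums S z) \<and>
       (\<forall>z\<in>upper_half_plane. U2 n m a z =
          F z * ln z
          + (-1) ^ (m + 1) * fact m / (pochhammer (1 - a) m * fact (m + n)) * z powi (- int m)
            * (1 - z) powr (of_nat (m + n + 1) - a)
            * (\<Sum>k<m. pochhammer (1 - a) k * fact (m - k - 1) * fact (n + k) / fact k * (- z) ^ k)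
          + fact m / fact (m + n) * (1 - z) powr (of_nat (m + n + 1) - a) * S z)) \<and>
    (\<exists>S. S holomorphic_on upper_half_plane \<and>
       (\<forall>z\<in>upper_half_plane. norm (z / (z - 1)) < 1 \<longrightarrow>
          (\<lambda>k. pochhammer a k * fact (m + n + k) / (fact (m + k) * fact k)
                * (Digamma (a + of_nat k) + Digamma (of_nat (m + n + k + 1))
                   - Digamma (of_nat (m + k + 1)) - Digamma (of_nat (k + 1)))
                * (z ^ k / (z - 1) ^ k)) sums S z) \<and>
       (\<forall>z\<in>upper_half_plane. U2 n m a z =
          F z * ln (z / (1 - z)) + of_real pi / tan (of_real pi * a) * F z
          + (-1) ^ (m + 1) * fact m / (pochhammer (1 - a) m * fact (m + n)) * z powi (- int m)
            * (1 - z) powr (of_nat m - a)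
            * (\<Sum>k<m. pochhammer (a - of_nat m) k * fact (m - k - 1) * fact (n + k) / fact k
                       * (z ^ k / (1 - z) ^ k))
          + fact m / fact (m + n) * (1 - z) powr (- a) * S z)) \<and>
    (\<exists>S. S holomorphic_on upper_half_plane \<and>
       (\<forall>z\<in>upper_half_plane. norm (z / (z - 1)) < 1 \<longrightarrow>
          (\<lambda>j. let k = n + 1 + j in
             pochhammer (of_nat (m + 1) - a) k * fact (k - n - 1) / (fact (m + k) * fact k)
                * (z ^ k / (z - 1) ^ k)) sums S z) \<and>
       (\<forall>z\<in>upper_half_plane. U2 n m a z =
          F z * ln (z / (1 - z))
          + (-1) ^ (m + 1) * fact m * fact n / pochhammer (1 - a) m * z powi (- int m)
            * (1 - z) ^ (n + m)
            * (\<Sum>k<m. pochhammer (1 - a) k * fact (m - k - 1) / (fact (m + n - k) * fact k)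
                       * (z ^ k / (z - 1) ^ k))
          + fact m * fact n * (1 - z) ^ n
            * (\<Sum>k\<le>n. pochhammer (of_nat (m + 1) - a) k / (fact (m + k) * fact (n - k) * fact k)
                       * (Digamma (of_nat (m + k + 1) - a) + Digamma (of_nat (n - k + 1))
                          - Digamma (of_nat (m + k + 1)) - Digamma (of_nat (k + 1)))
                       * (z ^ k / (1 - z) ^ k))
          + fact m * fact n * (z - 1) ^ n * S z))"
proof -
  have lim: "((\<lambda>b. U2_generic m a b z) \<longlongrightarrow> U2 n m a z) (at (- of_nat n))" if "z \<in> upper_half_plane" for z
    unfolding U2_eq[OF assms(1) that] by (rule tendsto_U2_generic[OF assms(1) that])
  show ?thesis
    unfolding F_def
    by (intro conjI ballI lim U2_eq U2_at_infinity U2_log_series_terminating U2_log_series_euler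
          U2_log_series_pfaff U2_log_series_terminating_pfaff assms(1))
qed

end
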